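(* Let $m$ be a positive integer, let $\delta \in (-m, 0)$, and put $\chi(\delta,m) = 1 - \frac{1}{2+\delta/m}$. For integers $T \ge 2$ let $X(T,\delta,m)$ be the preferential attachment clique complex. Let $q \geq 2$ be an integer and suppose $m \geq 2q$. Then, as $T \to \infty$, $$E\big[\beta_q(X(T, \delta, m))\big] = \begin{cases} \Theta\big(T^{1 - 2q\chi(\delta, m)}\big) & \text{ if } 1 - 2q\chi(\delta, m) > 0, \\ \Theta(\log T) & \text{ if } 1 - 2q\chi(\delta, m) = 0, \\ O(1) & \text{ otherwise,} \end{cases}$$ where the big-Oh and big-$\Theta$ constants depend only on $q, \delta, m$, and $E$ denotes expectation.
   Context: Preferential attachment graph: for integers $T\ge 2$, $m\ge 1$ and real $\delta>-m$, $G(T,\delta,m)$ is the random directed graph with no self-loops but possibly with repeated edges constructed inductively as follows. $G(2,\delta,m)$ is the deterministic graph with two nodes, indexed by $1$ and $2$, and $m$ edges from node $2$ to node $1$. $G(T,\delta,m)$ is constructed from $G(T-1,\delta,m)$ by adding a node with index $T$ and $m$ edges from node $T$ to randomly chosen nodes of $G(T-1,\delta,m)$, the edges being added one after another; for $1\le v\le T-1$, the probability that node $v$ is chosen as the endpoint of an edge is proportional to $\delta$ plus the (total) degree of node $v$, where the degree is updated every time an edge is added. Preferential attachment clique complex: let $G_{\text{simple}}(T,\delta,m)$ be the graph obtained from $G(T,\delta,m)$ by replacing all repeated edges with simple edges (directions are ignored). $X(T,\delta,m)$ is the clique complex of $G_{\text{simple}}(T,\delta,m)$, i.e. the simplicial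 complex whose simplices are the nonempty sets of nodes that are pairwise adjacent. $\beta_q(X)$ is the rank of the simplicial homology group $H_q(X)$ with coefficients in $\mathbb{Z}$ (unreduced). Asymptotic notation, for nonnegative functions $f,g$ on the natural numbers: $f(n)=O(g(n))$ means $f(n)\le C g(n)$ for all large enough $n$ for some constant $C>0$; $f(n)=\Theta(g(n))$ means $c g(n)\le f(n)\le C g(n)$ for all large enough $n$ for some constants $c,C>0$. *)

theory Defs
  imports
    "HOL-Probability.Probability"
    "HOL-Library.Landau_Symbols"
    "HOL-Algebra.Free_Abelian_Groups"
    "HOL-Library.Multiset"
begin

section \<open>Preferential attachment graphs\<close>

text \<open>
  A directed multigraph on the nodes \<open>{1..T}\<close> is the multiset of its edges
  \<open>(source, target)\<close>; the node set is kept implicit in \<open>T\<close>.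
\<close>

type_synonym multigraph = "(nat \<times> nat) multiset"

definition degree :: "multigraph \<Rightarrow> nat \<Rightarrow> nat" where
  "degree G v = size {#e \<in># G. fst e = v#} + size {#e \<in># G. snd e = v#}"

definition pa_weight :: "real \<Rightarrow> multigraph \<Rightarrow> nat \<Rightarrow> real" where
  "pa_weight \<delta> G v = \<delta> + real (degree G v)"

text \<open>
  The target of the next edge sent out by the node \<open>t\<close>, given the current multigraph \<open>G\<close>.
  The side conditions of \<^const>\<open>embed_pmf\<close> hold along the whole construction if \<open>\<delta> > - m\<close>:
  see \<open>pmf_pa_target\<close> and \<open>pa_weight_pos\<close> below.
\<close>

definition pa_target :: "real \<Rightarrow> nat \<Rightarrow> multigraph \<Rightarrow> nat pmf" where
  "pa_target \<delta> t G =
     embed_pmf (\<lambda>v. if v \<in> {1..<t} then pa_weight \<delta> G v / (\<Sum>u\<in>{1..<t}. pa_weight \<delta> G u) else 0)"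

primrec pa_add_edges :: "real \<Rightarrow> nat \<Rightarrow> nat \<Rightarrow> multigraph \<Rightarrow> multigraph pmf" where
  "pa_add_edges \<delta> t 0 G = return_pmf G"
| "pa_add_edges \<delta> t (Suc k) G =
     bind_pmf (pa_add_edges \<delta> t k G) (\<lambda>G'. map_pmf (\<lambda>v. add_mset (t, v) G') (pa_target \<delta> t G'))"

text \<open>Only the values at \<open>T \<ge> 2\<close> are meaningful; \<open>T < 2\<close> is filled with the graph for \<open>T = 2\<close>.\<close>

primrec pa_graph :: "nat \<Rightarrow> real \<Rightarrow> nat \<Rightarrow> multigraph pmf" where
  "pa_graph 0 \<delta> m = return_pmf (replicate_mset m (2, 1))"
| "pa_graph (Suc T) \<delta> m =
     (if Suc T \<le> 2 then return_pmf (replicate_mset m (2, 1))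
      else bind_pmf (pa_graph T \<delta> m) (pa_add_edges \<delta> (Suc T) m))"

lemma pmf_pa_target:
  assumes "t \<ge> 2" and pos: "\<And>u. u \<in> {1..<t} \<Longrightarrow> pa_weight \<delta> G u > 0"
  shows "pmf (pa_target \<delta> t G) v =
    (if v \<in> {1..<t} then pa_weight \<delta> G v / (\<Sum>u\<in>{1..<t}. pa_weight \<delta> G u) else 0)"
proof -
  let ?S = "\<Sum>u\<in>{1..<t}. pa_weight \<delta> G u"
  let ?f = "\<lambda>v. if v \<in> {1..<t} then pa_weight \<delta> G v / ?S else 0"
  have S: "?S > 0"
    using assms by (intro sum_pos) auto
  have nonneg: "?f u \<ge> 0" for u
    using S pos by (auto intro!: divide_nonneg_nonneg less_imp_le)
  have "(\<integral>\<^sup>+u. ennreal (?f u) \<partial>count_space UNIV) = (\<Sum>u\<in>{1..<t}. ennreal (?f u))"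
    by (rule nn_integral_count_space') auto
  also have "\<dots> = ennreal (\<Sum>u\<in>{1..<t}. ?f u)"
    using nonneg by (intro sum_ennreal) blast
  also have "(\<Sum>u\<in>{1..<t}. ?f u) = (\<Sum>u\<in>{1..<t}. pa_weight \<delta> G u / ?S)"
    by (rule sum.cong) auto
  also have "\<dots> = 1"
    using S by (simp flip: sum_divide_distrib)
  finally have "(\<integral>\<^sup>+u. ennreal (?f u) \<partial>count_space UNIV) = 1"
    by simp
  then show ?thesis
    unfolding pa_target_def by (rule pmf_embed_pmf[OF nonneg])
qed

lemma pa_add_edges_degree:
  assumes "G' \<in> set_pmf (pa_add_edges \<delta> t k G)"
  shows "degree G v \<le> degree G' v" and "k \<le> degree G' t"
  using assms
proof (induction k arbitrary: G')
  case (Suc k)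
  { case 1 then show ?case using Suc.IH(1) by (force simp: degree_def) }
  { case 2 then show ?case using Suc.IH(2) by (force simp: degree_def) }
qed auto

lemma pa_graph_degree:
  assumes "T \<ge> 2" "G \<in> set_pmf (pa_graph T \<delta> m)" "v \<in> {1..T}"
  shows "degree G v \<ge> m"
  using assms
proof (induction T arbitrary: G)
  case (Suc T)
  show ?case
  proof (cases "T = 1")
    case True
    then have "v = 1 \<or> v = 2" "G = replicate_mset m (2, 1)"
      using Suc.prems by auto
    moreover have "filter_mset P (replicate_mset m x) = (if P x then replicate_mset m x else {#})"
      for P and x :: "nat \<times> nat"
      by (induction m) auto
    ultimately show ?thesis
      by (auto simp: degree_def)
  next
    case False
    then obtain H where H: "H \<in> set_pmf (pa_graph T \<delta> m)" "G \<in> set_pmf (pa_add_edges \<delta> (Suc T) m H)"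
      using Suc.prems by auto
    show ?thesis
      using Suc.IH[OF _ H(1)] pa_add_edges_degree[OF H(2)] Suc.prems False
      by (cases "v = Suc T") (auto intro: order.trans)
  qed
qed simp

lemma pa_weight_pos:
  assumes "\<delta> > - real m" "T \<ge> 2" "G \<in> set_pmf (pa_graph T \<delta> m)"
    and "G' \<in> set_pmf (pa_add_edges \<delta> (Suc T) k G)" and "v \<in> {1..<Suc T}"
  shows "pa_weight \<delta> G' v > 0"
proof -
  have "m \<le> degree G v"
    using assms by (intro pa_graph_degree) auto
  also have "\<dots> \<le> degree G' v"
    using assms(4) by (rule pa_add_edges_degree)
  finally show ?thesis
    using assms(1) by (simp add: pa_weight_def)
qed


section \<open>Clique complexes\<close>

definition adjacent :: "multigraph \<Rightarrow> nat \<Rightarrow> nat \<Rightarrow> bool" where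
  "adjacent G u v \<longleftrightarrow> u \<noteq> v \<and> ((u, v) \<in># G \<or> (v, u) \<in># G)"

definition clique_complex :: "'a set \<Rightarrow> ('a \<Rightarrow> 'a \<Rightarrow> bool) \<Rightarrow> 'a set set" where
  "clique_complex V E = {\<sigma>. \<sigma> \<noteq> {} \<and> finite \<sigma> \<and> \<sigma> \<subseteq> V \<and> pairwise E \<sigma>}"

definition pa_complex :: "nat \<Rightarrow> multigraph \<Rightarrow> nat set set" where
  "pa_complex T G = clique_complex {1..T} (adjacent G)"


section \<open>Simplicial homology and Betti numbers\<close>

definition simplicial_chain_group :: "'a set set \<Rightarrow> nat \<Rightarrow> ('a set \<Rightarrow>\<^sub>0 int) monoid" where
  "simplicial_chain_group X q = free_Abelian_group {\<sigma> \<in> X. card \<sigma> = Suc q}"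

text \<open>
  Every simplex is oriented by the order of its vertices, so the face of \<open>\<sigma>\<close> opposite to \<open>v\<close>
  carries the sign \<open>(-1)^i\<close>, where \<open>i\<close> is the (zero-based) position of \<open>v\<close> in \<open>\<sigma>\<close>.
  The boundary of a vertex is zero, that is, homology is unreduced.
\<close>

definition simplicial_boundary :: "nat \<Rightarrow> ('a::linorder set \<Rightarrow>\<^sub>0 int) \<Rightarrow> ('a set \<Rightarrow>\<^sub>0 int)" where
  "simplicial_boundary q c =
     (if q = 0 then 0
      else frag_extend
        (\<lambda>\<sigma>. \<Sum>v\<in>\<sigma>. frag_cmul ((-1) ^ card {u \<in> \<sigma>. u < v}) (frag_of (\<sigma> - {v}))) c)"

definition simplicial_cycles :: "'a::linorder set set \<Rightarrow> nat \<Rightarrow> ('a set \<Rightarrow>\<^sub>0 int) set" where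
  "simplicial_cycles X q =
     {c \<in> carrier (simplicial_chain_group X q). simplicial_boundary q c = 0}"

definition simplicial_boundaries :: "'a::linorder set set \<Rightarrow> nat \<Rightarrow> ('a set \<Rightarrow>\<^sub>0 int) set" where
  "simplicial_boundaries X q =
     simplicial_boundary (Suc q) ` carrier (simplicial_chain_group X (Suc q))"

definition simplicial_homology_group ::
    "'a::linorder set set \<Rightarrow> nat \<Rightarrow> ('a set \<Rightarrow>\<^sub>0 int) set monoid" where
  "simplicial_homology_group X q =
     subgroup_generated (simplicial_chain_group X q) (simplicial_cycles X q)
       Mod simplicial_boundaries X q"

definition int_independent :: "('a, 'b) monoid_scheme \<Rightarrow> 'a set \<Rightarrow> bool" where
  "int_independent G B \<longleftrightarrow>
     (\<forall>a :: 'a \<Rightarrow> int. finprod G (\<lambda>x. x [^]\<^bsub>G\<^esub> a x) B = \<one>\<^bsub>G\<^esub> \<longrightarrow> (\<forall>x\<in>B. a x = 0))"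

text \<open>
  The rank of a (multiplicatively written) abelian group. The supremum is over a bounded set
  if the group is finitely generated, as are the homology groups of a finite complex.
\<close>

definition group_rank :: "('a, 'b) monoid_scheme \<Rightarrow> nat" where
  "group_rank G = Sup {card B | B. finite B \<and> B \<subseteq> carrier G \<and> int_independent G B}"

definition betti :: "nat \<Rightarrow> 'a::linorder set set \<Rightarrow> nat" where
  "betti q X = group_rank (simplicial_homology_group X q)"


section \<open>Expected Betti numbers\<close>

definition expected_betti :: "nat \<Rightarrow> nat \<Rightarrow> real \<Rightarrow> nat \<Rightarrow> real" where
  "expected_betti q T \<delta> m =
     measure_pmf.expectation (pa_graph T \<delta> m) (\<lambda>G. real (betti q (pa_complex T G)))"

definition pa_chi :: "real \<Rightarrow> nat \<Rightarrow> real" where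
  "pa_chi \<delta> m = 1 - 1 / (2 + \<delta> / real m)"

end

theory Submission
  imports Defs "HOL-Library.Function_Algebras" "HOL-Real_Asymp.Real_Asymp"
begin

text \<open>
  The node \<open>T\<close> cones off its link \<open>L\<close>, a flag complex on at most \<open>m\<close> nodes. By the
  Mayer--Vietoris argument, \<open>\<beta>\<^sub>q\<close> grows by at most a constant, and only if \<open>L\<close> has
  reduced homology in degree \<open>q - 1\<close>; it drops only if \<open>L\<close> has homology in degree \<open>q\<close>; and it
  grows if a cycle that is not a boundary in \<open>L\<close> bounds in the old complex. A flag complex with
  homology in degree \<open>q - 1\<close> contains \<open>2 q\<close> vertices among which every vertex has at least
  \<open>2 q - 2 \<ge> 2\<close> neighbours.

  Products of rising factorials of the weights are martingales up to deterministic factors, so the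
  probability that prescribed edges \<open>(s, v)\<close> all occur is at most a constant times the product of
  the \<open>s powr - \<chi> * v powr - (1 - \<chi>)\<close>. Summing over all such configurations of \<open>2 q\<close>
  neighbours of \<open>T\<close>, the exponent of every old node is at most \<open>- 1 - \<chi>\<close>, so the sum converges
  and the expected increment is \<open>O(T powr - 2 q \<chi>)\<close>. Conversely, with positive probability the
  first \<open>2 q + 2\<close> nodes contain a cross-polytope on \<open>2 q\<close> nodes together with a cone over it, and
  \<open>T\<close> caps this cross-polytope, without filling it in its own link, with probability of the
  same order.
\<close>

section \<open>Finite-dimensional subspaces\<close>

text \<open>Targets are drawn according to degrees that change after every edge, so edge events are
  dependent and their probabilities do not factor. The remedy is
  \<open>x * pochhammer (x + 1) k = pochhammer x (Suc k)\<close>: drawing a target of weight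
  \<open>x\<close> absorbs \<open>x\<close> into a rising factorial. The edges of the last node thus
  only raise the demands \<open>\<kappa>\<close> on older weights, and peeling off the last node
  stays within one family of expectations.

  A weight grows like \<open>t powr theta\<close> with \<open>theta = 1 - chi\<close>, while the
  total weight is linear; hence the cost of an edge \<open>(s, v)\<close>. In a configuration an old
  node \<open>w\<close> gets exponent \<open>- theta\<close> from the edge of \<open>T\<close> and
  at most \<open>- chi\<close> from each of two further edges, in sum \<open>- 1 - chi\<close>. Here
  \<open>\<delta> < 0\<close> gives \<open>chi < theta\<close>, and \<open>q \<ge> 2\<close>
  supplies the two edges.

  Homology of the link in degree \<open>q\<close> needs \<open>2 q + 2\<close> neighbours, so losses
  are smaller than gains by \<open>T powr (- 2 * chi)\<close>.

  Ranks over the integers become rational dimensions because denominators can be cleared. The three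
  regimes come from one comparison of the increments with an antiderivative of
  \<open>x powr (- 2 q \<chi>)\<close>.\<close>

context vector_space
begin

text \<open>Extend \<open>B\<close> to a basis of \<open>W\<close>. Rational chains will be
  arbitrary functions on sets, an infinite-dimensional space, so every dimension count carries a
  finite \<open>F\<close> whose span contains the sets concerned.\<close>

lemma card_le_dim_finite:
  assumes "B \<subseteq> W" "independent B" "W \<subseteq> span F" "finite F"
  shows "finite B" "card B \<le> dim W"
proof -
  obtain C where C: "B \<subseteq> C" "C \<subseteq> W" "independent C" "W \<subseteq> span C"
    using maximal_independent_subset_extend[OF assms(1,2)] by blast
  have "finite C"
    using independent_span_bound[of F C] C assms by auto
  moreover have "card C = dim W"
    using C by (intro basis_card_eq_dim)
  ultimately show "finite B" "card B \<le> dim W"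
    using C(1) by (auto intro: finite_subset card_mono simp flip: \<open>card C = dim W\<close>)
qed

lemma dim_mono_finite:
  assumes "V \<subseteq> span W" "W \<subseteq> span F" "finite F"
  shows "dim V \<le> dim W"
proof -
  obtain B where B: "B \<subseteq> W" "independent B" "W \<subseteq> span B" "card B = dim W"
    by (rule basis_exists)
  have "finite B"
    using card_le_dim_finite[OF B(1,2) assms(2,3)] by simp
  moreover have "V \<subseteq> span B"
    using assms(1) span_minimal[OF B(3) subspace_span] by blast
  ultimately show ?thesis
    using dim_le_card[of V B] B(4) by simp
qed

lemma dim_subset_finite:
  assumes "V \<subseteq> W" "W \<subseteq> span F" "finite F"
  shows "dim V \<le> dim W"
  using assms(1) span_superset by (intro dim_mono_finite[OF _ assms(2,3)]) (rule order.trans)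

lemma dim_strict_mono_finite:
  assumes "subspace V" "V \<subseteq> W" "x \<in> W" "x \<notin> V" "W \<subseteq> span F" "finite F"
  shows "dim V < dim W"
proof -
  obtain B where B: "B \<subseteq> V" "independent B" "V \<subseteq> span B" "card B = dim V"
    by (rule basis_exists)
  have "span B = V"
    using B(1,3) span_minimal[OF B(1) assms(1)] by blast
  then have ind: "independent (insert x B)"
    using assms(4) B(2) by (subst independent_insert) auto
  have sub: "insert x B \<subseteq> W"
    using B(1) assms(2,3) by auto
  have "x \<notin> B"
    using B(1) assms(4) by auto
  then have "card (insert x B) = Suc (dim V)"
    using card_le_dim_finite(1)[OF sub ind assms(5,6)] B(4) by simp
  then show ?thesis
    using card_le_dim_finite(2)[OF sub ind assms(5,6)] by simp
qed

lemma rank_nullity_finite: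
  assumes "Vector_Spaces.linear scale scale f" "subspace S" "S \<subseteq> span F" "finite F"
  shows "dim S = dim {x \<in> S. f x = 0} + dim (f ` S)"
proof -
  interpret f: Vector_Spaces.linear scale scale f by fact
  define K where "K = {x \<in> S. f x = 0}"
  have "subspace K"
    using assms(2) unfolding K_def subspace_def by (auto simp: f.add f.scale f.zero)
  obtain B0 where B0: "B0 \<subseteq> K" "independent B0" "K \<subseteq> span B0" "card B0 = dim K"
    by (rule basis_exists)
  have "B0 \<subseteq> S"
    using B0(1) by (auto simp: K_def)
  then obtain B where B: "B0 \<subseteq> B" "B \<subseteq> S" "independent B" "S \<subseteq> span B"
    using maximal_independent_subset_extend[OF _ B0(2)] by blast
  have "finite B"
    using card_le_dim_finite(1)[OF B(2,3) assms(3,4)] .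
  define C where "C = B - B0"
  have "independent C"
    using B(3) by (rule independent_mono) (auto simp: C_def)
  have "span C \<subseteq> S"
    using B(2) assms(2) by (intro span_minimal) (auto simp: C_def)
  \<comment> \<open>Such an \<open>x\<close> lies in \<open>span B0\<close> and in
    \<open>span C\<close>. Its representation over \<open>B\<close> is supported on both, and these
    are disjoint.\<close>
  have zero: "x = 0" if x: "x \<in> span C" "f x = 0" for x
  proof -
    have "x \<in> span B0"
      using x B0(3) \<open>span C \<subseteq> S\<close> by (auto simp: K_def)
    then have "representation B x = representation B0 x" "representation B x = representation C x"
      using B(1,3) x(1) by (auto intro!: representation_extend simp: C_def)
    moreover have "b \<in> B0 \<inter> C" if "representation B0 x b \<noteq> 0" "representation C x b \<noteq> 0" for b
      using that by (auto dest: representation_ne_zero)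
    ultimately have "representation B x b = 0" for b
      unfolding C_def by fastforce
    moreover have "x \<in> span B"
      using x(1) span_mono[of C B] by (auto simp: C_def)
    ultimately show "x = 0"
      using sum_nonzero_representation_eq[OF B(3)] by fastforce
  qed
  have inj: "inj_on f (span C)"
    using zero by (subst f.inj_on_iff_eq_0) auto
  have "independent (f ` C)"
    using f.independent_injective_image[OF \<open>independent C\<close> inj] .
  moreover have "f ` S \<subseteq> span (f ` C)"
  proof -
    have "B \<subseteq> B0 \<union> C"
      by (auto simp: C_def)
    then have "f ` B \<subseteq> span (f ` C)"
      using B0(1) by (force simp: K_def span_zero intro: span_base)
    then have "span (f ` B) \<subseteq> span (f ` C)"
      by (intro span_minimal subspace_span)
    then show ?thesis
      using B(4) by (auto simp: f.span_image)
  qed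
  moreover have "f ` C \<subseteq> f ` S"
    using B(2) by (auto simp: C_def)
  ultimately have "card (f ` C) = dim (f ` S)"
    by (intro basis_card_eq_dim)
  moreover have "card (f ` C) = card C"
    using inj_on_subset[OF inj span_superset] by (rule card_image)
  moreover have "card B = card B0 + card C"
    using \<open>finite B\<close> B(1) by (auto simp: C_def card_Diff_subset finite_subset card_mono)
  moreover have "card B = dim S"
    using B by (intro basis_card_eq_dim)
  ultimately show ?thesis
    using B0(4) by (simp add: K_def)
qed

end


section \<open>Rational chains\<close>

definition chain_scale :: "rat \<Rightarrow> ('a \<Rightarrow> rat) \<Rightarrow> 'a \<Rightarrow> rat" where
  "chain_scale c f = (\<lambda>\<sigma>. c * f \<sigma>)"

interpretation chain: vector_space chain_scale
  by standard (auto simp: chain_scale_def fun_eq_iff algebra_simps)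

lemma sum_fun_apply: "(\<Sum>i\<in>A. f i) x = (\<Sum>i\<in>A. f i x)" for f :: "'i \<Rightarrow> 'a \<Rightarrow> 'b::comm_monoid_add"
  by (induction A rule: infinite_finite_induct) auto

definition vertex_sign :: "nat \<Rightarrow> nat set \<Rightarrow> rat" where
  "vertex_sign v \<sigma> = (- 1) ^ card {u \<in> \<sigma>. u < v}"

text \<open>
  \<open>contract v\<close> and \<open>wedge v\<close> satisfy the anticommutation relations of the annihilation and
  creation operators of an exterior algebra; the boundary operator is the sum of all \<open>contract v\<close>.
\<close>

definition contract :: "nat \<Rightarrow> (nat set \<Rightarrow> rat) \<Rightarrow> nat set \<Rightarrow> rat" where
  "contract v f \<tau> = (if v \<in> \<tau> then 0 else vertex_sign v \<tau> * f (insert v \<tau>))"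

definition wedge :: "nat \<Rightarrow> (nat set \<Rightarrow> rat) \<Rightarrow> nat set \<Rightarrow> rat" where
  "wedge v f \<sigma> = (if v \<in> \<sigma> then vertex_sign v \<sigma> * f (\<sigma> - {v}) else 0)"

lemma vertex_sign_insert:
  assumes "v \<noteq> w" "w \<notin> \<sigma>"
  shows "vertex_sign v (insert w \<sigma>) = (if w < v then - vertex_sign v \<sigma> else vertex_sign v \<sigma>)"
proof (cases "w < v")
  case True
  then have "{u \<in> insert w \<sigma>. u < v} = insert w {u \<in> \<sigma>. u < v}"
    by auto
  then show ?thesis
    using True assms by (simp add: vertex_sign_def)
next
  case False
  then have "{u \<in> insert w \<sigma>. u < v} = {u \<in> \<sigma>. u < v}"
    by auto
  then show ?thesis
    using False by (simp add: vertex_sign_def)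
qed

lemma vertex_sign_insert_same [simp]: "vertex_sign v (insert v \<sigma>) = vertex_sign v \<sigma>"
  unfolding vertex_sign_def by (rule arg_cong[where f = "\<lambda>A. (- 1) ^ card A"]) auto

lemma vertex_sign_Diff_same [simp]: "vertex_sign v (\<sigma> - {v}) = vertex_sign v \<sigma>"
  unfolding vertex_sign_def by (rule arg_cong[where f = "\<lambda>A. (- 1) ^ card A"]) auto

lemma vertex_sign_Diff:
  assumes "v \<noteq> w" "w \<in> \<sigma>"
  shows "vertex_sign v (\<sigma> - {w}) = (if w < v then - vertex_sign v \<sigma> else vertex_sign v \<sigma>)"
  using vertex_sign_insert[of v w "\<sigma> - {w}"] assms by (auto simp: insert_absorb split: if_splits)

lemma vertex_sign_square [simp]: "vertex_sign v \<sigma> * vertex_sign v \<sigma> = 1"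
  by (simp add: vertex_sign_def flip: power_mult_distrib)

lemma vertex_sign_square' [simp]: "vertex_sign v \<sigma> * (vertex_sign v \<sigma> * a) = a"
  by (simp flip: mult.assoc)

lemma vertex_sign_nonzero [simp]: "vertex_sign v \<sigma> \<noteq> 0"
  by (simp add: vertex_sign_def)

lemma contract_add: "contract v (f + g) = contract v f + contract v g"
  by (auto simp: contract_def fun_eq_iff algebra_simps)

lemma contract_scale: "contract v (chain_scale c f) = chain_scale c (contract v f)"
  by (auto simp: contract_def chain_scale_def fun_eq_iff algebra_simps)

lemma contract_uminus: "contract v (- f) = - contract v f"
  by (auto simp: contract_def fun_eq_iff)

lemma contract_zero [simp]: "contract v 0 = 0"
  by (auto simp: contract_def fun_eq_iff)

lemma contract_sum: "contract v (sum f A) = (\<Sum>i\<in>A. contract v (f i))"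
  using sum_comp_morphism[of "contract v" f A] by (simp add: contract_add comp_def)

lemma wedge_zero [simp]: "wedge v 0 = 0"
  by (auto simp: wedge_def fun_eq_iff)

lemma wedge_add: "wedge v (f + g) = wedge v f + wedge v g"
  by (auto simp: wedge_def fun_eq_iff algebra_simps)

lemma wedge_sum: "wedge v (sum f A) = (\<Sum>i\<in>A. wedge v (f i))"
  using sum_comp_morphism[of "wedge v" f A] by (simp add: wedge_add comp_def)

text \<open>Of two distinct vertices, only the larger changes its position when the other is
  removed, so exchanging the order flips exactly one sign.\<close>

lemma contract_contract: "contract v (contract w f) = - contract w (contract v f)"
proof (cases "v = w")
  case True
  then show ?thesis by (auto simp: contract_def fun_eq_iff)
next
  case False
  then show ?thesis
    by (auto simp: contract_def fun_eq_iff vertex_sign_insert insert_commute)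
qed

text \<open>Both sides are the part of \<open>f\<close> on sets without \<open>v\<close>;
  \<open>wedge v (contract v f)\<close> is the part on sets containing \<open>v\<close>. This splits
  a chain into simplices through \<open>v\<close> and simplices avoiding it.\<close>

lemma contract_wedge_same: "contract v (wedge v f) = f - wedge v (contract v f)"
  by (auto simp: contract_def wedge_def fun_eq_iff insert_absorb)

lemma contract_wedge:
  assumes "v \<noteq> w"
  shows "contract v (wedge w f) = - wedge w (contract v f)"
proof
  fix \<tau>
  show "contract v (wedge w f) \<tau> = (- wedge w (contract v f)) \<tau>"
  proof (cases "v \<notin> \<tau> \<and> w \<in> \<tau>")
    case True
    then have "insert v \<tau> - {w} = insert v (\<tau> - {w})"
      using assms by auto
    then show ?thesis
      using True assms by (auto simp: contract_def wedge_def vertex_sign_insert vertex_sign_Diff)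
  qed (use assms in \<open>auto simp: contract_def wedge_def\<close>)
qed

lemma linear_contract: "Vector_Spaces.linear chain_scale chain_scale (contract v)"
  by (auto simp: Vector_Spaces.linear_iff contract_add contract_scale chain.vector_space_axioms)

text \<open>Summing over an ambient set \<open>U\<close> instead of the vertices of the simplices
  lets one operator serve all subcomplexes.\<close>

definition boundary :: "nat set \<Rightarrow> (nat set \<Rightarrow> rat) \<Rightarrow> nat set \<Rightarrow> rat" where
  "boundary U f = (\<Sum>v\<in>U. contract v f)"

lemma boundary_add: "boundary U (f + g) = boundary U f + boundary U g"
  by (simp add: boundary_def contract_add sum.distrib)

lemma boundary_scale: "boundary U (chain_scale c f) = chain_scale c (boundary U f)"
  by (simp add: boundary_def contract_scale chain.scale_sum_right)

lemma boundary_uminus: "boundary U (- f) = - boundary U f"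
  by (simp add: boundary_def contract_uminus sum_negf)

lemma boundary_zero [simp]: "boundary U 0 = 0"
  by (simp add: boundary_def)

lemma boundary_diff: "boundary U (f - g) = boundary U f - boundary U g"
  using boundary_add[of U f "- g"] by (simp add: boundary_uminus)

lemma contract_boundary: "contract x (boundary U f) = - boundary U (contract x f)"
  by (simp add: boundary_def contract_sum contract_contract[of x] sum_negf)

text \<open>By anticommutation and an exchange of the two sums, the expression equals its own
  negative.\<close>

lemma boundary_boundary [simp]: "boundary U (boundary U f) = 0"
proof -
  have "boundary U (boundary U f) = (\<Sum>v\<in>U. \<Sum>w\<in>U. contract v (contract w f))"
    by (simp add: boundary_def contract_sum)
  also have "\<dots> = (\<Sum>v\<in>U. \<Sum>w\<in>U. - contract w (contract v f))"
    by (subst contract_contract) (rule refl)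
  also have "\<dots> = - (\<Sum>w\<in>U. \<Sum>v\<in>U. contract w (contract v f))"
    by (subst sum.swap) (simp add: sum_negf)
  also have "\<dots> = - boundary U (boundary U f)"
    by (simp add: boundary_def contract_sum)
  finally show ?thesis
    by (auto simp: fun_eq_iff)
qed

text \<open>The cone formula: the summand \<open>v = x\<close> produces \<open>f\<close>, every
  other one anticommutes with \<open>wedge x\<close>.\<close>

lemma boundary_wedge:
  assumes "finite U" "x \<in> U"
  shows "boundary U (wedge x f) = f - wedge x (boundary U f)"
proof -
  have "boundary U (wedge x f) = contract x (wedge x f) + (\<Sum>v\<in>U - {x}. contract v (wedge x f))"
    unfolding boundary_def using assms by (rule sum.remove)
  also have "(\<Sum>v\<in>U - {x}. contract v (wedge x f)) = - (\<Sum>v\<in>U - {x}. wedge x (contract v f))"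
    by (simp add: contract_wedge sum_negf)
  also have "contract x (wedge x f) = f - wedge x (contract x f)"
    by (rule contract_wedge_same)
  also have "f - wedge x (contract x f) + - (\<Sum>v\<in>U - {x}. wedge x (contract v f)) =
      f - (\<Sum>v\<in>U. wedge x (contract v f))"
    using assms by (simp add: sum.remove[of U x "\<lambda>v. wedge x (contract v f)"])
  finally show ?thesis
    by (simp add: boundary_def wedge_sum)
qed


section \<open>Flag complexes\<close>

definition link :: "('a \<Rightarrow> 'a \<Rightarrow> bool) \<Rightarrow> 'a \<Rightarrow> 'a set \<Rightarrow> 'a set" where
  "link E x V = {v \<in> V. v \<noteq> x \<and> E x v}"

lemma link_subset: "link E x V \<subseteq> V"
  by (auto simp: link_def)

definition cliques :: "('a \<Rightarrow> 'a \<Rightarrow> bool) \<Rightarrow> 'a set \<Rightarrow> nat \<Rightarrow> 'a set set" where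
  "cliques E V n = {\<sigma>. finite \<sigma> \<and> \<sigma> \<subseteq> V \<and> card \<sigma> = n \<and> pairwise E \<sigma>}"

text \<open>
  The augmented chain complex of a flag complex, graded by the number of vertices of a simplex:
  degree \<open>n\<close> is dimension \<open>n - 1\<close>, and the empty simplex spans degree \<open>0\<close>.
  The finite set \<open>U\<close> contains all vertices.
\<close>

locale flag =
  fixes E :: "nat \<Rightarrow> nat \<Rightarrow> bool" and U :: "nat set"
  assumes finite_U: "finite U" and E_sym: "E u v \<Longrightarrow> E v u"
begin

definition chains :: "nat set \<Rightarrow> nat \<Rightarrow> (nat set \<Rightarrow> rat) set" where
  "chains V n = {f. \<forall>\<sigma>. f \<sigma> \<noteq> 0 \<longrightarrow> \<sigma> \<in> cliques E V n}"

definition cycles :: "nat set \<Rightarrow> nat \<Rightarrow> (nat set \<Rightarrow> rat) set" where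
  "cycles V n = {f \<in> chains V n. boundary U f = 0}"

definition boundaries :: "nat set \<Rightarrow> nat \<Rightarrow> (nat set \<Rightarrow> rat) set" where
  "boundaries V n = boundary U ` chains V (Suc n)"

text \<open>For \<open>V \<subseteq> U\<close> the subtraction does not truncate, by
  \<open>dim_boundaries_le\<close>. Because degrees count vertices, the \<open>q\<close>-th Betti
  number is the value at \<open>Suc q\<close>.\<close>

definition betti_number :: "nat set \<Rightarrow> nat \<Rightarrow> nat" where
  "betti_number V n = chain.dim (cycles V n) - chain.dim (boundaries V n)"

lemma finite_vertices: "V \<subseteq> U \<Longrightarrow> finite V"
  using finite_U by (rule rev_finite_subset)

lemma finite_cliques: "V \<subseteq> U \<Longrightarrow> finite (cliques E V n)"
  by (rule finite_subset[of _ "Pow V"]) (use finite_vertices[of V] in \<open>auto simp: cliques_def\<close>)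

lemma card_cliques_le: "V \<subseteq> U \<Longrightarrow> card (cliques E V n) \<le> 2 ^ card V"
  using card_mono[of "Pow V" "cliques E V n"] finite_vertices[of V] by (force simp: cliques_def card_Pow)

lemma subspace_chains: "chain.subspace (chains V n)"
  unfolding chain.subspace_def
proof (intro conjI ballI allI)
  fix f g assume "f \<in> chains V n" "g \<in> chains V n"
  moreover have "f \<sigma> \<noteq> 0 \<or> g \<sigma> \<noteq> 0" if "(f + g) \<sigma> \<noteq> 0" for \<sigma>
    using that by auto
  ultimately show "f + g \<in> chains V n"
    unfolding chains_def by blast
qed (auto simp: chains_def chain_scale_def)

lemma subspace_cycles: "chain.subspace (cycles V n)"
  using subspace_chains[of V n]
  by (auto simp: chain.subspace_def cycles_def boundary_add boundary_scale)

lemma subspace_boundaries: "chain.subspace (boundaries V n)"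
  unfolding chain.subspace_def boundaries_def
proof safe
  show "0 \<in> boundary U ` chains V (Suc n)"
    using chain.subspace_0[OF subspace_chains] by (force intro: image_eqI[of _ _ 0])
  show "boundary U f + boundary U g \<in> boundary U ` chains V (Suc n)"
    if "f \<in> chains V (Suc n)" "g \<in> chains V (Suc n)" for f g
    using that chain.subspace_add[OF subspace_chains] by (auto simp flip: boundary_add)
  show "chain_scale c (boundary U f) \<in> boundary U ` chains V (Suc n)"
    if "f \<in> chains V (Suc n)" for c f
    using that chain.subspace_scale[OF subspace_chains] by (auto simp flip: boundary_scale)
qed

lemmas chains_closed =
  chain.subspace_0[OF subspace_chains] chain.subspace_add[OF subspace_chains]
  chain.subspace_diff[OF subspace_chains] chain.subspace_neg[OF subspace_chains]
  chain.subspace_sum[OF subspace_chains]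

lemma chains_mono: "V \<subseteq> W \<Longrightarrow> chains V n \<subseteq> chains W n"
  by (fastforce simp: chains_def cliques_def)

lemma cycles_mono: "V \<subseteq> W \<Longrightarrow> cycles V n \<subseteq> cycles W n"
  using chains_mono[of V W] by (auto simp: cycles_def)

lemma boundaries_mono: "V \<subseteq> W \<Longrightarrow> boundaries V n \<subseteq> boundaries W n"
  using chains_mono[of V W] by (auto simp: boundaries_def)

lemma contract_chains_subset:
  assumes "f \<in> chains V (Suc n)"
  shows "contract v f \<in> chains V n"
  unfolding chains_def
proof safe
  fix \<tau> assume "contract v f \<tau> \<noteq> 0"
  then have "v \<notin> \<tau>" "f (insert v \<tau>) \<noteq> 0"
    by (auto simp: contract_def split: if_splits)
  then show "\<tau> \<in> cliques E V n"
    using assms by (auto simp: chains_def cliques_def pairwise_insert)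
qed

lemma boundary_chains: "f \<in> chains V (Suc n) \<Longrightarrow> boundary U f \<in> chains V n"
  unfolding boundary_def by (intro chains_closed contract_chains_subset)

lemma boundaries_subset_cycles: "boundaries V n \<subseteq> cycles V n"
  by (auto simp: boundaries_def cycles_def boundary_chains)

lemma chains_subset_span:
  assumes "V \<subseteq> U"
  shows "chains V n \<subseteq> chain.span ((\<lambda>\<sigma>. indicator {\<sigma>}) ` cliques E V n)"
proof
  fix f assume f: "f \<in> chains V n"
  have "f = (\<Sum>\<sigma>\<in>cliques E V n. chain_scale (f \<sigma>) (indicator {\<sigma>}))"
  proof
    fix \<tau>
    show "f \<tau> = (\<Sum>\<sigma>\<in>cliques E V n. chain_scale (f \<sigma>) (indicator {\<sigma>})) \<tau>"
      using f finite_cliques[OF assms]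
      by (cases "\<tau> \<in> cliques E V n")
        (auto simp: sum_fun_apply chain_scale_def indicator_def chains_def if_distrib cong: if_cong)
  qed
  also have "\<dots> \<in> chain.span ((\<lambda>\<sigma>. indicator {\<sigma>}) ` cliques E V n)"
    by (intro chain.span_sum chain.span_scale chain.span_base) auto
  finally show "f \<in> chain.span ((\<lambda>\<sigma>. indicator {\<sigma>}) ` cliques E V n)" .
qed

lemma finite_span_chains:
  assumes "V \<subseteq> U"
  obtains F where "finite F" "card F \<le> 2 ^ card V" "chains V n \<subseteq> chain.span F"
proof
  let ?F = "(\<lambda>\<sigma>. indicator {\<sigma>} :: nat set \<Rightarrow> rat) ` cliques E V n"
  show "finite ?F" "chains V n \<subseteq> chain.span ?F"
    using assms by (auto simp: finite_cliques intro!: chains_subset_span)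
  show "card ?F \<le> 2 ^ card V"
    using card_image_le[OF finite_cliques[OF assms]] card_cliques_le[OF assms] by (rule order.trans)
qed

lemma finite_span_cycles:
  assumes "V \<subseteq> U"
  obtains F where "finite F" "card F \<le> 2 ^ card V" "cycles V n \<subseteq> chain.span F"
proof -
  obtain F where "finite F" "card F \<le> 2 ^ card V" "chains V n \<subseteq> chain.span F"
    using finite_span_chains[OF assms] .
  moreover have "cycles V n \<subseteq> chains V n"
    by (auto simp: cycles_def)
  ultimately show ?thesis
    using that by blast
qed

lemma dim_boundaries_le:
  assumes "V \<subseteq> U"
  shows "chain.dim (boundaries V n) \<le> chain.dim (cycles V n)"
proof -
  obtain F where "finite F" "cycles V n \<subseteq> chain.span F"
    using finite_span_cycles[OF assms] .
  then show ?thesis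
    by (intro chain.dim_subset_finite[OF boundaries_subset_cycles])
qed

lemma dim_cycles_le: "V \<subseteq> U \<Longrightarrow> chain.dim (cycles V n) \<le> 2 ^ card V"
  by (rule finite_span_cycles[of V n]) (use chain.dim_le_card order.trans in blast)+

section \<open>Adding a vertex: chains through it and chains of its link\<close>

lemma contract_chains:
  assumes "f \<in> chains (insert x V) (Suc n)" "x \<notin> V"
  shows "contract x f \<in> chains (link E x V) n"
  unfolding chains_def
proof safe
  fix \<tau> assume "contract x f \<tau> \<noteq> 0"
  then have "x \<notin> \<tau>" "f (insert x \<tau>) \<noteq> 0"
    by (auto simp: contract_def split: if_splits)
  then have "insert x \<tau> \<in> cliques E (insert x V) (Suc n)"
    using assms(1) by (auto simp: chains_def)
  then show "\<tau> \<in> cliques E (link E x V) n"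
    using assms(2) \<open>x \<notin> \<tau>\<close> by (auto simp: cliques_def pairwise_insert link_def)
qed

lemma insert_mem_cliques:
  assumes "\<tau> \<in> cliques E W n" "x \<notin> \<tau>" "\<And>v. v \<in> \<tau> \<Longrightarrow> E x v" "insert x W \<subseteq> V"
  shows "insert x \<tau> \<in> cliques E V (Suc n)"
  using assms E_sym by (auto simp: cliques_def pairwise_insert)

lemma wedge_chains:
  assumes "f \<in> chains (link E x V) n"
  shows "wedge x f \<in> chains (insert x V) (Suc n)"
  unfolding chains_def
proof safe
  fix \<sigma> assume "wedge x f \<sigma> \<noteq> 0"
  then have *: "x \<in> \<sigma>" "f (\<sigma> - {x}) \<noteq> 0"
    by (auto simp: wedge_def split: if_splits)
  then have "\<sigma> - {x} \<in> cliques E (link E x V) n"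
    using assms by (auto simp: chains_def)
  then have "insert x (\<sigma> - {x}) \<in> cliques E (insert x V) (Suc n)"
    by (rule insert_mem_cliques) (use \<open>\<sigma> - {x} \<in> _\<close> in \<open>auto simp: cliques_def link_def\<close>)
  then show "\<sigma> \<in> cliques E (insert x V) (Suc n)"
    using * by (simp add: insert_absorb)
qed

lemma contract_chains_eq_0:
  assumes "f \<in> chains V n" "x \<notin> V"
  shows "contract x f = 0"
  using assms by (fastforce simp: contract_def chains_def cliques_def)

lemma contract_wedge_chains:
  assumes "f \<in> chains V n" "x \<notin> V"
  shows "contract x (wedge x f) = f"
  using contract_chains_eq_0[OF assms] by (simp add: contract_wedge_same)

lemma chains_if_contract_eq_0:
  assumes "f \<in> chains (insert x V) n" "contract x f = 0"
  shows "f \<in> chains V n"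
  unfolding chains_def
proof safe
  fix \<sigma> assume nz: "f \<sigma> \<noteq> 0"
  have "contract x f (\<sigma> - {x}) = 0"
    using assms(2) by simp
  then have "x \<notin> \<sigma>"
    using nz by (auto simp: contract_def insert_absorb)
  moreover have "\<sigma> \<in> cliques E (insert x V) n"
    using assms(1) nz by (auto simp: chains_def)
  ultimately show "\<sigma> \<in> cliques E V n"
    by (auto simp: cliques_def)
qed

lemma contract_wedge_mem_chains:
  assumes "f \<in> chains (insert x V) n"
  shows "contract x (wedge x f) \<in> chains V n"
  using assms by (force simp: chains_def cliques_def contract_def wedge_def split: if_splits)

text \<open>
  For a new vertex \<open>x\<close> with link \<open>L\<close>, contraction with \<open>x\<close> sends a cycle to the
  cycle of \<open>L\<close> along which the star of \<open>x\<close> meets the old complex.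
\<close>

lemma contract_image_cycles:
  assumes "x \<notin> V" "x \<in> U"
  shows "contract x ` cycles (insert x V) (Suc n) = cycles (link E x V) n \<inter> boundaries V n"
proof (intro equalityI subsetI)
  fix b assume "b \<in> contract x ` cycles (insert x V) (Suc n)"
  then obtain f where f: "f \<in> chains (insert x V) (Suc n)" "boundary U f = 0" and b: "b = contract x f"
    by (auto simp: cycles_def)
  have cyc: "boundary U b = 0"
    using contract_boundary[of x U f] f(2) b by simp
  define a where "a = contract x (wedge x f)"
  have a: "a \<in> chains V (Suc n)"
    using contract_wedge_mem_chains[OF f(1)] by (simp add: a_def)
  \<comment> \<open>The simplices through \<open>x\<close> form the cone over \<open>b\<close>, and
    \<open>a\<close> collects the others. Since \<open>b\<close> is a cycle, taking boundaries
    leaves \<open>b + boundary U a = 0\<close>.\<close>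
  have "f = wedge x b + a"
    by (simp add: a_def b contract_wedge_same)
  then have "0 = b + boundary U a"
    using f(2) cyc boundary_wedge[OF finite_U assms(2), of b] by (simp add: boundary_add)
  then have "b = boundary U (- a)"
    by (simp add: boundary_uminus eq_neg_iff_add_eq_0)
  then show "b \<in> cycles (link E x V) n \<inter> boundaries V n"
    using contract_chains[OF f(1) assms(1)] cyc b a
    by (auto simp: cycles_def boundaries_def intro!: imageI chains_closed)
next
  fix b assume "b \<in> cycles (link E x V) n \<inter> boundaries V n"
  then obtain a where a: "a \<in> chains V (Suc n)" "b = boundary U a"
    and b: "b \<in> chains (link E x V) n" "boundary U b = 0"
    by (auto simp: cycles_def boundaries_def)
  \<comment> \<open>The cone over \<open>b\<close> and the filling \<open>a\<close> inside the old
    complex have the same boundary, so they glue to a cycle.\<close>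
  have "wedge x b - a \<in> chains (insert x V) (Suc n)"
    using wedge_chains[OF b(1)] a chains_mono[of V "insert x V"] by (auto intro: chains_closed)
  moreover have "boundary U (wedge x b - a) = 0"
    using a b boundary_wedge[OF finite_U assms(2), of b] by (simp add: boundary_diff)
  moreover have "contract x (wedge x b - a) = b"
  proof -
    have "contract x (wedge x b + - a) = b"
      using contract_wedge_chains[of b "link E x V" n x] contract_chains_eq_0[OF a(1) assms(1)] b(1) assms(1)
      by (subst contract_add) (auto simp: contract_uminus link_def)
    then show ?thesis by simp
  qed
  ultimately show "b \<in> contract x ` cycles (insert x V) (Suc n)"
    by (auto simp: cycles_def intro: image_eqI[of _ _ "wedge x b - a"])
qed

lemma cycles_contract_kernel:
  assumes "x \<notin> V"
  shows "{f \<in> cycles (insert x V) n. contract x f = 0} = cycles V n"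
  using chains_if_contract_eq_0[of _ x V n] contract_chains_eq_0[of _ V n x] assms
    chains_mono[of V "insert x V" n]
  by (auto simp: cycles_def)

lemma contract_image_boundaries:
  assumes "x \<notin> V"
  shows "contract x ` boundaries (insert x V) (Suc n) = boundaries (link E x V) n"
proof (intro equalityI subsetI)
  fix b assume "b \<in> contract x ` boundaries (insert x V) (Suc n)"
  then obtain f where f: "f \<in> chains (insert x V) (Suc (Suc n))" "b = contract x (boundary U f)"
    by (auto simp: boundaries_def)
  have "b = boundary U (- contract x f)"
    by (simp add: f(2) contract_boundary boundary_uminus)
  then show "b \<in> boundaries (link E x V) n"
    using contract_chains[OF f(1) assms] by (auto simp: boundaries_def intro!: imageI chains_closed)
next
  fix b assume "b \<in> boundaries (link E x V) n"
  then obtain c where c: "c \<in> chains (link E x V) (Suc n)" "b = boundary U c"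
    by (auto simp: boundaries_def)
  \<comment> \<open>The minus sign compensates the anticommutation of \<open>contract x\<close> with
    the boundary.\<close>
  have "contract x (wedge x (- c)) = - c"
    using c(1) assms by (intro contract_wedge_chains[of _ "link E x V" "Suc n"]) (auto simp: link_def intro: chains_closed)
  then have "b = contract x (boundary U (wedge x (- c)))"
    by (simp add: contract_boundary boundary_uminus c(2))
  moreover have "wedge x (- c) \<in> chains (insert x V) (Suc (Suc n))"
    using c(1) by (intro wedge_chains chains_closed)
  ultimately show "b \<in> contract x ` boundaries (insert x V) (Suc n)"
    by (auto simp: boundaries_def)
qed

text \<open>Let \<open>b\<close> be the contraction of the bounding chain. A boundary without
  simplices through \<open>x\<close> forces \<open>b\<close> to be a cycle of the link, and the star
  of \<open>x\<close> contributes exactly \<open>b\<close> to that boundary. These are the cycles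
  that die when \<open>x\<close> arrives.\<close>

lemma boundaries_contract_kernel:
  assumes "x \<notin> V" "x \<in> U"
  shows "{f \<in> boundaries (insert x V) n. contract x f = 0} \<subseteq>
    {b + a |b a. b \<in> cycles (link E x V) n \<and> a \<in> boundaries V n}"
proof safe
  fix f assume "f \<in> boundaries (insert x V) n" "contract x f = 0"
  then obtain c where c: "c \<in> chains (insert x V) (Suc n)" "f = boundary U c"
    by (auto simp: boundaries_def)
  define b a where "b = contract x c" and "a = contract x (wedge x c)"
  have cyc: "boundary U b = 0"
    using \<open>contract x f = 0\<close> by (simp add: b_def c(2) contract_boundary)
  have "c = wedge x b + a"
    by (simp add: a_def b_def contract_wedge_same)
  then have "f = b + boundary U a"
    using cyc boundary_wedge[OF finite_U assms(2), of b] by (simp add: c(2) boundary_add)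
  moreover have "b \<in> cycles (link E x V) n"
    using cyc contract_chains[OF c(1) assms(1)] by (simp add: cycles_def b_def)
  moreover have "boundary U a \<in> boundaries V n"
    using contract_wedge_mem_chains[OF c(1)] by (simp add: a_def boundaries_def)
  ultimately show "\<exists>b a. f = b + a \<and> b \<in> cycles (link E x V) n \<and> a \<in> boundaries V n"
    by blast
qed

lemma boundaries_subset_contract_kernel:
  assumes "x \<notin> V"
  shows "boundaries V n \<subseteq> {f \<in> boundaries (insert x V) n. contract x f = 0}"
  using boundaries_mono[of V "insert x V"] boundaries_subset_cycles[of V n]
    contract_chains_eq_0[of _ V n x] assms by (auto simp: cycles_def)

text \<open>Rank-nullity for \<open>contract x\<close>. Together with
  \<open>dim_boundaries_insert\<close> this replaces the Mayer--Vietoris sequence. With link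
  \<open>L\<close>, the Betti number gains the dimension of
  \<open>cycles L n \<inter> boundaries V n\<close> minus that of \<open>boundaries L n\<close>, and
  loses the dimension by which the kernel of \<open>contract x\<close> on the new boundaries exceeds
  \<open>boundaries V (Suc n)\<close>.\<close>

lemma dim_cycles_insert:
  assumes "x \<notin> V" "insert x V \<subseteq> U"
  shows "chain.dim (cycles (insert x V) (Suc n)) =
    chain.dim (cycles V (Suc n)) + chain.dim (cycles (link E x V) n \<inter> boundaries V n)"
proof -
  obtain F where "finite F" "cycles (insert x V) (Suc n) \<subseteq> chain.span F"
    using finite_span_cycles[OF assms(2)] .
  then show ?thesis
    using chain.rank_nullity_finite[OF linear_contract[of x] subspace_cycles] assms
    by (simp add: contract_image_cycles cycles_contract_kernel)
qed

lemma dim_boundaries_insert: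
  assumes "x \<notin> V" "insert x V \<subseteq> U"
  shows "chain.dim (boundaries (insert x V) (Suc n)) =
    chain.dim {f \<in> boundaries (insert x V) (Suc n). contract x f = 0} +
    chain.dim (boundaries (link E x V) n)"
proof -
  obtain F where "finite F" "cycles (insert x V) (Suc n) \<subseteq> chain.span F"
    using finite_span_cycles[OF assms(2)] .
  then show ?thesis
    using chain.rank_nullity_finite[OF linear_contract[of x] subspace_boundaries, of "insert x V" "Suc n" F]
      assms boundaries_subset_cycles[of "insert x V" "Suc n"]
    by (simp add: contract_image_boundaries)
qed

text \<open>Vanishing of reduced rational homology in dimension \<open>n - 1\<close>.\<close>

definition acyclic_at :: "nat set \<Rightarrow> nat \<Rightarrow> bool" where
  "acyclic_at V n \<longleftrightarrow> cycles V n \<subseteq> boundaries V n"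

text \<open>The loss is nonnegative. The gain vanishes if every \<open>n\<close>-cycle of the link
  bounds there, and is otherwise at most the number of cliques of the link.\<close>

theorem betti_number_insert_le:
  assumes "x \<notin> V" "insert x V \<subseteq> U"
  shows "betti_number (insert x V) (Suc n) \<le>
    betti_number V (Suc n) + (if acyclic_at (link E x V) n then 0 else 2 ^ card (link E x V))"
proof -
  let ?L = "link E x V"
  have L: "?L \<subseteq> U"
    using assms(2) link_subset[of E x V] by blast
  obtain F where F: "finite F" "cycles (insert x V) (Suc n) \<subseteq> chain.span F"
    using finite_span_cycles[OF assms(2)] .
  obtain F' where F': "finite F'" "cycles ?L n \<subseteq> chain.span F'"
    using finite_span_cycles[OF L] .
  have "chain.dim (boundaries V (Suc n)) \<le> chain.dim {f \<in> boundaries (insert x V) (Suc n). contract x f = 0}"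
    using F boundaries_subset_cycles[of "insert x V" "Suc n"]
    by (intro chain.dim_subset_finite[OF boundaries_subset_contract_kernel[OF assms(1)] _ F(1)]) blast
  moreover have "chain.dim (cycles ?L n \<inter> boundaries V n) \<le>
      chain.dim (boundaries ?L n) + (if acyclic_at ?L n then 0 else 2 ^ card ?L)"
  proof (cases "acyclic_at ?L n")
    case True
    then have "cycles ?L n \<inter> boundaries V n \<subseteq> boundaries ?L n"
      by (auto simp: acyclic_at_def)
    then have "chain.dim (cycles ?L n \<inter> boundaries V n) \<le> chain.dim (boundaries ?L n)"
      using F' boundaries_subset_cycles[of ?L n] by (intro chain.dim_subset_finite[OF _ _ F'(1)]) blast+
    then show ?thesis
      using True by simp
  next
    case False
    have "chain.dim (cycles ?L n \<inter> boundaries V n) \<le> chain.dim (cycles ?L n)"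
      using F' by (intro chain.dim_subset_finite[OF _ _ F'(1)]) auto
    also have "\<dots> \<le> 2 ^ card ?L"
      by (rule dim_cycles_le[OF L])
    finally show ?thesis
      using False by simp
  qed
  ultimately show ?thesis
    using dim_boundaries_le[of V "Suc n"] assms(2)
    unfolding betti_number_def dim_cycles_insert[OF assms] dim_boundaries_insert[OF assms]
    by auto
qed

text \<open>The gain is nonnegative, and positive if some cycle of the link bounds in the old
  complex but not in the link. The loss is bounded by \<open>boundaries_contract_kernel\<close>: it
  comes from \<open>Suc n\<close>-cycles of the link, which already bound in the old complex if the
  link is acyclic there.\<close>

theorem betti_number_insert_ge:
  assumes "x \<notin> V" "insert x V \<subseteq> U"
  shows "betti_number V (Suc n) \<le> betti_number (insert x V) (Suc n) +
    (if acyclic_at (link E x V) (Suc n) then 0 else 2 ^ card (link E x V))"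
    and "cycles (link E x V) n \<inter> boundaries V n \<noteq> boundaries (link E x V) n \<Longrightarrow>
      betti_number V (Suc n) + 1 \<le> betti_number (insert x V) (Suc n) +
      (if acyclic_at (link E x V) (Suc n) then 0 else 2 ^ card (link E x V))"
proof -
  let ?L = "link E x V"
  let ?K = "{f \<in> boundaries (insert x V) (Suc n). contract x f = 0}"
  have L: "?L \<subseteq> U" "?L \<subseteq> V"
    using assms(2) link_subset[of E x V] by auto
  obtain F where F: "finite F" "cycles ?L n \<subseteq> chain.span F"
    using finite_span_cycles[OF L(1)] .
  obtain F' where F': "finite F'" "card F' \<le> 2 ^ card ?L" "cycles ?L (Suc n) \<subseteq> chain.span F'"
    using finite_span_cycles[OF L(1)] .
  obtain F'' where F'': "finite F''" "cycles V (Suc n) \<subseteq> chain.span F''"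
    by (rule finite_span_cycles[of V "Suc n"]) (use assms(2) in auto)
  have ker: "chain.dim ?K \<le>
      chain.dim (boundaries V (Suc n)) + (if acyclic_at ?L (Suc n) then 0 else 2 ^ card ?L)"
  proof (cases "acyclic_at ?L (Suc n)")
    case True
    have "?K \<subseteq> boundaries V (Suc n)"
    proof
      fix f assume "f \<in> ?K"
      then obtain b a where "f = b + a" "b \<in> cycles ?L (Suc n)" "a \<in> boundaries V (Suc n)"
        using boundaries_contract_kernel[of x V "Suc n"] assms by blast
      moreover from this(2) have "b \<in> boundaries V (Suc n)"
        using True boundaries_mono[OF L(2), of "Suc n"] by (auto simp: acyclic_at_def)
      ultimately show "f \<in> boundaries V (Suc n)"
        by (simp add: chain.subspace_add[OF subspace_boundaries])
    qed
    then have "chain.dim ?K \<le> chain.dim (boundaries V (Suc n))"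
      using F'' boundaries_subset_cycles[of V "Suc n"] by (intro chain.dim_subset_finite[OF _ _ F''(1)]) blast+
    then show ?thesis
      using True by simp
  next
    case False
    obtain B where B: "B \<subseteq> boundaries V (Suc n)" "chain.independent B"
      "boundaries V (Suc n) \<subseteq> chain.span B" "card B = chain.dim (boundaries V (Suc n))"
      by (rule chain.basis_exists)
    have "finite B"
      using chain.card_le_dim_finite(1)[OF B(1,2) _ F''(1)] boundaries_subset_cycles[of V "Suc n"] F''(2)
      by blast
    have "?K \<subseteq> chain.span (B \<union> F')"
    proof
      fix f assume "f \<in> ?K"
      then obtain b a where "f = b + a" "b \<in> cycles ?L (Suc n)" "a \<in> boundaries V (Suc n)"
        using boundaries_contract_kernel[of x V "Suc n"] assms by blast
      moreover have "chain.span B \<subseteq> chain.span (B \<union> F')" "chain.span F' \<subseteq> chain.span (B \<union> F')"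
        by (auto intro!: chain.span_mono)
      ultimately show "f \<in> chain.span (B \<union> F')"
        using B(3) F'(3) chain.span_add[of b "B \<union> F'" a] by blast
    qed
    then have "chain.dim ?K \<le> card (B \<union> F')"
      using \<open>finite B\<close> F'(1) by (intro chain.dim_le_card) auto
    also have "\<dots> \<le> card B + card F'"
      by (rule card_Un_le)
    finally show ?thesis
      using False B(4) F'(2) by simp
  qed
  have sub: "boundaries ?L n \<subseteq> cycles ?L n \<inter> boundaries V n"
    using boundaries_subset_cycles[of ?L n] boundaries_mono[OF L(2)] by auto
  have le: "chain.dim (boundaries ?L n) \<le> chain.dim (cycles ?L n \<inter> boundaries V n)"
    using F by (intro chain.dim_subset_finite[OF sub _ F(1)]) auto
  note eqs = betti_number_def dim_cycles_insert[OF assms] dim_boundaries_insert[OF assms]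
  have V: "chain.dim (boundaries V (Suc n)) \<le> chain.dim (cycles V (Suc n))"
    using assms(2) by (intro dim_boundaries_le) auto
  show "betti_number V (Suc n) \<le> betti_number (insert x V) (Suc n) +
    (if acyclic_at ?L (Suc n) then 0 else 2 ^ card ?L)"
    using ker le V unfolding eqs by auto
  assume "cycles ?L n \<inter> boundaries V n \<noteq> boundaries ?L n"
  then obtain z where "z \<in> cycles ?L n \<inter> boundaries V n" "z \<notin> boundaries ?L n"
    using sub by blast
  then have "chain.dim (boundaries ?L n) < chain.dim (cycles ?L n \<inter> boundaries V n)"
    using sub F by (intro chain.dim_strict_mono_finite[OF subspace_boundaries _ _ _ _ F(1)]) auto
  then show "betti_number V (Suc n) + 1 \<le> betti_number (insert x V) (Suc n) +
    (if acyclic_at ?L (Suc n) then 0 else 2 ^ card ?L)"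
    using ker V unfolding eqs by auto
qed

text \<open>\<open>wedge w f\<close> cones off the simplices of \<open>f\<close> that avoid
  \<open>w\<close>. By \<open>boundary_wedge\<close> it bounds the whole cycle
  \<open>f\<close>.\<close>

lemma acyclic_at_if_cone_point:
  assumes "w \<in> V" "w \<in> U" "\<And>v. v \<in> V \<Longrightarrow> v \<noteq> w \<Longrightarrow> E w v"
  shows "acyclic_at V n"
  unfolding acyclic_at_def
proof
  fix f assume f: "f \<in> cycles V n"
  have "wedge w f \<in> chains V (Suc n)"
    unfolding chains_def
  proof safe
    fix \<sigma> assume "wedge w f \<sigma> \<noteq> 0"
    then have *: "w \<in> \<sigma>" "f (\<sigma> - {w}) \<noteq> 0"
      by (auto simp: wedge_def split: if_splits)
    then have "\<sigma> - {w} \<in> cliques E V n"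
      using f by (auto simp: cycles_def chains_def)
    then have "insert w (\<sigma> - {w}) \<in> cliques E V (Suc n)"
      by (rule insert_mem_cliques)
        (use assms \<open>\<sigma> - {w} \<in> _\<close> in \<open>auto simp: cliques_def\<close>)
    then show "\<sigma> \<in> cliques E V (Suc n)"
      using * by (simp add: insert_absorb)
  qed
  moreover have "boundary U (wedge w f) = f"
    using f boundary_wedge[OF finite_U assms(2), of f] by (simp add: cycles_def)
  ultimately show "f \<in> boundaries V n"
    unfolding boundaries_def by (metis imageI)
qed

text \<open>
  In a minimal vertex set supporting a nontrivial class, every vertex link carries a nontrivial
  class of one degree less, and no vertex is a cone point.
\<close>

lemma not_acyclic_at_imp_dense_subset:
  assumes "V \<subseteq> U" "\<not> acyclic_at V n"
  shows "\<exists>W\<subseteq>V. 2 * n \<le> card W \<and> (\<forall>w\<in>W. 2 * (n - 1) \<le> card (link E w W))"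
  using assms
proof (induction n arbitrary: V)
  case 0
  then show ?case by (intro exI[of _ "{}"]) auto
next
  case (Suc n)
  define W where "W = (ARG_MIN card W. W \<subseteq> V \<and> \<not> acyclic_at W (Suc n))"
  have W: "W \<subseteq> V" "\<not> acyclic_at W (Suc n)"
    using arg_min_natI[of "\<lambda>W. W \<subseteq> V \<and> \<not> acyclic_at W (Suc n)" V card] Suc.prems
    by (auto simp: W_def)
  have minimal: "card W \<le> card W'" if "W' \<subseteq> V" "\<not> acyclic_at W' (Suc n)" for W'
    using arg_min_nat_le[of "\<lambda>W. W \<subseteq> V \<and> \<not> acyclic_at W (Suc n)" W' card] that
    by (auto simp: W_def)
  have "finite W"
    using W(1) Suc.prems(1) finite_U by (auto intro: finite_subset)
  have link_W: "2 * n \<le> card (link E w W)" if "w \<in> W" for w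
  proof -
    define W' where "W' = W - {w}"
    have W': "W = insert w W'" "w \<notin> W'" "card W' < card W"
      using that card_Diff1_less[OF \<open>finite W\<close> that] unfolding W'_def by blast+
    have link_eq: "link E w W = link E w W'"
      by (auto simp: link_def W'_def)
    have "acyclic_at W' (Suc n)"
      using minimal[of W'] W W' by fastforce
    have "\<not> acyclic_at (link E w W') n"
    proof
      assume ac: "acyclic_at (link E w W') n"
      have "f \<in> boundaries W (Suc n)" if f: "f \<in> cycles W (Suc n)" for f
      proof -
        have w: "w \<in> U"
          using that W W' Suc.prems(1) by auto
        have "contract w f \<in> cycles (link E w W') n"
          using contract_image_cycles[OF W'(2) w] f unfolding W'(1) by blast
        then obtain e where e: "e \<in> chains (link E w W') (Suc n)" "contract w f = boundary U e"
          using ac by (auto simp: acyclic_at_def boundaries_def)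
        \<comment> \<open>The added boundary has contraction \<open>- contract w f\<close> at
          \<open>w\<close>. Hence \<open>h\<close> is homologous to \<open>f\<close> and has no
          simplex through \<open>w\<close>, so it lives in the acyclic \<open>W'\<close>.\<close>
        define h where "h = f + boundary U (wedge w e)"
        have wedge: "wedge w e \<in> chains W (Suc (Suc n))"
          using wedge_chains[OF e(1)] by (simp add: W'(1))
        have "contract w (wedge w e) = e"
          using e(1) W'(2) by (intro contract_wedge_chains[of _ "link E w W'" "Suc n"]) (auto simp: link_def)
        then have "contract w h = 0"
          using e(2) by (simp add: h_def contract_add contract_boundary)
        moreover have "h \<in> chains W (Suc n)"
          using f wedge by (auto simp: h_def cycles_def intro!: chains_closed boundary_chains)
        moreover have "boundary U h = 0"
          using f by (simp add: h_def cycles_def boundary_add)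
        ultimately have "h \<in> cycles W' (Suc n)"
          using cycles_contract_kernel[OF W'(2), of "Suc n"] by (auto simp: cycles_def W'(1))
        then have "h \<in> boundaries W (Suc n)"
          using \<open>acyclic_at W' (Suc n)\<close> boundaries_mono[of W' W] W'(1) by (auto simp: acyclic_at_def)
        moreover have "boundary U (wedge w e) \<in> boundaries W (Suc n)"
          using wedge by (auto simp: boundaries_def)
        ultimately have "h - boundary U (wedge w e) \<in> boundaries W (Suc n)"
          by (intro chain.subspace_diff[OF subspace_boundaries])
        then show ?thesis
          by (simp add: h_def)
      qed
      then show False
        using W(2) by (auto simp: acyclic_at_def)
    qed
    moreover have "link E w W' \<subseteq> U"
      using link_subset[of E w W'] W W' Suc.prems(1) by blast
    ultimately obtain X where X: "X \<subseteq> link E w W'" "2 * n \<le> card X"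
      using Suc.IH by blast
    have "finite (link E w W)"
      using \<open>finite W\<close> by (auto simp: link_def)
    then show ?thesis
      using X link_eq by (auto intro: order.trans[OF X(2)] card_mono)
  qed
  have "W \<noteq> {}"
  proof
    assume "W = {}"
    then have "cycles W (Suc n) \<subseteq> {0}"
      by (force simp: cycles_def chains_def cliques_def fun_eq_iff)
    then show False
      using W(2) chain.subspace_0[OF subspace_boundaries] by (auto simp: acyclic_at_def)
  qed
  then obtain w where w: "w \<in> W" by blast
  obtain v where v: "v \<in> W" "v \<noteq> w" "\<not> E w v"
    using acyclic_at_if_cone_point[of w W "Suc n"] W w Suc.prems(1) by blast
  \<comment> \<open>Besides the link of \<open>w\<close>, the set \<open>W\<close> contains
    \<open>w\<close> itself and a non-neighbour \<open>v\<close>; these two raise the bound from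
    \<open>2 * n\<close> to \<open>2 * Suc n\<close>.\<close>
  have "card (insert v (insert w (link E w W))) \<le> card W"
    using v w \<open>finite W\<close> by (intro card_mono) (auto simp: link_def)
  moreover have "card (insert v (insert w (link E w W))) = 2 + card (link E w W)"
    using v \<open>finite W\<close> by (simp add: link_def)
  ultimately show ?case
    using W(1) link_W w by (intro exI[of _ W]) fastforce
qed

end


section \<open>Betti numbers as dimensions of rational homology\<close>

lemma (in comm_group) finprod_FactGroup:
  assumes N: "subgroup N G" and "finite I" "r \<in> I \<rightarrow> carrier G"
  shows "finprod (G Mod N) (\<lambda>i. N #> r i) I = N #> finprod G r I"
proof -
  interpret N: normal N G
    using N by (rule subgroup_imp_normal)
  interpret Q: comm_group "G Mod N"
    using N by (rule abelian_FactGroup)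
  show ?thesis
    using assms(2,3)
  proof (induction I)
    case empty
    have "finprod (G Mod N) (\<lambda>i. N #> r i) {} = N"
      by (subst Q.finprod_empty) (simp add: FactGroup_def)
    then show ?case
      by (simp add: coset_join2[OF one_closed N N.one_closed])
  next
    case (insert i I)
    have r: "r i \<in> carrier G" "r \<in> I \<rightarrow> carrier G"
      using insert.prems by auto
    have "finprod (G Mod N) (\<lambda>i. N #> r i) (insert i I) =
        (N #> r i) \<otimes>\<^bsub>G Mod N\<^esub> (N #> finprod G r I)"
      using insert r by (subst Q.finprod_insert) (auto simp: carrier_FactGroup)
    also have "\<dots> = N #> (r i \<otimes> finprod G r I)"
      using r by (simp add: FactGroup_def N.rcos_sum)
    also have "r i \<otimes> finprod G r I = finprod G r (insert i I)"
      using insert r by simp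
    finally show ?case .
  qed
qed

text \<open>\<open>int_independent\<close> attaches coefficients to cosets. Injectivity moves them
  to the index set, and a product of cosets is trivial iff the product of the representatives lies
  in \<open>N\<close>.\<close>

lemma (in comm_group) int_independent_FactGroup:
  assumes N: "subgroup N G" and "finite I" and r: "r \<in> I \<rightarrow> carrier G"
    and inj: "inj_on (\<lambda>i. N #> r i) I"
  shows "int_independent (G Mod N) ((\<lambda>i. N #> r i) ` I) \<longleftrightarrow>
    (\<forall>a :: 'i \<Rightarrow> int. finprod G (\<lambda>i. r i [^] a i) I \<in> N \<longrightarrow> (\<forall>i\<in>I. a i = 0))"
proof -
  interpret N: normal N G
    using N by (rule subgroup_imp_normal)
  interpret Q: comm_group "G Mod N"
    using N by (rule abelian_FactGroup)
  let ?h = "\<lambda>i. N #> r i"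
  have h: "?h i \<in> carrier (G Mod N)" if "i \<in> I" for i
    using that r by (auto simp: carrier_FactGroup)
  have eq: "finprod (G Mod N) (\<lambda>x. x [^]\<^bsub>G Mod N\<^esub> a x) (?h ` I) = \<one>\<^bsub>G Mod N\<^esub> \<longleftrightarrow>
      finprod G (\<lambda>i. r i [^] a (?h i)) I \<in> N" for a :: "'a set \<Rightarrow> int"
  proof -
    have "finprod (G Mod N) (\<lambda>x. x [^]\<^bsub>G Mod N\<^esub> a x) (?h ` I) =
        finprod (G Mod N) (\<lambda>i. ?h i [^]\<^bsub>G Mod N\<^esub> a (?h i)) I"
      using h inj by (intro Q.finprod_reindex) (auto intro!: Q.int_pow_closed)
    also have "\<dots> = finprod (G Mod N) (\<lambda>i. N #> (r i [^] a (?h i))) I"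
      using r by (intro Q.finprod_cong') (auto simp: N.FactGroup_int_pow[OF funcset_mem[OF r]] carrier_FactGroup)
    also have "\<dots> = N #> finprod G (\<lambda>i. r i [^] a (?h i)) I"
      using r by (intro finprod_FactGroup[OF N \<open>finite I\<close>]) auto
    finally have "finprod (G Mod N) (\<lambda>x. x [^]\<^bsub>G Mod N\<^esub> a x) (?h ` I) =
        N #> finprod G (\<lambda>i. r i [^] a (?h i)) I" .
    moreover have "finprod G (\<lambda>i. r i [^] a (?h i)) I \<in> carrier G"
      using r by (intro finprod_closed) auto
    ultimately show ?thesis
      using coset_join1[OF _ _ N] coset_join2[OF _ N] by (auto simp: FactGroup_def)
  qed
  show ?thesis
    unfolding int_independent_def eq
  proof (intro iffI allI impI)
    fix a :: "'i \<Rightarrow> int"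
    assume *: "\<forall>a :: 'a set \<Rightarrow> int. finprod G (\<lambda>i. r i [^] a (?h i)) I \<in> N \<longrightarrow> (\<forall>x\<in>?h ` I. a x = 0)"
      and a: "finprod G (\<lambda>i. r i [^] a i) I \<in> N"
    have "finprod G (\<lambda>i. r i [^] a (the_inv_into I ?h (?h i))) I = finprod G (\<lambda>i. r i [^] a i) I"
      using r by (intro finprod_cong') (auto simp: the_inv_into_f_f[OF inj])
    then have "\<forall>x\<in>?h ` I. a (the_inv_into I ?h x) = 0"
      using *[rule_format, of "\<lambda>x. a (the_inv_into I ?h x)"] a by simp
    then show "\<forall>i\<in>I. a i = 0"
      by (auto simp: the_inv_into_f_f[OF inj])
  qed auto
qed

text \<open>The last hypothesis says that the \<open>v i\<close> are independent modulo
  \<open>span D\<close>, so they can be added to \<open>D\<close> one at a time.\<close>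

lemma (in vector_space) independent_union_image:
  assumes "finite I" "finite D" "independent D"
    and "\<And>a. (\<Sum>i\<in>I. scale (a i) (v i)) \<in> span D \<Longrightarrow> \<forall>i\<in>I. a i = 0"
  shows "independent (D \<union> v ` I) \<and> card (D \<union> v ` I) = card D + card I \<and> inj_on v I"
  using assms(1,4)
proof (induction I)
  case empty
  then show ?case using assms(3) by simp
next
  case (insert i I)
  have rel: "\<forall>j\<in>I. a j = 0" if "(\<Sum>j\<in>I. scale (a j) (v j)) \<in> span D" for a
  proof -
    have "(\<Sum>j\<in>insert i I. scale ((a(i := 0)) j) (v j)) = (\<Sum>j\<in>I. scale (a j) (v j))"
      using insert.hyps by (simp, intro sum.cong) auto
    then have "\<forall>j\<in>insert i I. (a(i := 0)) j = 0"
      using insert.prems[of "a(i := 0)"] that by simp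
    then show ?thesis
      using insert.hyps by (auto split: if_splits)
  qed
  then have IH: "independent (D \<union> v ` I)" "card (D \<union> v ` I) = card D + card I" "inj_on v I"
    using insert.IH by auto
  have notin: "v i \<notin> span (D \<union> v ` I)"
  proof
    assume "v i \<in> span (D \<union> v ` I)"
    then obtain d e where de: "v i = d + e" "d \<in> span D" "e \<in> span (v ` I)"
      by (auto simp: span_Un)
    then obtain u where "e = (\<Sum>w\<in>v ` I. scale (u w) w)"
      using insert.hyps by (auto simp: span_finite)
    then have e: "e = (\<Sum>j\<in>I. scale (u (v j)) (v j))"
      using IH(3) by (simp add: sum.reindex)
    \<comment> \<open>A relation modulo \<open>span D\<close> whose coefficient at \<open>i\<close>
      is \<open>1\<close>.\<close>
    have "(\<Sum>j\<in>insert i I. scale (if j = i then 1 else - u (v j)) (v j)) =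
        v i + (\<Sum>j\<in>I. scale (- u (v j)) (v j))"
      using insert.hyps by (simp, intro sum.cong) auto
    also have "\<dots> = d"
      using de(1) e by (simp add: sum_negf)
    finally have "\<forall>j\<in>insert i I. (if j = i then 1 else - u (v j)) = 0"
      using de(2) by (intro insert.prems) simp
    then show False by auto
  qed
  then have "v i \<notin> D \<union> v ` I"
    using span_base[of "v i" "D \<union> v ` I"] by blast
  moreover have "independent (insert (v i) (D \<union> v ` I))"
    using IH(1) notin by (simp add: independent_insert)
  moreover have "finite (D \<union> v ` I)"
    using insert.hyps(1) assms(2) by simp
  ultimately show ?case
    using IH(2,3) insert.hyps by simp
qed

lemma (in vector_space) independent_complement_coeffs:
  assumes "independent B" "finite P" "P \<subseteq> B" "(\<Sum>f\<in>P. scale (a f) f) \<in> span (B - P)" "f \<in> P"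
  shows "a f = 0"
proof (rule ccontr)
  assume nz: "a f \<noteq> 0"
  have "scale (a f) f = (\<Sum>g\<in>P. scale (a g) g) - (\<Sum>g\<in>P - {f}. scale (a g) g)"
    using assms by (simp add: sum.remove)
  also have "\<dots> \<in> span (B - {f})"
  proof (rule span_diff)
    show "(\<Sum>g\<in>P. scale (a g) g) \<in> span (B - {f})"
      using assms span_mono[of "B - P" "B - {f}"] by auto
    show "(\<Sum>g\<in>P - {f}. scale (a g) g) \<in> span (B - {f})"
      using assms by (intro span_sum span_scale span_base) auto
  qed
  finally have "scale (inverse (a f)) (scale (a f) f) \<in> span (B - {f})"
    by (rule span_scale)
  then show False
    using nz assms by (auto simp: dependent_def)
qed

section \<open>Extension of scalars from the integers to the rationals\<close>

definition rat_chain :: "('a \<Rightarrow>\<^sub>0 int) \<Rightarrow> 'a \<Rightarrow> rat" where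
  "rat_chain c = (\<lambda>\<sigma>. of_int (poly_mapping.lookup c \<sigma>))"

lemma rat_chain_add: "rat_chain (c + d) = rat_chain c + rat_chain d"
  by (auto simp: rat_chain_def fun_eq_iff lookup_add)

lemma rat_chain_diff: "rat_chain (c - d) = rat_chain c - rat_chain d"
  by (auto simp: rat_chain_def fun_eq_iff lookup_minus)

lemma rat_chain_0 [simp]: "rat_chain 0 = 0"
  by (auto simp: rat_chain_def fun_eq_iff)

lemma rat_chain_cmul: "rat_chain (frag_cmul k c) = chain_scale (of_int k) (rat_chain c)"
  by (auto simp: rat_chain_def chain_scale_def fun_eq_iff)

lemma rat_chain_sum: "rat_chain (sum c I) = (\<Sum>i\<in>I. rat_chain (c i))"
  using sum_comp_morphism[of rat_chain c I] by (simp add: rat_chain_add comp_def)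

lemma rat_chain_inject: "rat_chain c = rat_chain d \<longleftrightarrow> c = d"
  by (auto simp: rat_chain_def fun_eq_iff poly_mapping_eq_iff)

lemma common_denominator:
  fixes f :: "'a \<Rightarrow> rat"
  assumes "finite A"
  shows "\<exists>N::int. N > 0 \<and> (\<forall>x\<in>A. of_int N * f x \<in> \<int>)"
  using assms
proof (induction A)
  case empty
  then show ?case by (intro exI[of _ 1]) auto
next
  case (insert x A)
  then obtain N :: int where N: "N > 0" "\<forall>y\<in>A. of_int N * f y \<in> \<int>" by blast
  obtain a b where ab: "f x = Fract a b" "b > 0"
    by (cases "f x") auto
  have b: "of_int b * f x \<in> \<int>"
    using ab by (simp add: Fract_of_int_quotient)
  have "of_int (b * N) * f y \<in> \<int>" if "y \<in> A" for y
    using N(2) that Ints_mult[of "of_int b" "of_int N * f y"] by (simp add: mult.assoc)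
  moreover have "of_int (b * N) * f x \<in> \<int>"
    using b Ints_mult[of "of_int N" "of_int b * f x"] by (simp add: ac_simps)
  ultimately show ?case
    using N(1) ab(2) by (intro exI[of _ "b * N"]) auto
qed

lemma clear_denominators:
  fixes f :: "'a \<Rightarrow> rat"
  assumes "finite {x. f x \<noteq> 0}"
  obtains N :: int and c where "N > 0" "rat_chain c = chain_scale (of_int N) f"
proof -
  obtain N :: int where N: "N > 0" "\<forall>x\<in>{x. f x \<noteq> 0}. of_int N * f x \<in> \<int>"
    using common_denominator[OF assms] by blast
  have int: "of_int \<lfloor>of_int N * f x\<rfloor> = of_int N * f x" for x
    using N(2) by (cases "f x = 0") (auto elim!: Ints_cases)
  have "finite {x. \<lfloor>of_int N * f x\<rfloor> \<noteq> 0}"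
    by (rule finite_subset[OF _ assms]) auto
  then have "rat_chain (Abs_poly_mapping (\<lambda>x. \<lfloor>of_int N * f x\<rfloor>)) = chain_scale (of_int N) f"
    by (simp add: rat_chain_def chain_scale_def int fun_eq_iff)
  then show ?thesis
    using that N(1) by blast
qed

text \<open>By linearity a single simplex suffices. \<open>contract v\<close> takes the sign of
  \<open>v\<close> from the face, \<open>simplicial_boundary\<close> from the whole simplex; they
  agree since \<open>v\<close> is not below itself. \<open>n > 0\<close> is essential:
  \<open>boundary\<close> is augmented, whereas \<open>simplicial_boundary 0\<close> is
  zero.\<close>

lemma rat_chain_simplicial_boundary:
  assumes "finite U" "n > 0" "\<And>\<sigma>. \<sigma> \<in> Poly_Mapping.keys c \<Longrightarrow> \<sigma> \<subseteq> U"
  shows "rat_chain (simplicial_boundary n c) = boundary U (rat_chain c)"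
proof -
  let ?d = "\<lambda>\<sigma>. \<Sum>v\<in>\<sigma>. frag_cmul ((-1) ^ card {u \<in> \<sigma>. u < v}) (frag_of (\<sigma> - {v}))"
  have "rat_chain (frag_extend ?d c) = boundary U (rat_chain c)"
  proof (rule frag_induction[of c "Pow U"])
    show "Poly_Mapping.keys c \<subseteq> Pow U"
      using assms(3) by auto
    show "rat_chain (frag_extend ?d 0) = boundary U (rat_chain 0)"
      by simp
    show "rat_chain (frag_extend ?d (a - b)) = boundary U (rat_chain (a - b))"
      if "rat_chain (frag_extend ?d a) = boundary U (rat_chain a)"
        "rat_chain (frag_extend ?d b) = boundary U (rat_chain b)" for a b
      using that by (simp add: frag_extend_diff rat_chain_diff boundary_diff)
    fix \<sigma> assume \<sigma>: "\<sigma> \<in> Pow U"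
    show "rat_chain (frag_extend ?d (frag_of \<sigma>)) = boundary U (rat_chain (frag_of \<sigma>))"
    proof
      fix \<tau>
      have "boundary U (rat_chain (frag_of \<sigma>)) \<tau> = (\<Sum>v\<in>U. contract v (rat_chain (frag_of \<sigma>)) \<tau>)"
        by (simp add: boundary_def sum_fun_apply)
      also have "\<dots> = (\<Sum>v\<in>\<sigma>. contract v (rat_chain (frag_of \<sigma>)) \<tau>)"
        using assms(1) \<sigma>
        by (intro sum.mono_neutral_right) (auto simp: contract_def rat_chain_def lookup_frag_of)
      also have "\<dots> = (\<Sum>v\<in>\<sigma>. of_int ((-1) ^ card {u \<in> \<sigma>. u < v} * (if \<tau> = \<sigma> - {v} then 1 else 0)))"
      proof (intro sum.cong refl)
        fix v assume "v \<in> \<sigma>"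
        then have "v \<notin> \<tau> \<and> insert v \<tau> = \<sigma> \<longleftrightarrow> \<tau> = \<sigma> - {v}"
          by auto
        then show "contract v (rat_chain (frag_of \<sigma>)) \<tau> =
            of_int ((-1) ^ card {u \<in> \<sigma>. u < v} * (if \<tau> = \<sigma> - {v} then 1 else 0))"
          using vertex_sign_Diff_same[of v \<sigma>]
          by (auto simp: contract_def rat_chain_def lookup_frag_of vertex_sign_def)
      qed
      also have "\<dots> = rat_chain (frag_extend ?d (frag_of \<sigma>)) \<tau>"
        by (simp add: rat_chain_def Poly_Mapping.lookup_sum lookup_frag_of)
      finally show "rat_chain (frag_extend ?d (frag_of \<sigma>)) \<tau> = boundary U (rat_chain (frag_of \<sigma>)) \<tau>" ..
    qed
  qed
  then show ?thesis
    using assms(2) by (simp add: simplicial_boundary_def)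
qed

section \<open>Comparison of integral and rational homology\<close>

context flag
begin

abbreviation "chain_group V n \<equiv> simplicial_chain_group (clique_complex V E) n"
abbreviation "int_cycles V n \<equiv> simplicial_cycles (clique_complex V E) n"
abbreviation "int_boundaries V n \<equiv> simplicial_boundaries (clique_complex V E) n"
abbreviation "homology V n \<equiv> simplicial_homology_group (clique_complex V E) n"

lemma rat_chain_mem_chains:
  "rat_chain c \<in> chains V (Suc n) \<longleftrightarrow> c \<in> carrier (chain_group V n)"
  by (auto simp: rat_chain_def chains_def simplicial_chain_group_def clique_complex_def cliques_def
      in_keys_iff subset_iff)

lemma rat_chain_boundary_chains:
  assumes "V \<subseteq> U" "n > 0" "c \<in> carrier (chain_group V n)"
  shows "rat_chain (simplicial_boundary n c) = boundary U (rat_chain c)"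
  using assms
  by (intro rat_chain_simplicial_boundary finite_U)
    (auto simp: simplicial_chain_group_def clique_complex_def)

lemma rat_chain_mem_cycles:
  assumes "V \<subseteq> U" "n > 0"
  shows "rat_chain c \<in> cycles V (Suc n) \<longleftrightarrow> c \<in> int_cycles V n"
  using rat_chain_boundary_chains[OF assms, of c] rat_chain_inject[of "simplicial_boundary n c" 0]
  by (auto simp: cycles_def simplicial_cycles_def rat_chain_mem_chains)

lemma finite_chain_support:
  assumes "V \<subseteq> U" "f \<in> chains V n"
  shows "finite {\<sigma>. f \<sigma> \<noteq> 0}"
  by (rule finite_subset[OF _ finite_cliques[OF assms(1), of n]]) (use assms(2) in \<open>auto simp: chains_def\<close>)

lemma clear_denominators_chain:
  assumes "V \<subseteq> U" "f \<in> chains V (Suc n)"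
  obtains N :: int and c where "N > 0" "rat_chain c = chain_scale (of_int N) f"
    "c \<in> carrier (chain_group V n)"
proof -
  obtain N :: int and c where c: "N > 0" "rat_chain c = chain_scale (of_int N) f"
    using clear_denominators[OF finite_chain_support[OF assms]] by blast
  then have "rat_chain c \<in> chains V (Suc n)"
    using assms(2) by (simp add: chain.subspace_scale[OF subspace_chains])
  then show ?thesis
    using that c rat_chain_mem_chains by blast
qed

lemma rat_chain_mem_boundaries:
  assumes "V \<subseteq> U" "c \<in> int_boundaries V n"
  shows "rat_chain c \<in> boundaries V (Suc n)"
proof -
  obtain d where d: "d \<in> carrier (chain_group V (Suc n))"
    "c = simplicial_boundary (Suc n) d"
    using assms(2) by (auto simp: simplicial_boundaries_def)
  then show ?thesis
    using rat_chain_boundary_chains[OF assms(1) _ d(1)] rat_chain_mem_chains[of d V "Suc n"]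
    by (auto simp: boundaries_def)
qed

text \<open>This takes care of torsion: an integral chain that bounds rationally need not bound
  integrally, but a multiple does. \<open>N\<close> clears the denominators of one rational filling,
  so it serves all \<open>M\<close> at once.\<close>

lemma multiple_mem_simplicial_boundaries:
  assumes "V \<subseteq> U" "f \<in> boundaries V (Suc n)"
  obtains N :: int where "N > 0"
    "\<And>M c. rat_chain c = chain_scale (of_int (M * N)) f \<Longrightarrow> c \<in> int_boundaries V n"
proof -
  obtain e where e: "e \<in> chains V (Suc (Suc n))" "f = boundary U e"
    using assms(2) by (auto simp: boundaries_def)
  obtain N :: int and d where d: "N > 0" "rat_chain d = chain_scale (of_int N) e"
    "d \<in> carrier (chain_group V (Suc n))"
    using clear_denominators_chain[OF assms(1) e(1)] .
  show ?thesis
  proof (rule that[OF d(1)])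
    fix M c assume c: "rat_chain c = chain_scale (of_int (M * N)) f"
    have Md: "frag_cmul M d \<in> carrier (chain_group V (Suc n))"
      using d(3) keys_cmul[of M d] by (auto simp: simplicial_chain_group_def)
    have "rat_chain (simplicial_boundary (Suc n) (frag_cmul M d)) = boundary U (rat_chain (frag_cmul M d))"
      by (rule rat_chain_boundary_chains[OF assms(1) _ Md]) simp
    also have "\<dots> = rat_chain c"
      by (simp add: rat_chain_cmul d(2) c e(2) boundary_scale)
    finally have "simplicial_boundary (Suc n) (frag_cmul M d) = c"
      by (simp add: rat_chain_inject)
    then show "c \<in> int_boundaries V n"
      using Md by (auto simp: simplicial_boundaries_def)
  qed
qed

lemma comm_group_simplicial_chain_group: "comm_group (simplicial_chain_group X n)"
  by (simp add: simplicial_chain_group_def abelian_free_Abelian_group)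

lemma subgroup_simplicial_cycles:
  assumes "V \<subseteq> U" "n > 0"
  shows "subgroup (int_cycles V n) (chain_group V n)"
proof -
  interpret comm_group "chain_group V n"
    by (rule comm_group_simplicial_chain_group)
  show ?thesis
  proof (rule subgroupI)
    show "int_cycles V n \<subseteq> carrier (chain_group V n)"
      by (auto simp: simplicial_cycles_def)
    have "0 \<in> int_cycles V n"
      by (simp add: chain.subspace_0[OF subspace_cycles] flip: rat_chain_mem_cycles[OF assms])
    then show "int_cycles V n \<noteq> {}"
      by blast
  next
    fix c assume c: "c \<in> int_cycles V n"
    then have "inv\<^bsub>chain_group V n\<^esub> c = 0 - c"
      by (simp add: simplicial_chain_group_def simplicial_cycles_def)
    moreover have "0 - c \<in> int_cycles V n"
      using c unfolding rat_chain_mem_cycles[OF assms, symmetric] rat_chain_diff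
      by (simp add: chain.subspace_neg[OF subspace_cycles])
    ultimately show "inv\<^bsub>chain_group V n\<^esub> c \<in> int_cycles V n"
      by simp
  next
    fix c d assume "c \<in> int_cycles V n" "d \<in> int_cycles V n"
    then show "c \<otimes>\<^bsub>chain_group V n\<^esub> d \<in> int_cycles V n"
      unfolding rat_chain_mem_cycles[OF assms, symmetric]
      by (simp add: simplicial_chain_group_def rat_chain_add chain.subspace_add[OF subspace_cycles])
  qed
qed

lemma subgroup_simplicial_boundaries:
  assumes "V \<subseteq> U" "n > 0"
  shows "subgroup (int_boundaries V n)
    (subgroup_generated (chain_group V n)
      (int_cycles V n))"
proof -
  let ?C = "\<lambda>n. chain_group V n"
  let ?Z = "int_cycles V n"
  let ?B = "int_boundaries V n"
  interpret C: comm_group "?C n"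
    by (rule comm_group_simplicial_chain_group)
  interpret C': comm_group "?C (Suc n)"
    by (rule comm_group_simplicial_chain_group)
  have BZ: "?B \<subseteq> ?Z"
    using rat_chain_mem_boundaries[OF assms(1), of _ n] boundaries_subset_cycles[of V "Suc n"]
      rat_chain_mem_cycles[OF assms] by blast
  have ZC: "?Z \<subseteq> carrier (?C n)"
    by (auto simp: simplicial_cycles_def)
  have "simplicial_boundary (Suc n) \<in> hom (?C (Suc n)) (?C n)"
  proof (rule homI)
    show "simplicial_boundary (Suc n) c \<in> carrier (?C n)" if "c \<in> carrier (?C (Suc n))" for c
      using that BZ ZC unfolding simplicial_boundaries_def by blast
  qed (simp add: simplicial_boundary_def simplicial_chain_group_def frag_extend_add)
  then interpret h: group_hom "?C (Suc n)" "?C n" "simplicial_boundary (Suc n)"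
    by unfold_locales
  have "subgroup ?B (?C n)"
    using h.img_is_subgroup by (simp add: simplicial_boundaries_def)
  then show ?thesis
    using BZ subgroup.carrier_subgroup_generated_subgroup[OF subgroup_simplicial_cycles[OF assms]]
    by (simp add: C.subgroup_subgroup_generated_iff)
qed

lemma finprod_cycle_group:
  assumes "V \<subseteq> U" "n > 0" "finite I" "r \<in> I \<rightarrow> int_cycles V n"
  defines "ZG \<equiv> subgroup_generated (chain_group V n)
      (int_cycles V n)"
  shows "finprod ZG (\<lambda>i. r i [^]\<^bsub>ZG\<^esub> (a i :: int)) I = (\<Sum>i\<in>I. frag_cmul (a i) (r i))"
proof -
  interpret C: comm_group "chain_group V n"
    by (rule comm_group_simplicial_chain_group)
  interpret ZG: comm_group ZG
    unfolding ZG_def by (rule C.abelian_subgroup_generated) (rule C.comm_group_axioms)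
  have carrier: "carrier ZG = int_cycles V n"
    unfolding ZG_def
    by (rule subgroup.carrier_subgroup_generated_subgroup[OF subgroup_simplicial_cycles[OF assms(1,2)]])
  have pow: "c [^]\<^bsub>ZG\<^esub> k = frag_cmul k c" if "c \<in> carrier ZG" for c and k :: int
  proof -
    have "c [^]\<^bsub>ZG\<^esub> k = c [^]\<^bsub>chain_group V n\<^esub> k"
      using that unfolding ZG_def by (rule C.int_pow_subgroup_generated)
    also have "\<dots> = frag_cmul k c"
      using that unfolding carrier by (simp add: simplicial_cycles_def simplicial_chain_group_def)
    finally show ?thesis .
  qed
  show ?thesis
    using assms(3,4)
  proof (induction I)
    case empty
    show ?case
      by (subst ZG.finprod_empty) (simp add: ZG_def simplicial_chain_group_def)
  next
    case (insert i I)
    then have r: "r i \<in> carrier ZG" "r \<in> I \<rightarrow> carrier ZG"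
      by (auto simp: carrier)
    have "finprod ZG (\<lambda>i. r i [^]\<^bsub>ZG\<^esub> a i) (insert i I) =
        r i [^]\<^bsub>ZG\<^esub> a i \<otimes>\<^bsub>ZG\<^esub> finprod ZG (\<lambda>i. r i [^]\<^bsub>ZG\<^esub> a i) I"
      using insert.hyps r by (intro ZG.finprod_insert) auto
    also have "\<dots> = frag_cmul (a i) (r i) + finprod ZG (\<lambda>i. r i [^]\<^bsub>ZG\<^esub> a i) I"
      by (simp add: pow[OF r(1)]) (simp add: ZG_def simplicial_chain_group_def)
    finally show ?case
      using insert r by (simp add: carrier)
  qed
qed

lemma int_independent_homology_iff:
  fixes r :: "'i \<Rightarrow> nat set \<Rightarrow>\<^sub>0 int"
  assumes "V \<subseteq> U" "n > 0" "finite I" "r \<in> I \<rightarrow> int_cycles V n"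
  defines "ZG \<equiv> subgroup_generated (chain_group V n)
      (int_cycles V n)"
    and "N \<equiv> int_boundaries V n"
  assumes "inj_on (\<lambda>i. N #>\<^bsub>ZG\<^esub> r i) I"
  shows "int_independent (homology V n) ((\<lambda>i. N #>\<^bsub>ZG\<^esub> r i) ` I) \<longleftrightarrow>
    (\<forall>a :: 'i \<Rightarrow> int. (\<Sum>i\<in>I. frag_cmul (a i) (r i)) \<in> N \<longrightarrow> (\<forall>i\<in>I. a i = 0))"
proof -
  interpret C: comm_group "chain_group V n"
    by (rule comm_group_simplicial_chain_group)
  interpret ZG: comm_group ZG
    unfolding ZG_def by (rule C.abelian_subgroup_generated) (rule C.comm_group_axioms)
  have carrier: "carrier ZG = int_cycles V n"
    unfolding ZG_def
    by (rule subgroup.carrier_subgroup_generated_subgroup[OF subgroup_simplicial_cycles[OF assms(1,2)]])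
  have N: "subgroup N ZG"
    unfolding N_def ZG_def by (rule subgroup_simplicial_boundaries[OF assms(1,2)])
  have "int_independent (ZG Mod N) ((\<lambda>i. N #>\<^bsub>ZG\<^esub> r i) ` I) \<longleftrightarrow>
    (\<forall>a :: 'i \<Rightarrow> int. finprod ZG (\<lambda>i. r i [^]\<^bsub>ZG\<^esub> a i) I \<in> N \<longrightarrow> (\<forall>i\<in>I. a i = 0))"
    using assms(4,7) by (intro ZG.int_independent_FactGroup[OF N \<open>finite I\<close>]) (auto simp: carrier)
  also have "ZG Mod N = homology V n"
    by (simp add: simplicial_homology_group_def ZG_def N_def)
  finally show ?thesis
    using finprod_cycle_group[OF assms(1-4), folded ZG_def] by simp
qed

text \<open>Representatives of independent classes stay independent over the rationals modulo
  boundaries. Joined to a basis \<open>D\<close> of the boundaries, they form an independent set of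
  cycles.\<close>

lemma card_le_betti_number_if_int_independent:
  assumes "V \<subseteq> U" "n > 0" "finite B" "B \<subseteq> carrier (homology V n)"
    "int_independent (homology V n) B"
  shows "card B \<le> betti_number V (Suc n)"
proof -
  define ZG where "ZG = subgroup_generated (chain_group V n)
      (int_cycles V n)"
  define N where "N = int_boundaries V n"
  have carrier: "carrier ZG = int_cycles V n"
    unfolding ZG_def
    by (rule subgroup.carrier_subgroup_generated_subgroup[OF subgroup_simplicial_cycles[OF assms(1,2)]])
  have "\<exists>z. z \<in> carrier ZG \<and> N #>\<^bsub>ZG\<^esub> z = x" if "x \<in> B" for x
    using that assms(4) by (auto simp: simplicial_homology_group_def carrier_FactGroup ZG_def N_def)
  then obtain r where r: "\<And>x. x \<in> B \<Longrightarrow> r x \<in> carrier ZG" "\<And>x. x \<in> B \<Longrightarrow> N #>\<^bsub>ZG\<^esub> r x = x"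
    by metis
  have r_Z: "r \<in> B \<rightarrow> int_cycles V n"
    using r(1) by (auto simp: carrier)
  have inj: "inj_on (\<lambda>x. N #>\<^bsub>ZG\<^esub> r x) B"
    using r(2) by (auto simp: inj_on_def)
  have img: "(\<lambda>x. N #>\<^bsub>ZG\<^esub> r x) ` B = B"
    using r(2) by force
  have ind: "\<forall>x\<in>B. a x = 0" if "(\<Sum>x\<in>B. frag_cmul (a x) (r x)) \<in> N" for a :: "_ \<Rightarrow> int"
    using int_independent_homology_iff[OF assms(1-3) r_Z, folded ZG_def N_def] inj img assms(5) that
    by simp
  obtain F where F: "finite F" "cycles V (Suc n) \<subseteq> chain.span F"
    by (rule finite_span_cycles[OF assms(1)])
  obtain D where D: "D \<subseteq> boundaries V (Suc n)" "chain.independent D" "boundaries V (Suc n) \<subseteq> chain.span D"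
    "card D = chain.dim (boundaries V (Suc n))"
    by (rule chain.basis_exists)
  have D_Z: "D \<subseteq> cycles V (Suc n)"
    using D(1) boundaries_subset_cycles[of V "Suc n"] by blast
  have "finite D"
    by (rule chain.card_le_dim_finite(1)[OF D_Z D(2) F(2,1)])
  have span_D: "chain.span D \<subseteq> boundaries V (Suc n)"
    by (rule chain.span_minimal[OF D(1) subspace_boundaries])
  have "\<forall>x\<in>B. a x = 0" if a: "(\<Sum>x\<in>B. chain_scale (a x) (rat_chain (r x))) \<in> chain.span D" for a
  proof -
    define f where "f = (\<Sum>x\<in>B. chain_scale (a x) (rat_chain (r x)))"
    have "f \<in> boundaries V (Suc n)"
      using a span_D by (auto simp: f_def)
    then obtain K :: int where K: "K > 0" "\<And>M c. rat_chain c = chain_scale (of_int (M * K)) f \<Longrightarrow> c \<in> N"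
      using multiple_mem_simplicial_boundaries[OF assms(1)] unfolding N_def by metis
    obtain M :: int where M: "M > 0" "\<forall>x\<in>B. of_int M * a x \<in> \<int>"
      using common_denominator[OF \<open>finite B\<close>] by blast
    have int: "of_int \<lfloor>of_int M * a x\<rfloor> = of_int M * a x" if "x \<in> B" for x
      using M(2) that by (auto elim!: Ints_cases)
    \<comment> \<open>\<open>M\<close> makes the coefficients integral, \<open>K\<close> turns the
      resulting rational boundary into an integral one.\<close>
    define c where "c = (\<Sum>x\<in>B. frag_cmul (K * \<lfloor>of_int M * a x\<rfloor>) (r x))"
    have "rat_chain c = (\<Sum>x\<in>B. chain_scale (of_int (M * K)) (chain_scale (a x) (rat_chain (r x))))"
      unfolding c_def rat_chain_sum rat_chain_cmul
      by (intro sum.cong refl) (simp add: int chain.scale_scale ac_simps)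
    then have "rat_chain c = chain_scale (of_int (M * K)) f"
      by (simp add: f_def chain.scale_sum_right)
    then have "c \<in> N"
      by (rule K(2))
    then have "\<forall>x\<in>B. K * \<lfloor>of_int M * a x\<rfloor> = 0"
      unfolding c_def by (rule ind)
    then show ?thesis
      using K(1) M(1) int by force
  qed
  then have *: "chain.independent (D \<union> (\<lambda>x. rat_chain (r x)) ` B)"
      "card (D \<union> (\<lambda>x. rat_chain (r x)) ` B) = card D + card B"
    using chain.independent_union_image[OF \<open>finite B\<close> \<open>finite D\<close> D(2), of "\<lambda>x. rat_chain (r x)"]
    by auto
  have "D \<union> (\<lambda>x. rat_chain (r x)) ` B \<subseteq> cycles V (Suc n)"
    using D_Z r_Z rat_chain_mem_cycles[OF assms(1,2)] by auto
  then have "card D + card B \<le> chain.dim (cycles V (Suc n))"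
    using chain.card_le_dim_finite(2)[OF _ *(1) F(2,1)] *(2) by simp
  then show ?thesis
    using D(4) by (simp add: betti_number_def)
qed

text \<open>Extend a basis of the boundaries to one of the cycles, and scale each added basis vector
  to an integral cycle.\<close>

lemma exists_int_independent:
  assumes "V \<subseteq> U" "n > 0"
  obtains B where "finite B" "B \<subseteq> carrier (homology V n)"
    "int_independent (homology V n) B"
    "card B = betti_number V (Suc n)"
proof -
  define ZG where "ZG = subgroup_generated (chain_group V n)
      (int_cycles V n)"
  define N where "N = int_boundaries V n"
  interpret C: comm_group "chain_group V n"
    by (rule comm_group_simplicial_chain_group)
  interpret ZG: comm_group ZG
    unfolding ZG_def by (rule C.abelian_subgroup_generated) (rule C.comm_group_axioms)
  have carrier: "carrier ZG = int_cycles V n"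
    unfolding ZG_def
    by (rule subgroup.carrier_subgroup_generated_subgroup[OF subgroup_simplicial_cycles[OF assms(1,2)]])
  have N: "subgroup N ZG"
    unfolding N_def ZG_def by (rule subgroup_simplicial_boundaries[OF assms(1,2)])
  obtain F where F: "finite F" "cycles V (Suc n) \<subseteq> chain.span F"
    by (rule finite_span_cycles[OF assms(1)])
  obtain D where D: "D \<subseteq> boundaries V (Suc n)" "chain.independent D" "boundaries V (Suc n) \<subseteq> chain.span D"
    "card D = chain.dim (boundaries V (Suc n))"
    by (rule chain.basis_exists)
  have "D \<subseteq> cycles V (Suc n)"
    using D(1) boundaries_subset_cycles[of V "Suc n"] by blast
  then obtain D' where D': "D \<subseteq> D'" "D' \<subseteq> cycles V (Suc n)" "chain.independent D'"
    "cycles V (Suc n) \<subseteq> chain.span D'"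
    using chain.maximal_independent_subset_extend[OF _ D(2)] by blast
  have "finite D'"
    by (rule chain.card_le_dim_finite(1)[OF D'(2,3) F(2,1)])
  have card_D': "card D' = chain.dim (cycles V (Suc n))"
    by (rule chain.basis_card_eq_dim[OF D'(2,4,3)])
  define P where "P = D' - D"
  have P: "finite P" "P \<subseteq> cycles V (Suc n)" "D' - P = D"
    using \<open>finite D'\<close> D'(1,2) by (auto simp: P_def)
  have card_P: "card P = betti_number V (Suc n)"
    using \<open>finite D'\<close> D'(1) card_D' D(4)
    by (simp add: P_def betti_number_def card_Diff_subset finite_subset)
  have "\<exists>K c. (K :: int) > 0 \<and> rat_chain c = chain_scale (of_int K) f" if "f \<in> P" for f
  proof -
    have "f \<in> chains V (Suc n)"
      using P(2) that by (auto simp: cycles_def)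
    then show ?thesis
      using clear_denominators_chain[OF assms(1)] by metis
  qed
  then obtain K r where Kr: "\<And>f. f \<in> P \<Longrightarrow> (K f :: int) > 0"
      "\<And>f. f \<in> P \<Longrightarrow> rat_chain (r f) = chain_scale (of_int (K f)) f"
    by metis
  have r_Z: "r \<in> P \<rightarrow> int_cycles V n"
    using P(2) by (auto simp: Kr(2) chain.subspace_scale[OF subspace_cycles]
        simp flip: rat_chain_mem_cycles[OF assms])
  have ind: "\<forall>f\<in>P. a f = 0" if a: "(\<Sum>f\<in>P. frag_cmul (a f) (r f)) \<in> N" for a
  proof
    fix f assume f: "f \<in> P"
    have "rat_chain (\<Sum>f\<in>P. frag_cmul (a f) (r f)) = (\<Sum>f\<in>P. chain_scale (of_int (a f * K f)) f)"
      unfolding rat_chain_sum rat_chain_cmul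
      by (intro sum.cong refl) (simp add: Kr(2) chain.scale_scale)
    then have "(\<Sum>f\<in>P. chain_scale (of_int (a f * K f)) f) \<in> chain.span (D' - P)"
      using rat_chain_mem_boundaries[OF assms(1) a[unfolded N_def]] D(3) P(3) by auto
    then have "(of_int (a f * K f) :: rat) = 0"
      using f by (intro chain.independent_complement_coeffs[OF D'(3) P(1)]) (auto simp: P_def)
    then show "a f = 0"
      using Kr(1)[OF f] by simp
  qed
  have inj: "inj_on (\<lambda>f. N #>\<^bsub>ZG\<^esub> r f) P"
  proof (rule inj_onI, rule ccontr)
    fix f g assume fg: "f \<in> P" "g \<in> P" "N #>\<^bsub>ZG\<^esub> r f = N #>\<^bsub>ZG\<^esub> r g" "f \<noteq> g"
    have r: "r f \<in> carrier ZG" "r g \<in> carrier ZG"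
      using fg r_Z by (auto simp: carrier)
    then have "r f \<in> N #>\<^bsub>ZG\<^esub> r g"
      using fg(3) ZG.rcos_self[OF _ N] by force
    then obtain b where b: "b \<in> N" "r f = b + r g"
      by (auto simp: r_coset_def ZG_def simplicial_chain_group_def)
    \<comment> \<open>Equal cosets would give the nontrivial relation
      \<open>r f - r g \<in> N\<close>.\<close>
    define a where "a h = (if h = f then 1 else if h = g then - 1 else 0 :: int)" for h
    have "(\<Sum>h\<in>P. frag_cmul (a h) (r h)) = (\<Sum>h\<in>{f, g}. frag_cmul (a h) (r h))"
      using fg(1,2) P(1) by (intro sum.mono_neutral_right) (auto simp: a_def)
    also have "\<dots> = b"
      using fg(4) b(2) by (simp add: a_def)
    finally show False
      using ind[of a] b(1) fg(1) by (auto simp: a_def)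
  qed
  show ?thesis
  proof
    show "finite ((\<lambda>f. N #>\<^bsub>ZG\<^esub> r f) ` P)" "card ((\<lambda>f. N #>\<^bsub>ZG\<^esub> r f) ` P) = betti_number V (Suc n)"
      using P(1) card_image[OF inj] card_P by auto
    show "int_independent (homology V n) ((\<lambda>f. N #>\<^bsub>ZG\<^esub> r f) ` P)"
      using int_independent_homology_iff[OF assms P(1) r_Z, folded ZG_def N_def] inj ind by simp
    show "(\<lambda>f. N #>\<^bsub>ZG\<^esub> r f) ` P \<subseteq> carrier (homology V n)"
      using r_Z unfolding simplicial_homology_group_def carrier_FactGroup
      by (auto simp: carrier simp flip: ZG_def N_def)
  qed
qed

theorem betti_clique_complex:
  assumes "V \<subseteq> U" "n > 0"
  shows "betti n (clique_complex V E) = betti_number V (Suc n)"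
  unfolding betti_def group_rank_def
proof (rule cSup_eq_maximum)
  obtain B where "finite B" "B \<subseteq> carrier (homology V n)"
    "int_independent (homology V n) B"
    "card B = betti_number V (Suc n)"
    by (rule exists_int_independent[OF assms])
  then show "betti_number V (Suc n) \<in> {card B |B. finite B \<and>
      B \<subseteq> carrier (homology V n) \<and>
      int_independent (homology V n) B}"
    by (intro CollectI exI[of _ B]) simp
next
  fix k assume "k \<in> {card B |B. finite B \<and>
      B \<subseteq> carrier (homology V n) \<and>
      int_independent (homology V n) B}"
  then show "k \<le> betti_number V (Suc n)"
    using card_le_betti_number_if_int_independent[OF assms] by auto
qed

end


section \<open>Cross-polytopes\<close>

text \<open>
  The fundamental cycle of the cross-polytope with antipodal pairs \<open>a i\<close>, \<open>b i\<close> is the exterior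
  product of the \<open>a i - b i\<close>.
\<close>

primrec cross_cycle :: "(nat \<Rightarrow> nat) \<Rightarrow> (nat \<Rightarrow> nat) \<Rightarrow> nat \<Rightarrow> nat set \<Rightarrow> rat" where
  "cross_cycle a b 0 = indicator {{}}"
| "cross_cycle a b (Suc i) = wedge (a i) (cross_cycle a b i) - wedge (b i) (cross_cycle a b i)"

definition cross_vertices :: "(nat \<Rightarrow> nat) \<Rightarrow> (nat \<Rightarrow> nat) \<Rightarrow> nat \<Rightarrow> nat set" where
  "cross_vertices a b q = a ` {..<q} \<union> b ` {..<q}"

text \<open>An iterated suspension: each antipodal pair is joined to all earlier pairs, and its two
  nodes are not adjacent to each other.\<close>

locale cross_polytope = flag +
  fixes a b :: "nat \<Rightarrow> nat" and q :: nat
  assumes vertices_in_U: "cross_vertices a b q \<subseteq> U"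
    and new: "i < q \<Longrightarrow> a i \<notin> cross_vertices a b i" "i < q \<Longrightarrow> b i \<notin> cross_vertices a b i" "i < q \<Longrightarrow> a i \<noteq> b i"
    and adj: "i < q \<Longrightarrow> v \<in> cross_vertices a b i \<Longrightarrow> E (a i) v" "i < q \<Longrightarrow> v \<in> cross_vertices a b i \<Longrightarrow> E (b i) v"
    and antipodal: "i < q \<Longrightarrow> \<not> E (b i) (a i)"
begin

lemma cross_vertices_Suc: "cross_vertices a b (Suc i) = insert (a i) (insert (b i) (cross_vertices a b i))"
  by (auto simp: cross_vertices_def lessThan_Suc)

lemma cross_cycle_Suc:
  "cross_cycle a b (Suc i) = wedge (a i) (cross_cycle a b i) - wedge (b i) (cross_cycle a b i)"
  by (simp add: fun_eq_iff)

lemma cross_cycle_chains: "i \<le> q \<Longrightarrow> cross_cycle a b i \<in> chains (cross_vertices a b i) i"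
proof (induction i)
  case 0
  then show ?case
    by (auto simp: chains_def cliques_def cross_vertices_def indicator_def split: if_splits)
next
  case (Suc i)
  have "wedge x (cross_cycle a b i) \<in> chains (cross_vertices a b (Suc i)) (Suc i)"
    if "x \<in> {a i, b i}" for x
  proof -
    have "link E x (cross_vertices a b i) = cross_vertices a b i"
      using that Suc.prems new[of i] adj[of i] by (auto simp: link_def)
    then have "wedge x (cross_cycle a b i) \<in> chains (insert x (cross_vertices a b i)) (Suc i)"
      using Suc.IH Suc.prems by (intro wedge_chains) simp
    moreover have "insert x (cross_vertices a b i) \<subseteq> cross_vertices a b (Suc i)"
      using that by (auto simp: cross_vertices_Suc)
    ultimately show ?thesis
      using chains_mono[of "insert x (cross_vertices a b i)"] by blast
  qed
  then show ?case
    by (auto simp only: cross_cycle_Suc intro!: chains_closed)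
qed

lemma boundary_cross_cycle: "i \<le> q \<Longrightarrow> boundary U (cross_cycle a b i) = 0"
proof (induction i)
  case 0
  show ?case
    by (auto simp: boundary_def contract_def fun_eq_iff sum_fun_apply intro!: sum.neutral)
next
  case (Suc i)
  have "{a i, b i} \<subseteq> U"
    using Suc.prems vertices_in_U by (auto simp: cross_vertices_def)
  moreover have "boundary U (cross_cycle a b i) = 0"
    using Suc by (simp add: zero_fun_def)
  ultimately show ?case
    using boundary_wedge[OF finite_U, of _ "cross_cycle a b i"]
    by (simp only: cross_cycle_Suc boundary_diff) (simp add: fun_eq_iff)
qed

lemma cross_cycle_nonzero: "i \<le> q \<Longrightarrow> cross_cycle a b i (a ` {..<i}) \<noteq> 0"
proof (induction i)
  case (Suc i)
  have "a ` {..<Suc i} - {a i} = a ` {..<i}"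
    using Suc.prems new(1)[of i] by (auto simp: cross_vertices_def lessThan_Suc)
  moreover have "b i \<notin> a ` {..<Suc i}"
    using Suc.prems new(2,3)[of i] by (auto simp: cross_vertices_def lessThan_Suc)
  ultimately show ?case
    using Suc by (simp add: wedge_def)
qed simp

theorem cycles_inter_boundaries_ne:
  assumes "cross_vertices a b q \<subseteq> L" "L \<subseteq> V" "V \<subseteq> U"
    and cone: "f \<in> V" "\<And>v. v \<in> cross_vertices a b q \<Longrightarrow> E f v"
    and no_coface: "\<And>w. w \<in> L \<Longrightarrow> w \<notin> cross_vertices a b q \<Longrightarrow> \<exists>i<q. \<not> E w (a i)"
  shows "cycles L q \<inter> boundaries V q \<noteq> boundaries L q"
proof -
  let ?P = "cross_vertices a b q" and ?z = "cross_cycle a b q" and ?\<sigma> = "a ` {..<q}"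
  have z: "?z \<in> cycles ?P q"
    by (simp add: cycles_def cross_cycle_chains boundary_cross_cycle)
  have "acyclic_at (insert f ?P) q"
    using assms(3) cone by (intro acyclic_at_if_cone_point[of f]) auto
  then have "?z \<in> boundaries (insert f ?P) q"
    using z cycles_mono[of ?P "insert f ?P" q] by (auto simp: acyclic_at_def)
  then have "?z \<in> boundaries V q"
    using boundaries_mono[of "insert f ?P" V q] assms(1,2) cone(1) by blast
  moreover have "?z \<in> cycles L q"
    using z cycles_mono[OF assms(1)] by blast
  moreover have "?z \<notin> boundaries L q"
  proof
    assume "?z \<in> boundaries L q"
    then obtain c where c: "c \<in> chains L (Suc q)" "?z = boundary U c"
      by (auto simp: boundaries_def)
    have "(\<Sum>v\<in>U. contract v c ?\<sigma>) \<noteq> 0"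
      using cross_cycle_nonzero[of q] c(2) by (simp add: boundary_def sum_fun_apply)
    then obtain v where "contract v c ?\<sigma> \<noteq> 0"
      by (meson sum.neutral)
    then have v: "v \<notin> ?\<sigma>" "c (insert v ?\<sigma>) \<noteq> 0"
      by (auto simp: contract_def split: if_splits)
    then have "insert v ?\<sigma> \<in> cliques E L (Suc q)"
      using c(1) by (auto simp: chains_def)
    then have vL: "v \<in> L" "\<And>i. i < q \<Longrightarrow> E v (a i)"
      using v(1) by (auto simp: cliques_def pairwise_insert)
    show False
    proof (cases "v \<in> ?P")
      case True
      then obtain i where "i < q" "v = b i"
        using v(1) by (auto simp: cross_vertices_def)
      then show False
        using vL(2) antipodal by blast
    next
      case False
      then show False
        using no_coface vL by blast
    qed
  qed
  ultimately show ?thesis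
    by blast
qed

end


section \<open>The preferential attachment process\<close>

lemma expectation_bind_finite:
  fixes h :: "'b \<Rightarrow> real"
  assumes "finite (set_pmf p)" "\<And>x. x \<in> set_pmf p \<Longrightarrow> finite (set_pmf (f x))"
  shows "measure_pmf.expectation (bind_pmf p f) h =
    measure_pmf.expectation p (\<lambda>x. measure_pmf.expectation (f x) h)"
  using assms
  by (subst pmf_expectation_bind[of "set_pmf p"])
    (auto simp: integral_measure_pmf_real[of "set_pmf p"] mult.commute)

lemma expectation_mono_finite:
  fixes f g :: "'a \<Rightarrow> real"
  assumes "finite (set_pmf p)" "\<And>x. x \<in> set_pmf p \<Longrightarrow> f x \<le> g x"
  shows "measure_pmf.expectation p f \<le> measure_pmf.expectation p g"
  using assms by (intro integral_mono_AE integrable_measure_pmf_finite) (auto simp: AE_measure_pmf_iff)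

lemma expectation_cong:
  fixes f g :: "'a \<Rightarrow> real"
  assumes "\<And>x. x \<in> set_pmf p \<Longrightarrow> f x = g x"
  shows "measure_pmf.expectation p f = measure_pmf.expectation p g"
  using assms by (intro integral_cong_AE) (auto simp: AE_measure_pmf_iff)

lemma sum_size_filter:
  assumes "finite A"
  shows "(\<Sum>u\<in>A. size {#e \<in># G. f e = u#}) = size {#e \<in># G. f e \<in> A#}"
proof (induction G)
  case (add x G)
  have "(\<Sum>u\<in>A. size {#e \<in># add_mset x G. f e = u#}) =
      (\<Sum>u\<in>A. (if f x = u then 1 else 0) + size {#e \<in># G. f e = u#})"
    by (intro sum.cong) auto
  also have "\<dots> = (if f x \<in> A then 1 else 0) + (\<Sum>u\<in>A. size {#e \<in># G. f e = u#})"
    using assms by (simp add: sum.distrib)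
  finally show ?case
    using add.IH by simp
qed simp

text \<open>
  The state of the process when all nodes up to \<open>T\<close> are complete and node \<open>T + 1\<close> has sent out
  \<open>k\<close> edges.
\<close>

definition pa_stage :: "nat \<Rightarrow> nat \<Rightarrow> nat \<Rightarrow> multigraph \<Rightarrow> bool" where
  "pa_stage m T k G \<longleftrightarrow>
     (\<forall>e\<in>#G. 1 \<le> snd e \<and> snd e < fst e \<and> fst e \<le> Suc T) \<and>
     (\<forall>s\<in>{2..T}. size {#e \<in># G. fst e = s#} = m) \<and> size {#e \<in># G. fst e = Suc T#} = k"

lemma pa_stage_edge: "pa_stage m T k G \<Longrightarrow> (s, v) \<in># G \<Longrightarrow> 1 \<le> v \<and> v < s \<and> s \<le> Suc T"
  by (auto simp: pa_stage_def)

lemma pa_stage_0_edge: "pa_stage m T 0 G \<Longrightarrow> (s, v) \<in># G \<Longrightarrow> s \<le> T"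
  by (force simp: pa_stage_def le_Suc_eq)

lemma pa_stage_step:
  "pa_stage m T k G \<Longrightarrow> v \<in> {1..T} \<Longrightarrow> pa_stage m T (Suc k) (add_mset (Suc T, v) G)"
  by (auto simp: pa_stage_def)

lemma pa_stage_Suc:
  assumes "pa_stage m T m G"
  shows "pa_stage m (Suc T) 0 G"
proof -
  have e: "1 \<le> snd e \<and> snd e < fst e \<and> fst e \<le> Suc T" if "e \<in># G" for e
    using assms that by (simp add: pa_stage_def)
  have "size {#e \<in># G. fst e = s#} = m" if "s \<in> {2..Suc T}" for s
    using assms that by (cases "s = Suc T") (simp_all add: pa_stage_def)
  moreover have "{#e \<in># G. fst e = Suc (Suc T)#} = {#}"
    unfolding filter_mset_eq_mempty_iff using e by fastforce
  ultimately show ?thesis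
    using e unfolding pa_stage_def by (simp add: le_SucI)
qed

lemma pa_stage_start: "pa_stage m 2 0 (replicate_mset m (2, 1))"
proof -
  have "filter_mset P (replicate_mset m x) = (if P x then replicate_mset m x else {#})"
    for P and x :: "nat \<times> nat"
    by (induction m) auto
  then show ?thesis
    by (auto simp: pa_stage_def)
qed

lemma pa_weight_add_mset:
  "v \<noteq> t \<Longrightarrow> pa_weight \<delta> (add_mset (t, u) G) v = pa_weight \<delta> G v + of_bool (u = v)"
  by (simp add: pa_weight_def degree_def)

section \<open>Weights along the process\<close>

locale pref_attach =
  fixes m :: nat and \<delta> :: real
  assumes m_pos: "m > 0" and \<delta>: "- real m < \<delta>" "\<delta> < 0"
begin

text \<open>The sum of the weights of the nodes \<open>1, ..., t - 1\<close> just before node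
  \<open>t\<close> sends its first edge: \<open>m * (t - 2)\<close> edges counted twice, and
  \<open>\<delta>\<close> for each node.\<close>

definition total_weight :: "nat \<Rightarrow> real" where
  "total_weight t = (2 * m + \<delta>) * (real t - 1) - 2 * m"

lemma total_weight_pos: "T \<ge> 2 \<Longrightarrow> total_weight (Suc T) > 0"
proof -
  assume "T \<ge> 2"
  then have "0 \<le> real m * (real T - 2)"
    by simp
  also have "\<dots> = 2 * m * (real T - 1) + (- real m) * real T"
    by (simp add: algebra_simps)
  also have "\<dots> < 2 * m * (real T - 1) + \<delta> * real T"
    using \<delta>(1) \<open>T \<ge> 2\<close> by (intro add_strict_left_mono mult_strict_right_mono) auto
  finally show ?thesis
    by (simp add: total_weight_def algebra_simps)
qed

lemma sum_pa_weight:
  assumes "T \<ge> 1" "pa_stage m T k G"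
  shows "(\<Sum>u\<in>{1..T}. pa_weight \<delta> G u) = total_weight (Suc T) + k"
proof -
  have e: "1 \<le> snd e \<and> snd e < fst e \<and> fst e \<le> Suc T" if "e \<in># G" for e
    using assms(2) that by (auto simp: pa_stage_def)
  have "size {#e \<in># G. fst e = 1#} = 0"
    using e by fastforce
  then have out: "(\<Sum>u\<in>{1..T}. size {#e \<in># G. fst e = u#}) = m * (T - 1)"
  proof -
    have "{1..T} = insert 1 {2..T}"
      using assms(1) by auto
    then have "(\<Sum>u\<in>{1..T}. size {#e \<in># G. fst e = u#}) = (\<Sum>u\<in>{2..T}. size {#e \<in># G. fst e = u#})"
      using \<open>size {#e \<in># G. fst e = 1#} = 0\<close> by simp
    also have "\<dots> = (\<Sum>u\<in>{2..T}. m)"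
      using assms(2) by (intro sum.cong) (auto simp: pa_stage_def)
    finally show ?thesis
      by simp
  qed
  have "(\<Sum>u\<in>{1..T}. size {#e \<in># G. snd e = u#}) = size {#e \<in># G. snd e \<in> {1..T}#}"
    by (rule sum_size_filter) simp
  \<comment> \<open>Both filters keep every edge; sources are easier to count than targets.\<close>
  also have "{#e \<in># G. snd e \<in> {1..T}#} = {#e \<in># G. fst e \<in> {1..Suc T}#}"
    using e by (intro filter_mset_cong refl) fastforce
  also have "size \<dots> = (\<Sum>u\<in>{1..Suc T}. size {#e \<in># G. fst e = u#})"
    by (rule sum_size_filter[symmetric]) simp
  also have "\<dots> = m * (T - 1) + k"
    using out assms(2) by (simp add: pa_stage_def)
  finally have "(\<Sum>u\<in>{1..T}. real (degree G u)) = 2 * real (m * (T - 1)) + k"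
    unfolding degree_def of_nat_sum[symmetric] sum.distrib using out by simp
  then show ?thesis
    using assms(1) by (simp add: pa_weight_def sum.distrib total_weight_def of_nat_diff algebra_simps)
qed

lemma pa_weight_ge:
  assumes "T \<ge> 2" "pa_stage m T k G" "u \<in> {1..T}"
  shows "pa_weight \<delta> G u \<ge> m + \<delta>"
proof -
  have "m \<le> degree G u"
  proof (cases "u = 1")
    case True
    \<comment> \<open>Node \<open>1\<close> sends no edges; its degree is guaranteed by the
      \<open>m\<close> edges of node \<open>2\<close>.\<close>
    have "m = size {#e \<in># G. fst e = 2#}"
      using assms(1,2) by (simp add: pa_stage_def)
    also have "\<dots> = size {#e \<in># G. snd e = 1 \<and> fst e = 2#}"
    proof (rule arg_cong[where f = size], rule filter_mset_cong[OF refl])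
      fix e assume "e \<in># G"
      then have "1 \<le> snd e" "snd e < fst e"
        using assms(2) by (auto simp: pa_stage_def)
      then show "fst e = 2 \<longleftrightarrow> snd e = 1 \<and> fst e = 2"
        by auto
    qed
    also have "\<dots> \<le> size {#e \<in># G. snd e = 1#}"
      by (simp add: size_mset_mono flip: filter_filter_mset)
    also have "\<dots> \<le> degree G u"
      using True by (simp add: degree_def)
    finally show ?thesis .
  next
    case False
    then have "size {#e \<in># G. fst e = u#} = m"
      using assms(2,3) by (simp add: pa_stage_def)
    then show ?thesis
      by (simp add: degree_def)
  qed
  then show ?thesis
    by (simp add: pa_weight_def)
qed

lemma pa_weight_positive:
  assumes "T \<ge> 2" "pa_stage m T k G" "u \<in> {1..T}"
  shows "pa_weight \<delta> G u > 0"
  using pa_weight_ge[OF assms] \<delta> by simp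

lemma pmf_target:
  assumes "T \<ge> 2" "pa_stage m T k G"
  shows "pmf (pa_target \<delta> (Suc T) G) v =
    (if v \<in> {1..T} then pa_weight \<delta> G v / (total_weight (Suc T) + k) else 0)"
proof -
  have *: "{1..<Suc T} = {1..T}"
    by auto
  have "pmf (pa_target \<delta> (Suc T) G) v = (if v \<in> {1..<Suc T}
      then pa_weight \<delta> G v / (\<Sum>u\<in>{1..<Suc T}. pa_weight \<delta> G u) else 0)"
    using assms(1) pa_weight_positive[OF assms] unfolding * by (intro pmf_pa_target[of "Suc T" \<delta> G, unfolded *]) auto
  then show ?thesis
    using sum_pa_weight[OF _ assms(2)] assms(1) unfolding * by simp
qed

lemma set_pmf_target:
  assumes "T \<ge> 2" "pa_stage m T k G"
  shows "set_pmf (pa_target \<delta> (Suc T) G) = {1..T}"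
proof -
  have "pa_weight \<delta> G v / (total_weight (Suc T) + k) \<noteq> 0" if "v \<in> {1..T}" for v
    using total_weight_pos[OF assms(1)] pa_weight_positive[OF assms that] by (simp add: add_pos_nonneg less_imp_neq[symmetric])
  then show ?thesis
    unfolding set_pmf_eq pmf_target[OF assms] by auto
qed

lemma expectation_target:
  assumes "T \<ge> 2" "pa_stage m T k G"
  shows "measure_pmf.expectation (pa_target \<delta> (Suc T) G) h =
    (\<Sum>v\<in>{1..T}. pa_weight \<delta> G v / (total_weight (Suc T) + k) * h v)"
  by (subst integral_measure_pmf_real[of "{1..T}"])
    (auto simp: set_pmf_target[OF assms] pmf_target[OF assms] mult.commute)

lemma pa_stage_add_edges:
  assumes "T \<ge> 2" "pa_stage m T 0 G" "G' \<in> set_pmf (pa_add_edges \<delta> (Suc T) k G)"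
  shows "pa_stage m T k G'"
  using assms(3)
proof (induction k arbitrary: G')
  case (Suc k)
  then obtain H v where "H \<in> set_pmf (pa_add_edges \<delta> (Suc T) k G)"
    "v \<in> set_pmf (pa_target \<delta> (Suc T) H)" "G' = add_mset (Suc T, v) H"
    by auto
  then show ?case
    using Suc.IH[of H] set_pmf_target[OF assms(1), of k H] by (auto intro!: pa_stage_step)
qed (use assms(2) in auto)

lemma finite_set_pmf_add_edges:
  assumes "T \<ge> 2" "pa_stage m T 0 G"
  shows "finite (set_pmf (pa_add_edges \<delta> (Suc T) k G))"
proof (induction k)
  case (Suc k)
  then show ?case
    using set_pmf_target[OF assms(1) pa_stage_add_edges[OF assms]] by auto
qed auto

lemma pa_stage_graph:
  "T \<ge> 2 \<Longrightarrow> G \<in> set_pmf (pa_graph T \<delta> m) \<Longrightarrow> pa_stage m T 0 G"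
proof (induction T arbitrary: G rule: dec_induct)
  case base
  then show ?case
    using pa_stage_start by (simp add: numeral_2_eq_2)
next
  case (step T)
  then obtain H where "H \<in> set_pmf (pa_graph T \<delta> m)" "G \<in> set_pmf (pa_add_edges \<delta> (Suc T) m H)"
    by auto
  then have "pa_stage m T m G"
    using step.IH step.hyps(1) by (auto intro: pa_stage_add_edges)
  then show ?case
    by (rule pa_stage_Suc)
qed

lemma finite_set_pmf_graph: "T \<ge> 2 \<Longrightarrow> finite (set_pmf (pa_graph T \<delta> m))"
proof (induction T rule: dec_induct)
  case base
  then show ?case
    by (simp add: numeral_2_eq_2)
next
  case (step T)
  then show ?case
    using finite_set_pmf_add_edges[OF step.hyps(1) pa_stage_graph[OF step.hyps(1)]] by simp
qed

abbreviation expect_graph :: "nat \<Rightarrow> (multigraph \<Rightarrow> real) \<Rightarrow> real" where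
  "expect_graph T \<equiv> measure_pmf.expectation (pa_graph T \<delta> m)"

abbreviation expect_edges :: "nat \<Rightarrow> nat \<Rightarrow> multigraph \<Rightarrow> (multigraph \<Rightarrow> real) \<Rightarrow> real" where
  "expect_edges T k G \<equiv> measure_pmf.expectation (pa_add_edges \<delta> (Suc T) k G)"

lemma expectation_add_edges_Suc:
  assumes "T \<ge> 2" "pa_stage m T 0 G"
  shows "expect_edges T (Suc k) G h =
    expect_edges T k G
      (\<lambda>G'. \<Sum>v\<in>{1..T}. pa_weight \<delta> G' v / (total_weight (Suc T) + k) * h (add_mset (Suc T, v) G'))"
proof -
  have "finite (set_pmf (map_pmf (\<lambda>v. add_mset (Suc T, v) G') (pa_target \<delta> (Suc T) G')))"
    if "G' \<in> set_pmf (pa_add_edges \<delta> (Suc T) k G)" for G'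
    using set_pmf_target[OF assms(1) pa_stage_add_edges[OF assms that]] by simp
  then have "expect_edges T (Suc k) G h =
    expect_edges T k G
      (\<lambda>G'. measure_pmf.expectation (map_pmf (\<lambda>v. add_mset (Suc T, v) G') (pa_target \<delta> (Suc T) G')) h)"
    using finite_set_pmf_add_edges[OF assms] by (simp add: expectation_bind_finite)
  also have "\<dots> = expect_edges T k G
      (\<lambda>G'. \<Sum>v\<in>{1..T}. pa_weight \<delta> G' v / (total_weight (Suc T) + k) * h (add_mset (Suc T, v) G'))"
    by (intro expectation_cong)
      (simp add: expectation_target[OF assms(1) pa_stage_add_edges[OF assms]])
  finally show ?thesis .
qed

lemma expectation_graph_Suc:
  fixes h :: "multigraph \<Rightarrow> real"
  assumes "T \<ge> 2"
  shows "expect_graph (Suc T) h =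
    expect_graph T
      (\<lambda>G. expect_edges T m G h)"
proof -
  have "pa_graph (Suc T) \<delta> m = bind_pmf (pa_graph T \<delta> m) (pa_add_edges \<delta> (Suc T) m)"
    using assms by simp
  moreover have "measure_pmf.expectation (bind_pmf (pa_graph T \<delta> m) (pa_add_edges \<delta> (Suc T) m)) h =
    expect_graph T
      (\<lambda>G. expect_edges T m G h)"
    by (intro expectation_bind_finite finite_set_pmf_graph finite_set_pmf_add_edges assms pa_stage_graph)
  ultimately show ?thesis
    by (simp only:)
qed

text \<open>
  The product of rising factorials of the weights is multiplied in expectation by a deterministic
  factor at every step. The function \<open>\<kappa>\<close> counts the in-edges that each node is still to receive.
\<close>

definition weight_product :: "nat \<Rightarrow> (nat \<Rightarrow> nat) \<Rightarrow> multigraph \<Rightarrow> real" where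
  "weight_product T \<kappa> G = (\<Prod>v\<in>{1..T}. pochhammer (pa_weight \<delta> G v) (\<kappa> v))"

definition incr :: "(nat \<Rightarrow> nat) \<Rightarrow> nat set \<Rightarrow> nat \<Rightarrow> nat" where
  "incr \<kappa> A v = \<kappa> v + of_bool (v \<in> A)"

lemma incr_empty [simp]: "incr \<kappa> {} = \<kappa>"
  by (auto simp: incr_def)

lemma incr_incr: "a \<in> A \<Longrightarrow> incr (incr \<kappa> {a}) (A - {a}) = incr \<kappa> A"
  by (auto simp: incr_def fun_eq_iff)

lemma sum_incr: "finite V \<Longrightarrow> A \<subseteq> V \<Longrightarrow> (\<Sum>v\<in>V. incr \<kappa> A v) = (\<Sum>v\<in>V. \<kappa> v) + card A"
  by (simp add: incr_def sum.distrib Int_absorb1)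

lemma weight_product_pos:
  assumes "T \<ge> 2" "pa_stage m T k G"
  shows "weight_product T \<kappa> G > 0"
  unfolding weight_product_def
  using pa_weight_positive[OF assms] by (intro prod_pos) (auto intro: pochhammer_pos)

lemma weight_product_remove:
  assumes "a \<in> {1..T}"
  shows "weight_product T \<kappa> G = pochhammer (pa_weight \<delta> G a) (\<kappa> a) *
    (\<Prod>v\<in>{1..T} - {a}. pochhammer (pa_weight \<delta> G v) (\<kappa> v))"
  using assms unfolding weight_product_def by (intro prod.remove) auto

lemma weight_product_incr_remove:
  assumes "a \<in> {1..T}"
  shows "weight_product T (incr \<kappa> {a}) G = pochhammer (pa_weight \<delta> G a) (Suc (\<kappa> a)) *
    (\<Prod>v\<in>{1..T} - {a}. pochhammer (pa_weight \<delta> G v) (\<kappa> v))"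
  unfolding weight_product_remove[OF assms]
  by (intro arg_cong2[where f = "(*)"] prod.cong) (auto simp: incr_def)

lemma weight_product_incr:
  assumes "a \<in> {1..T}"
  shows "weight_product T (incr \<kappa> {a}) G = weight_product T \<kappa> G * (pa_weight \<delta> G a + \<kappa> a)"
  by (subst weight_product_incr_remove[OF assms], subst weight_product_remove[OF assms])
    (simp add: pochhammer_rec')

text \<open>The identity \<open>x * pochhammer (x + 1) k = pochhammer x (Suc k)\<close>: an edge to
  \<open>a\<close>, drawn with probability proportional to the weight of \<open>a\<close>, turns
  into one more unit of demand on \<open>a\<close>.\<close>

lemma weight_product_add_edge:
  assumes "a \<in> {1..T}"
  shows "pa_weight \<delta> G a * weight_product T \<kappa> (add_mset (Suc T, a) G) = weight_product T (incr \<kappa> {a}) G"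
proof -
  have "weight_product T \<kappa> (add_mset (Suc T, a) G) =
      pochhammer (pa_weight \<delta> G a + 1) (\<kappa> a) *
      (\<Prod>v\<in>{1..T} - {a}. pochhammer (pa_weight \<delta> G v) (\<kappa> v))"
    using assms unfolding weight_product_remove[OF assms]
    by (intro arg_cong2[where f = "(*)"] prod.cong) (auto simp: pa_weight_add_mset)
  then show ?thesis
    by (simp add: weight_product_incr_remove[OF assms] pochhammer_rec)
qed

text \<open>Choosing \<open>v\<close> yields the old product times
  \<open>weight + \<kappa> v\<close>, over the total weight. Summed over \<open>v\<close>, the
  weights reproduce that total and the demands add up.\<close>

lemma weight_product_step:
  assumes "T \<ge> 2" "pa_stage m T k G"
  shows "(\<Sum>v\<in>{1..T}. pa_weight \<delta> G v / (total_weight (Suc T) + k) *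
      weight_product T \<kappa> (add_mset (Suc T, v) G)) =
    (1 + real (\<Sum>v\<in>{1..T}. \<kappa> v) / (total_weight (Suc T) + k)) * weight_product T \<kappa> G"
proof -
  let ?W = "total_weight (Suc T) + k"
  have W: "?W > 0"
    using total_weight_pos[OF assms(1)] by simp
  have "(\<Sum>v\<in>{1..T}. pa_weight \<delta> G v / ?W * weight_product T \<kappa> (add_mset (Suc T, v) G)) =
      (\<Sum>v\<in>{1..T}. weight_product T \<kappa> G / ?W * (pa_weight \<delta> G v + \<kappa> v))"
    by (intro sum.cong refl)
      (use weight_product_add_edge[of _ T G \<kappa>] weight_product_incr[of _ T \<kappa> G] in simp)
  also have "\<dots> = weight_product T \<kappa> G / ?W * (?W + (\<Sum>v\<in>{1..T}. \<kappa> v))"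
    using sum_pa_weight[OF _ assms(2)] assms(1)
    by (subst sum_distrib_left[symmetric]) (simp add: sum.distrib)
  also have "\<dots> = (1 + (\<Sum>v\<in>{1..T}. \<kappa> v) / ?W) * weight_product T \<kappa> G"
    using W by (simp add: field_simps)
  finally show ?thesis .
qed

definition (in -) targets_hit :: "nat \<Rightarrow> nat set \<Rightarrow> multigraph \<Rightarrow> bool" where
  "targets_hit t A G \<longleftrightarrow> (\<forall>a\<in>A. (t, a) \<in># G)"

text \<open>Induction on the number of edges, according to whether the last edge hits a target that
  is still missing; if so, that target leaves \<open>A\<close> and becomes demand in
  \<open>\<kappa>\<close>. The factor \<open>j ^ card A\<close> bounds the ways of assigning edges
  to targets.\<close>

lemma expectation_targets_hit_le:
  assumes T: "T \<ge> 2" "pa_stage m T 0 G" and "A \<subseteq> {1..T}"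
  defines "S \<equiv> total_weight (Suc T)"
  shows "expect_edges T j G
      (\<lambda>G'. of_bool (targets_hit (Suc T) A G') * weight_product T \<kappa> G') \<le>
    (real j / S) ^ card A * (1 + real ((\<Sum>v\<in>{1..T}. \<kappa> v) + card A) / S) ^ j *
      weight_product T (incr \<kappa> A) G"
  using assms(3)
proof (induction j arbitrary: A \<kappa>)
  case 0
  then have "finite A"
    by (rule finite_subset) simp
  have "\<not> targets_hit (Suc T) A G" if "A \<noteq> {}"
    using that pa_stage_0_edge[OF T(2)] by (fastforce simp: targets_hit_def)
  then show ?case
  proof (cases "A = {}")
    case False
    then show ?thesis
      using \<open>finite A\<close> \<open>A \<noteq> {} \<Longrightarrow> \<not> targets_hit (Suc T) A G\<close> by (simp add: power_0_left)
  qed (simp add: targets_hit_def)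
next
  case (Suc j)
  then have "finite A"
    by (auto intro: finite_subset)
  have S: "S > 0"
    unfolding S_def by (rule total_weight_pos[OF T(1)])
  let ?K = "\<Sum>v\<in>{1..T}. \<kappa> v"
  let ?E = "expect_edges T j G"
  let ?F = "\<lambda>A \<kappa> G'. of_bool (targets_hit (Suc T) A G') * weight_product T \<kappa> G' :: real"
  define c where "c = 1 + real (?K + card A) / S"
  define \<Psi> where "\<Psi> = weight_product T (incr \<kappa> A) G"
  have c: "c \<ge> 1"
    using S by (simp add: c_def del: of_nat_sum of_nat_add)
  have \<Psi>: "\<Psi> > 0"
    unfolding \<Psi>_def by (rule weight_product_pos[OF T])
  have fin: "finite (set_pmf (pa_add_edges \<delta> (Suc T) j G))"
    by (rule finite_set_pmf_add_edges[OF T])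
  have "expect_edges T (Suc j) G (?F A \<kappa>) =
      ?E (\<lambda>G'. \<Sum>v\<in>{1..T}. pa_weight \<delta> G' v / (S + j) * ?F A \<kappa> (add_mset (Suc T, v) G'))"
    unfolding S_def by (rule expectation_add_edges_Suc[OF T])
  also have "\<dots> \<le> ?E (\<lambda>G'. c * ?F A \<kappa> G' + (\<Sum>a\<in>A. 1 / S * ?F (A - {a}) (incr \<kappa> {a}) G'))"
  proof (rule expectation_mono_finite[OF fin])
    fix G' assume "G' \<in> set_pmf (pa_add_edges \<delta> (Suc T) j G)"
    then have G': "pa_stage m T j G'"
      by (rule pa_stage_add_edges[OF T])
    let ?w = "\<lambda>v. pa_weight \<delta> G' v / (S + j)"
    let ?\<psi> = "\<lambda>v. weight_product T \<kappa> (add_mset (Suc T, v) G')"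
    have w: "?w v \<ge> 0" if "v \<in> {1..T}" for v
      using pa_weight_positive[OF T(1) G' that] S by simp
    have \<psi>: "?\<psi> v > 0" if "v \<in> {1..T}" for v
      using pa_stage_step[OF G' that] by (rule weight_product_pos[OF T(1)])
    \<comment> \<open>Either all of \<open>A\<close> was hit before, or the new edge supplies the
      one missing target.\<close>
    have ind: "of_bool (targets_hit (Suc T) A (add_mset (Suc T, v) G')) \<le>
        (of_bool (targets_hit (Suc T) A G') +
         of_bool (v \<in> A) * of_bool (targets_hit (Suc T) (A - {v}) G') :: real)" for v
      by (auto simp: targets_hit_def)
    have "(\<Sum>v\<in>{1..T}. ?w v * ?F A \<kappa> (add_mset (Suc T, v) G')) \<le>
        (\<Sum>v\<in>{1..T}. ?w v * ((of_bool (targets_hit (Suc T) A G') +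
         of_bool (v \<in> A) * of_bool (targets_hit (Suc T) (A - {v}) G')) * ?\<psi> v))"
      by (intro sum_mono mult_left_mono mult_right_mono ind w less_imp_le[OF \<psi>])
    also have "\<dots> = of_bool (targets_hit (Suc T) A G') * (\<Sum>v\<in>{1..T}. ?w v * ?\<psi> v) +
        (\<Sum>v\<in>{1..T}. of_bool (v \<in> A) * (of_bool (targets_hit (Suc T) (A - {v}) G') * (?w v * ?\<psi> v)))"
      by (simp add: sum_distrib_left sum.distrib algebra_simps)
    also have "(\<Sum>v\<in>{1..T}. of_bool (v \<in> A) * (of_bool (targets_hit (Suc T) (A - {v}) G') * (?w v * ?\<psi> v))) =
        (\<Sum>v\<in>A. of_bool (targets_hit (Suc T) (A - {v}) G') * (?w v * ?\<psi> v))"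
      using Suc.prems by (intro sum.mono_neutral_cong_right) auto
    also have "(\<Sum>v\<in>{1..T}. ?w v * ?\<psi> v) = (1 + ?K / (S + j)) * weight_product T \<kappa> G'"
      unfolding S_def by (rule weight_product_step[OF T(1) G'])
    also have "of_bool (targets_hit (Suc T) A G') * ((1 + ?K / (S + j)) * weight_product T \<kappa> G') \<le>
        of_bool (targets_hit (Suc T) A G') * (c * weight_product T \<kappa> G')"
    proof (intro mult_left_mono mult_right_mono less_imp_le[OF weight_product_pos[OF T(1) G']])
      have "?K / (S + j) \<le> real (?K + card A) / S"
        using S by (intro frac_le) (auto intro!: add_nonneg_nonneg sum_nonneg)
      then show "1 + ?K / (S + j) \<le> c"
        by (simp add: c_def)
    qed auto
    also have "(\<Sum>v\<in>A. of_bool (targets_hit (Suc T) (A - {v}) G') * (?w v * ?\<psi> v)) \<le>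
        (\<Sum>a\<in>A. 1 / S * ?F (A - {a}) (incr \<kappa> {a}) G')"
    proof (rule sum_mono)
      fix a assume "a \<in> A"
      then have a: "a \<in> {1..T}"
        using Suc.prems by blast
      have "?w a * ?\<psi> a = weight_product T (incr \<kappa> {a}) G' / (S + j)"
        using weight_product_add_edge[OF a, of G' \<kappa>] by simp
      also have "\<dots> \<le> weight_product T (incr \<kappa> {a}) G' / S"
        using S weight_product_pos[OF T(1) G', of "incr \<kappa> {a}"] by (intro divide_left_mono) auto
      finally have "of_bool (targets_hit (Suc T) (A - {a}) G') * (?w a * ?\<psi> a) \<le>
          of_bool (targets_hit (Suc T) (A - {a}) G') * (weight_product T (incr \<kappa> {a}) G' / S)"
        by (rule mult_left_mono) simp
      then show "of_bool (targets_hit (Suc T) (A - {a}) G') * (?w a * ?\<psi> a) \<le>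
          1 / S * ?F (A - {a}) (incr \<kappa> {a}) G'"
        by (simp add: mult_ac)
    qed
    finally show "(\<Sum>v\<in>{1..T}. ?w v * ?F A \<kappa> (add_mset (Suc T, v) G')) \<le>
        c * ?F A \<kappa> G' + (\<Sum>a\<in>A. 1 / S * ?F (A - {a}) (incr \<kappa> {a}) G')"
      by (simp add: mult_ac)
  qed
  also have "\<dots> = c * ?E (?F A \<kappa>) + (\<Sum>a\<in>A. 1 / S * ?E (?F (A - {a}) (incr \<kappa> {a})))"
    by (simp add: integrable_measure_pmf_finite[OF fin] del: of_bool_eq)
  also have "\<dots> \<le> c * ((real j / S) ^ card A * c ^ j * \<Psi>) +
      (\<Sum>a\<in>A. 1 / S * ((real j / S) ^ (card A - 1) * c ^ j * \<Psi>))"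
  proof (intro add_mono mult_left_mono sum_mono)
    show "?E (?F A \<kappa>) \<le> (real j / S) ^ card A * c ^ j * \<Psi>"
      using Suc.IH[OF Suc.prems] by (simp add: c_def \<Psi>_def)
    fix a assume a: "a \<in> A"
    \<comment> \<open>Demand plus number of missing targets is invariant, so the induction
      hypothesis yields the same \<open>c\<close>.\<close>
    have "(\<Sum>v\<in>{1..T}. incr \<kappa> {a} v) + card (A - {a}) = ?K + card A"
      using a Suc.prems card_Suc_Diff1[OF \<open>finite A\<close> a] by (subst sum_incr) auto
    then show "?E (?F (A - {a}) (incr \<kappa> {a})) \<le> (real j / S) ^ (card A - 1) * c ^ j * \<Psi>"
      using Suc.IH[of "A - {a}" "incr \<kappa> {a}"] a Suc.prems \<open>finite A\<close>
      by (auto simp: c_def \<Psi>_def incr_incr)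
  qed (use c S in auto)
  also have "\<dots> \<le> (real (Suc j) / S) ^ card A * c ^ Suc j * \<Psi>"
  proof (cases "A = {}")
    case True
    then show ?thesis
      by simp
  next
    case False
    then obtain n where n: "card A = Suc n"
      using \<open>finite A\<close> by (cases "card A") auto
    have "c * ((real j / S) ^ card A * c ^ j * \<Psi>) + (\<Sum>a\<in>A. 1 / S * ((real j / S) ^ (card A - 1) * c ^ j * \<Psi>)) =
        (c * real j ^ Suc n + Suc n * real j ^ n) * (c ^ j * \<Psi> / S ^ Suc n)"
      using S by (simp add: n power_divide field_simps)
    also have "\<dots> \<le> (c * real (Suc j) ^ Suc n) * (c ^ j * \<Psi> / S ^ Suc n)"
    proof (rule mult_right_mono)
      \<comment> \<open>The two leading terms of the binomial expansion of
        \<open>(j + 1) ^ Suc n\<close>.\<close>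
      have "real j ^ Suc n + Suc n * real j ^ n \<le> real (Suc j) ^ Suc n"
      proof (induction n)
        case (Suc n)
        have "real j ^ Suc (Suc n) + Suc (Suc n) * real j ^ Suc n \<le>
            (real j + 1) * (real j ^ Suc n + Suc n * real j ^ n)"
          by (simp add: algebra_simps)
        also have "\<dots> \<le> (real j + 1) * real (Suc j) ^ Suc n"
          using Suc by (intro mult_left_mono) auto
        finally show ?case
          by (simp add: add.commute)
      qed simp
      moreover have "Suc n * real j ^ n \<le> c * (Suc n * real j ^ n)"
        using mult_right_mono[OF c, of "Suc n * real j ^ n"] by simp
      ultimately have "c * real j ^ Suc n + Suc n * real j ^ n \<le> c * (real j ^ Suc n + Suc n * real j ^ n)"
        by (simp add: algebra_simps)
      also have "\<dots> \<le> c * real (Suc j) ^ Suc n"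
        using c \<open>_ \<le> real (Suc j) ^ Suc n\<close> by (intro mult_left_mono) auto
      finally show "c * real j ^ Suc n + Suc n * real j ^ n \<le> c * real (Suc j) ^ Suc n" .
    qed (use c \<Psi> S in auto)
    also have "\<dots> = (real (Suc j) / S) ^ card A * c ^ Suc j * \<Psi>"
      by (simp add: n power_divide)
    finally show ?thesis .
  qed
  finally show ?case
    by (simp only: c_def \<Psi>_def)
qed

lemma expectation_weight_product_ge:
  assumes T: "T \<ge> 2" "pa_stage m T 0 G" and "j \<le> m"
  shows "(1 + real (\<Sum>v\<in>{1..T}. \<kappa> v) / (total_weight (Suc T) + m)) ^ j * weight_product T \<kappa> G \<le>
    expect_edges T j G (weight_product T \<kappa>)"
  using assms(3)
proof (induction j)
  case (Suc j)
  let ?S = "total_weight (Suc T)" and ?K = "\<Sum>v\<in>{1..T}. \<kappa> v"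
  let ?E = "expect_edges T j G"
  have S: "?S > 0"
    by (rule total_weight_pos[OF T(1)])
  have "(1 + ?K / (?S + m)) ^ Suc j * weight_product T \<kappa> G \<le> (1 + ?K / (?S + m)) * ?E (weight_product T \<kappa>)"
    using Suc S by (simp add: mult.assoc) (auto intro!: mult_left_mono add_nonneg_nonneg sum_nonneg divide_nonneg_nonneg)
  also have "\<dots> = ?E (\<lambda>G'. (1 + ?K / (?S + m)) * weight_product T \<kappa> G')"
    by simp
  also have "\<dots> \<le> ?E (\<lambda>G'. (1 + ?K / (?S + j)) * weight_product T \<kappa> G')"
  proof (rule expectation_mono_finite[OF finite_set_pmf_add_edges[OF T]])
    fix G' assume "G' \<in> set_pmf (pa_add_edges \<delta> (Suc T) j G)"
    then have "weight_product T \<kappa> G' > 0"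
      by (intro weight_product_pos[OF T(1)] pa_stage_add_edges[OF T])
    moreover have "?K / (?S + m) \<le> ?K / (?S + j)"
      using S Suc.prems by (intro divide_left_mono) (auto intro!: sum_nonneg)
    ultimately show "(1 + ?K / (?S + m)) * weight_product T \<kappa> G' \<le> (1 + ?K / (?S + j)) * weight_product T \<kappa> G'"
      by (intro mult_right_mono) auto
  qed
  also have "\<dots> = expect_edges T (Suc j) G (weight_product T \<kappa>)"
    unfolding expectation_add_edges_Suc[OF T]
    by (intro expectation_cong weight_product_step[symmetric] T(1) pa_stage_add_edges[OF T])
  finally show ?case .
qed simp

text \<open>Keep only the event that the last edge hits a chosen \<open>a \<in> A\<close> and the
  earlier ones hit the rest. Once \<open>A\<close> is exhausted, the remaining edges only increase
  the expected weight product.\<close>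

lemma expectation_targets_hit_ge:
  assumes T: "T \<ge> 2" "pa_stage m T 0 G" and "A \<subseteq> {1..T}" "card A \<le> j" "j \<le> m"
  defines "S \<equiv> total_weight (Suc T)"
  shows "weight_product T (incr \<kappa> A) G / (S + m) ^ card A \<le>
    expect_edges T j G
      (\<lambda>G'. of_bool (targets_hit (Suc T) A G') * weight_product T \<kappa> G')"
  using assms(3-5)
proof (induction j arbitrary: A \<kappa>)
  case 0
  then have "A = {}"
    using finite_subset[OF 0(1)] by simp
  then show ?case
    by (simp add: targets_hit_def)
next
  case (Suc j)
  then have "finite A"
    by (auto intro: finite_subset)
  have S: "S > 0"
    unfolding S_def by (rule total_weight_pos[OF T(1)])
  show ?case
  proof (cases "A = {}")
    case True
    have "1 * weight_product T \<kappa> G \<le>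
        (1 + real (\<Sum>v\<in>{1..T}. \<kappa> v) / (total_weight (Suc T) + m)) ^ Suc j * weight_product T \<kappa> G"
      using S less_imp_le[OF weight_product_pos[OF T, of \<kappa>]]
      by (intro mult_right_mono one_le_power) (auto simp: S_def intro!: divide_nonneg_nonneg sum_nonneg)
    also note expectation_weight_product_ge[OF T Suc.prems(3), of \<kappa>]
    finally show ?thesis
      using True by (simp add: targets_hit_def)
  next
    case False
    then obtain a where a: "a \<in> A" "a \<in> {1..T}"
      using Suc.prems(1) by blast
    let ?E = "expect_edges T j G"
    let ?F = "\<lambda>A \<kappa> G'. of_bool (targets_hit (Suc T) A G') * weight_product T \<kappa> G' :: real"
    have card: "card A = Suc (card (A - {a}))"
      using a(1) \<open>finite A\<close> by (metis card.remove)
    then have "card (A - {a}) \<le> j"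
      using Suc.prems(2) by linarith
    have "weight_product T (incr \<kappa> A) G / (S + m) ^ card A =
        1 / (S + m) * (weight_product T (incr (incr \<kappa> {a}) (A - {a})) G / (S + m) ^ card (A - {a}))"
      by (subst card) (simp add: incr_incr[OF a(1)])
    also have "\<dots> \<le> 1 / (S + m) * ?E (?F (A - {a}) (incr \<kappa> {a}))"
      using Suc.prems \<open>card (A - {a}) \<le> j\<close> S by (intro mult_left_mono Suc.IH) auto
    also have "\<dots> = ?E (\<lambda>G'. 1 / (S + m) * ?F (A - {a}) (incr \<kappa> {a}) G')"
      by simp
    also have "\<dots> \<le> ?E (\<lambda>G'. \<Sum>v\<in>{1..T}. pa_weight \<delta> G' v / (S + j) * ?F A \<kappa> (add_mset (Suc T, v) G'))"
    proof (rule expectation_mono_finite[OF finite_set_pmf_add_edges[OF T]])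
      fix G' assume "G' \<in> set_pmf (pa_add_edges \<delta> (Suc T) j G)"
      then have G': "pa_stage m T j G'"
        by (rule pa_stage_add_edges[OF T])
      let ?f = "\<lambda>v. pa_weight \<delta> G' v / (S + j) * ?F A \<kappa> (add_mset (Suc T, v) G')"
      have hit: "targets_hit (Suc T) A (add_mset (Suc T, a) G') \<longleftrightarrow> targets_hit (Suc T) (A - {a}) G'"
        by (auto simp: targets_hit_def)
      have "1 / (S + m) * ?F (A - {a}) (incr \<kappa> {a}) G' \<le> 1 / (S + j) * ?F (A - {a}) (incr \<kappa> {a}) G'"
        using S Suc.prems(3) less_imp_le[OF weight_product_pos[OF T(1) G']]
        by (intro mult_right_mono divide_left_mono) auto
      also have "\<dots> = ?f a"
        using weight_product_add_edge[OF a(2), of G' \<kappa>] by (simp add: hit mult_ac)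
      also have "\<dots> \<le> (\<Sum>v\<in>{1..T}. ?f v)"
      proof (rule member_le_sum[OF a(2)])
        fix v assume "v \<in> {1..T} - {a}"
        then show "0 \<le> ?f v"
          using S less_imp_le[OF pa_weight_positive[OF T(1) G', of v]]
            less_imp_le[OF weight_product_pos[OF T(1) pa_stage_step[OF G', of v], of \<kappa>]]
          by (intro mult_nonneg_nonneg divide_nonneg_nonneg) auto
      qed simp
      finally show "1 / (S + m) * ?F (A - {a}) (incr \<kappa> {a}) G' \<le> (\<Sum>v\<in>{1..T}. ?f v)" .
    qed
    also have "\<dots> = expect_edges T (Suc j) G (?F A \<kappa>)"
      unfolding S_def by (rule expectation_add_edges_Suc[OF T, symmetric])
    finally show ?thesis .
  qed
qed

end

section \<open>Upper bounds for the probability of prescribed edges\<close>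

lemma add_edges_old_edges:
  "G' \<in> set_pmf (pa_add_edges \<delta> t k G) \<Longrightarrow> s \<noteq> t \<Longrightarrow> (s, v) \<in># G' \<longleftrightarrow> (s, v) \<in># G"
  by (induction k arbitrary: G') auto

definition in_count :: "(nat \<times> nat) set \<Rightarrow> nat \<Rightarrow> nat" where
  "in_count F v = card {e \<in> F. snd e = v}"

definition forward_edges :: "nat \<Rightarrow> (nat \<times> nat) set" where
  "forward_edges T = {(s, v). 1 \<le> v \<and> v < s \<and> s \<le> T}"

lemma finite_forward_edges: "finite (forward_edges T)"
  by (rule finite_subset[of _ "{..T} \<times> {..T}"]) (auto simp: forward_edges_def)

context pref_attach
begin

text \<open>For \<open>t \<ge> 3\<close> this is the factor per target in
  \<open>expectation_targets_hit_le\<close> with all \<open>m\<close> edges. At \<open>t = 2\<close>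
  the edge is certain, and \<open>1 / (m + \<delta>)\<close> only offsets the additional Pochhammer
  factor that it brings in.\<close>

definition rate :: "nat \<Rightarrow> real" where
  "rate t = (if t \<le> 2 then 1 / (m + \<delta>) else m / total_weight t)"

text \<open>A bound for the expected growth of a weight per unit of demand. The exponential is used
  because \<open>(1 + K / S) ^ m\<close> is at most the \<open>K\<close>-th power of
  \<open>exp (m / S)\<close>, which then distributes over the nodes.\<close>

definition growth :: "nat \<Rightarrow> real" where
  "growth t = exp (\<Sum>s\<in>{3..t}. rate s)"

lemma growth_pos [simp]: "growth t > 0"
  by (simp add: growth_def)

lemma growth_nonneg [simp]: "growth t \<ge> 0"
  by (simp add: growth_def)

lemma growth_nonzero [simp]: "growth t \<noteq> 0"
  by (simp add: growth_def)

lemma growth_Suc: "T \<ge> 2 \<Longrightarrow> growth (Suc T) = growth T * exp (rate (Suc T))"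
  by (simp add: growth_def exp_add)

lemma growth_le_2: "t \<le> 2 \<Longrightarrow> growth t = 1"
  by (simp add: growth_def)

lemma rate_pos: "rate t > 0"
  using total_weight_pos[of "t - 1"] m_pos \<delta> by (simp add: rate_def)

lemma pa_weight_last:
  assumes "pa_stage m T m G"
  shows "pa_weight \<delta> G (Suc T) = m + \<delta>"
proof -
  have "1 \<le> snd e \<and> snd e < fst e \<and> fst e \<le> Suc T" if "e \<in># G" for e
    using assms that by (simp add: pa_stage_def)
  then have "{#e \<in># G. snd e = Suc T#} = {#}"
    unfolding filter_mset_eq_mempty_iff by fastforce
  then show ?thesis
    using assms by (simp add: pa_weight_def degree_def pa_stage_def)
qed

lemma weight_product_Suc:
  assumes "pa_stage m T m G"
  shows "weight_product (Suc T) \<kappa> G = weight_product T \<kappa> G * pochhammer (m + \<delta>) (\<kappa> (Suc T))"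
  using pa_weight_last[OF assms] by (simp add: weight_product_def)

text \<open>
  Every edge \<open>(s, v)\<close> costs a factor \<open>rate s\<close> when it is placed, and its demand on the weight of
  \<open>v\<close> costs the growth of that weight between the times \<open>v\<close> and \<open>s\<close>.
\<close>

lemma expectation_edges_le:
  assumes "T \<ge> 2" "F \<subseteq> forward_edges T"
  shows "expect_graph T
      (\<lambda>G. of_bool (F \<subseteq> set_mset G) * weight_product T \<kappa> G) \<le>
    (\<Prod>v\<in>{1..T}. pochhammer (m + \<delta>) (\<kappa> v + in_count F v)) *
    (\<Prod>(s, v)\<in>F. rate s * (growth s / growth v)) *
    (\<Prod>v\<in>{1..T}. (growth T / growth v) ^ \<kappa> v)"
  using assms
proof (induction T arbitrary: F \<kappa> rule: dec_induct)
  case base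
  let ?G = "replicate_mset m (2, 1) :: multigraph"
  have interval: "{1..2} = {1, 2 :: nat}"
    by auto
  have w: "pa_weight \<delta> ?G 1 = m + \<delta>" "pa_weight \<delta> ?G 2 = m + \<delta>"
  proof -
    have "filter_mset P (replicate_mset m x) = (if P x then replicate_mset m x else {#})"
      for P and x :: "nat \<times> nat"
      by (induction m) auto
    then show "pa_weight \<delta> ?G 1 = m + \<delta>" "pa_weight \<delta> ?G 2 = m + \<delta>"
      by (simp_all add: pa_weight_def degree_def)
  qed
  have lhs: "expect_graph 2 (\<lambda>G. of_bool (F \<subseteq> set_mset G) * weight_product 2 \<kappa> G) =
      of_bool (F \<subseteq> {(2, 1)}) * (pochhammer (m + \<delta>) (\<kappa> 1) * pochhammer (m + \<delta>) (\<kappa> 2))"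
    using m_pos w by (simp add: numeral_2_eq_2 weight_product_def interval[unfolded numeral_2_eq_2])
  have "F \<subseteq> {(2, 1)}"
    using base by (auto simp: forward_edges_def)
  then consider "F = {}" | "F = {(2, 1)}"
    by blast
  then show ?case
  proof cases
    case 1
    then show ?thesis
      unfolding lhs interval by (simp add: in_count_def growth_le_2)
  next
    case 2
    have fibers: "{e \<in> F. snd e = 1} = {(2, 1)}" "{e \<in> F. snd e = 2} = {}"
      using 2 by auto
    have count: "in_count F 1 = 1" "in_count F 2 = 0"
      unfolding in_count_def fibers by simp_all
    have pos: "pochhammer (m + \<delta>) k > 0" for k
      using \<delta> by (intro pochhammer_pos) simp
    \<comment> \<open>The additional factor is \<open>m + \<delta> + \<kappa> 1\<close>, at least
      the \<open>m + \<delta>\<close> in the denominator of \<open>rate 2\<close>.\<close>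
    have "pochhammer (m + \<delta>) (\<kappa> 1) \<le> pochhammer (m + \<delta>) (Suc (\<kappa> 1)) * (1 / (m + \<delta>))"
      using pos[of "\<kappa> 1"] \<delta> by (simp add: pochhammer_rec' field_simps)
    then have "pochhammer (m + \<delta>) (\<kappa> 1) * pochhammer (m + \<delta>) (\<kappa> 2) \<le>
        pochhammer (m + \<delta>) (Suc (\<kappa> 1)) * (1 / (m + \<delta>)) * pochhammer (m + \<delta>) (\<kappa> 2)"
      by (rule mult_right_mono[OF _ less_imp_le[OF pos]])
    then show ?thesis
      unfolding lhs interval using count 2 by (simp add: growth_le_2 rate_def mult_ac)
  qed
next
  case (step T)
  define t where "t = Suc T"
  define A where "A = {a. (t, a) \<in> F}"
  define F' where "F' = {e \<in> F. fst e \<noteq> t}"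
  define S where "S = total_weight t"
  define K where "K = (\<Sum>v\<in>{1..T}. incr \<kappa> A v)"
  have A: "A \<subseteq> {1..T}"
    using step.prems by (auto simp: A_def t_def forward_edges_def)
  then have fin_A: "finite A"
    by (rule finite_subset) simp
  have F': "F' \<subseteq> forward_edges T"
    using step.prems by (auto simp: F'_def t_def forward_edges_def)
  have F_split: "F = F' \<union> Pair t ` A"
    by (auto simp: F'_def A_def)
  have fin_F: "finite F'"
    using finite_subset[OF F' finite_forward_edges] .
  have S: "S > 0"
    using total_weight_pos[OF step.hyps(1)] by (simp add: S_def t_def)
  have K: "(\<Sum>v\<in>{1..T}. \<kappa> v) + card A = K"
    unfolding K_def by (subst sum_incr[OF _ A]) auto
  define p where "p = pochhammer (m + \<delta>) (\<kappa> t)"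
  have p: "p > 0"
    unfolding p_def using \<delta> by (intro pochhammer_pos) simp
  have rate_t: "rate t = m / S"
    using step.hyps(1) by (simp add: rate_def t_def S_def)
  have growth_t: "growth t / growth T = exp (m / S)"
    using growth_Suc[OF step.hyps(1)] rate_t by (simp add: t_def)
  have "(1 + K / S) ^ m \<le> exp (K / S) ^ m"
    using S by (intro power_mono) auto
  also have "\<dots> = (growth t / growth T) ^ K"
    unfolding growth_t by (simp add: exp_of_nat_mult[symmetric] mult.commute)
  finally have factor: "(1 + K / S) ^ m \<le> (growth t / growth T) ^ K" .
  let ?E = "expect_graph T"
  have "expect_graph (Suc T) (\<lambda>G. of_bool (F \<subseteq> set_mset G) * weight_product (Suc T) \<kappa> G) =
      ?E (\<lambda>G. expect_edges T m G
        (\<lambda>G'. of_bool (F \<subseteq> set_mset G') * weight_product (Suc T) \<kappa> G'))"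
    by (rule expectation_graph_Suc[OF step.hyps(1)])
  also have "\<dots> \<le> ?E (\<lambda>G. p * (rate t ^ card A * (growth t / growth T) ^ K) *
      (of_bool (F' \<subseteq> set_mset G) * weight_product T (incr \<kappa> A) G))"
  proof (rule expectation_mono_finite[OF finite_set_pmf_graph[OF step.hyps(1)]])
    fix G assume "G \<in> set_pmf (pa_graph T \<delta> m)"
    then have G: "pa_stage m T 0 G"
      by (rule pa_stage_graph[OF step.hyps(1)])
    let ?A = "expect_edges T m G"
    have "?A (\<lambda>G'. of_bool (F \<subseteq> set_mset G') * weight_product (Suc T) \<kappa> G') =
        ?A (\<lambda>G'. (of_bool (F' \<subseteq> set_mset G) * p) * (of_bool (targets_hit (Suc T) A G') * weight_product T \<kappa> G'))"
    proof (rule expectation_cong)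
      fix G' assume G': "G' \<in> set_pmf (pa_add_edges \<delta> (Suc T) m G)"
      have "F' \<subseteq> set_mset G' \<longleftrightarrow> F' \<subseteq> set_mset G"
        using add_edges_old_edges[OF G'] by (fastforce simp: F'_def t_def)
      then have "F \<subseteq> set_mset G' \<longleftrightarrow> F' \<subseteq> set_mset G \<and> targets_hit (Suc T) A G'"
        unfolding F_split by (auto simp: targets_hit_def t_def)
      moreover have "weight_product (Suc T) \<kappa> G' = weight_product T \<kappa> G' * p"
        unfolding p_def t_def by (rule weight_product_Suc[OF pa_stage_add_edges[OF step.hyps(1) G G']])
      ultimately show "of_bool (F \<subseteq> set_mset G') * weight_product (Suc T) \<kappa> G' =
          (of_bool (F' \<subseteq> set_mset G) * p) * (of_bool (targets_hit (Suc T) A G') * weight_product T \<kappa> G')"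
        by simp
    qed
    also have "\<dots> = of_bool (F' \<subseteq> set_mset G) * p * ?A (\<lambda>G'. of_bool (targets_hit (Suc T) A G') * weight_product T \<kappa> G')"
      by (rule integral_mult_right_zero)
    also have "\<dots> \<le> of_bool (F' \<subseteq> set_mset G) * p *
        ((real m / S) ^ card A * (1 + K / S) ^ m * weight_product T (incr \<kappa> A) G)"
      using expectation_targets_hit_le[OF step.hyps(1) G A, of m \<kappa>, folded t_def, folded S_def] p
      unfolding K by (intro mult_left_mono) (auto simp: t_def)
    also have "\<dots> \<le> of_bool (F' \<subseteq> set_mset G) * p *
        ((real m / S) ^ card A * (growth t / growth T) ^ K * weight_product T (incr \<kappa> A) G)"
      using factor p S less_imp_le[OF weight_product_pos[OF step.hyps(1) G]]
      by (intro mult_left_mono mult_right_mono) auto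
    finally show "?A (\<lambda>G'. of_bool (F \<subseteq> set_mset G') * weight_product (Suc T) \<kappa> G') \<le>
        p * (rate t ^ card A * (growth t / growth T) ^ K) *
        (of_bool (F' \<subseteq> set_mset G) * weight_product T (incr \<kappa> A) G)"
      by (simp add: rate_t mult_ac)
  qed
  also have "\<dots> = p * (rate t ^ card A * (growth t / growth T) ^ K) *
      ?E (\<lambda>G. of_bool (F' \<subseteq> set_mset G) * weight_product T (incr \<kappa> A) G)"
    by (rule integral_mult_right_zero)
  \<comment> \<open>The edges of the last node have become demand \<open>incr \<kappa> A\<close> at
    time \<open>T\<close>; the induction hypothesis applies to the remaining edges
    \<open>F'\<close>.\<close>
  also have "\<dots> \<le> p * (rate t ^ card A * (growth t / growth T) ^ K) *
     ((\<Prod>v\<in>{1..T}. pochhammer (m + \<delta>) (incr \<kappa> A v + in_count F' v)) *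
      (\<Prod>(s, v)\<in>F'. rate s * (growth s / growth v)) *
      (\<Prod>v\<in>{1..T}. (growth T / growth v) ^ incr \<kappa> A v))"
    using p less_imp_le[OF rate_pos[of t]] by (intro mult_left_mono step.IH F') (auto intro!: mult_nonneg_nonneg)
  also have "\<dots> = (p * (\<Prod>v\<in>{1..T}. pochhammer (m + \<delta>) (incr \<kappa> A v + in_count F' v))) *
      ((\<Prod>(s, v)\<in>F'. rate s * (growth s / growth v)) * rate t ^ card A) *
      ((growth t / growth T) ^ K * (\<Prod>v\<in>{1..T}. (growth T / growth v) ^ incr \<kappa> A v))"
    by (simp only: mult_ac)
  also have "p * (\<Prod>v\<in>{1..T}. pochhammer (m + \<delta>) (incr \<kappa> A v + in_count F' v)) =
      (\<Prod>v\<in>{1..Suc T}. pochhammer (m + \<delta>) (\<kappa> v + in_count F v))"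
  proof -
    have "in_count F t = 0"
    proof -
      have fiber: "{e \<in> F. snd e = t} = {}"
        using step.prems by (auto simp: forward_edges_def t_def)
      show ?thesis
        unfolding in_count_def fiber by simp
    qed
    moreover have "in_count F v = in_count F' v + of_bool (v \<in> A)" for v
    proof -
      have "{e \<in> F. snd e = v} = (if v \<in> A then insert (t, v) {e \<in> F'. snd e = v} else {e \<in> F'. snd e = v})"
        by (auto simp: F'_def A_def)
      moreover have "(t, v) \<notin> {e \<in> F'. snd e = v}"
        by (simp add: F'_def)
      ultimately show ?thesis
        using fin_F by (simp add: in_count_def)
    qed
    ultimately show ?thesis
      by (simp add: p_def t_def incr_def mult.commute add_ac)
  qed
  \<comment> \<open>\<open>K\<close> is the sum of the demands, so \<open>growth T\<close> cancels
    node by node.\<close>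
  also have "(growth t / growth T) ^ K * (\<Prod>v\<in>{1..T}. (growth T / growth v) ^ incr \<kappa> A v) =
      (\<Prod>v\<in>{1..T}. (growth t / growth v) ^ incr \<kappa> A v)"
    unfolding K_def power_sum prod.distrib[symmetric] by (simp flip: power_mult_distrib)
  \<comment> \<open>The extra unit of demand at \<open>v \<in> A\<close> is the growth factor that
    belongs to the edge \<open>(t, v)\<close>.\<close>
  also have "\<dots> = (\<Prod>v\<in>{1..T}. (growth t / growth v) ^ \<kappa> v) * (\<Prod>v\<in>{1..T}. if v \<in> A then growth t / growth v else 1)"
    unfolding prod.distrib[symmetric] by (intro prod.cong) (auto simp: incr_def)
  also have "(\<Prod>v\<in>{1..T}. if v \<in> A then growth t / growth v else 1) = (\<Prod>v\<in>A. growth t / growth v)"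
    using A by (subst prod.inter_restrict[symmetric]) (auto simp: Int_absorb1)
  also have "(\<Prod>v\<in>{1..T}. (growth t / growth v) ^ \<kappa> v) = (\<Prod>v\<in>{1..Suc T}. (growth t / growth v) ^ \<kappa> v)"
    by (simp add: t_def)
  also have "(\<Prod>v\<in>{1..Suc T}. pochhammer (m + \<delta>) (\<kappa> v + in_count F v)) *
      ((\<Prod>(s, v)\<in>F'. rate s * (growth s / growth v)) * rate t ^ card A) *
      ((\<Prod>v\<in>{1..Suc T}. (growth t / growth v) ^ \<kappa> v) * (\<Prod>v\<in>A. growth t / growth v)) =
      (\<Prod>v\<in>{1..Suc T}. pochhammer (m + \<delta>) (\<kappa> v + in_count F v)) *
      ((\<Prod>(s, v)\<in>F'. rate s * (growth s / growth v)) * (rate t ^ card A * (\<Prod>v\<in>A. growth t / growth v))) *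
      (\<Prod>v\<in>{1..Suc T}. (growth t / growth v) ^ \<kappa> v)"
    by (simp only: mult_ac)
  also have "(\<Prod>(s, v)\<in>F'. rate s * (growth s / growth v)) * (rate t ^ card A * (\<Prod>v\<in>A. growth t / growth v)) =
      (\<Prod>(s, v)\<in>F. rate s * (growth s / growth v))"
  proof -
    have "(\<Prod>(s, v)\<in>F. rate s * (growth s / growth v)) =
        (\<Prod>(s, v)\<in>F'. rate s * (growth s / growth v)) * (\<Prod>(s, v)\<in>Pair t ` A. rate s * (growth s / growth v))"
      unfolding F_split using fin_F fin_A by (intro prod.union_disjoint) (auto simp: F'_def)
    also have "(\<Prod>(s, v)\<in>Pair t ` A. rate s * (growth s / growth v)) = (\<Prod>v\<in>A. rate t * (growth t / growth v))"
      by (subst prod.reindex) (auto simp: inj_on_def)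
    also have "\<dots> = rate t ^ card A * (\<Prod>v\<in>A. growth t / growth v)"
      by (subst prod.distrib) simp
    finally show ?thesis ..
  qed
  finally show ?case
    by (simp only: t_def)
qed

section \<open>Power-law asymptotics of the growth factors\<close>

definition theta :: real where
  "theta = m / (2 * m + \<delta>)"

abbreviation "chi \<equiv> pa_chi \<delta> m"

lemma theta_bounds: "1 / 2 < theta" "theta < 1"
  using m_pos \<delta> by (auto simp: theta_def field_simps)

lemma chi_eq: "chi = 1 - theta"
  using m_pos \<delta> by (simp add: pa_chi_def theta_def field_simps)

text \<open>\<open>\<delta> < 0\<close> amounts to \<open>theta > 1 / 2\<close>, hence
  \<open>chi < theta\<close>; \<open>\<delta> > - m\<close> amounts to \<open>theta < 1\<close>,
  hence \<open>chi > 0\<close>.\<close>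

lemma chi_bounds: "0 < chi" "chi < theta"
  using theta_bounds by (auto simp: chi_eq)

lemma total_weight_eq: "total_weight t = m / theta * (real t - 1 - 2 * theta)"
proof -
  have eq: "m / theta = 2 * m + \<delta>" "(2 * m + \<delta>) * theta = m"
    using m_pos \<delta> by (auto simp: theta_def field_simps)
  have "total_weight t = (2 * m + \<delta>) * (real t - 1) - 2 * ((2 * m + \<delta>) * theta)"
    unfolding total_weight_def eq(2) by simp
  also have "\<dots> = (2 * m + \<delta>) * (real t - 1 - 2 * theta)"
    by (simp add: algebra_simps)
  finally show ?thesis
    by (simp only: eq(1))
qed

lemma rate_eq: "t \<ge> 3 \<Longrightarrow> rate t = theta / (real t - 1 - 2 * theta)"
  using m_pos theta_bounds by (simp add: rate_def total_weight_eq)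

text \<open>Up to \<open>t = 3\<close> the left side is at most \<open>1\<close>, which explains the
  constant. Afterwards \<open>1 + 1 / t \<le> exp (1 / t)\<close> and
  \<open>theta / t \<le> rate (Suc t)\<close> compare the two sides factor by factor.\<close>

lemma growth_ge:
  assumes "t \<ge> 1"
  shows "growth t \<ge> (t / 3) powr theta"
proof (cases "t \<le> 3")
  case True
  have "(t / 3) powr theta \<le> 1 powr theta"
    using True theta_bounds by (intro powr_mono2) auto
  also have "\<dots> \<le> growth t"
    using less_imp_le[OF rate_pos] by (auto simp: growth_def intro!: sum_nonneg)
  finally show ?thesis .
next
  case False
  then have "3 \<le> t" by simp
  then show ?thesis
  proof (induction t rule: dec_induct)
    case base
    show ?case
      using less_imp_le[OF rate_pos] by (auto simp: growth_def intro!: sum_nonneg)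
  next
    case (step t)
    have "real (Suc t) / 3 = real t / 3 * (1 + 1 / real t)"
      using step.hyps by (simp add: field_simps)
    also have "\<dots> \<le> real t / 3 * exp (1 / real t)"
      by (intro mult_left_mono exp_ge_add_one_self) auto
    finally have "(real (Suc t) / 3) powr theta \<le> (real t / 3 * exp (1 / real t)) powr theta"
      using theta_bounds by (intro powr_mono2) auto
    also have "\<dots> = (real t / 3) powr theta * exp (theta / real t)"
      by (subst powr_mult) (auto simp: exp_powr_real)
    also have "\<dots> \<le> growth t * exp (rate (Suc t))"
    proof (intro mult_mono step.IH)
      have "theta / real t \<le> theta / (real (Suc t) - 1 - 2 * theta)"
        using theta_bounds step.hyps by (intro divide_left_mono) auto
      then show "exp (theta / real t) \<le> exp (rate (Suc t))"
        using step.hyps by (simp add: rate_eq)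
    qed auto
    also have "\<dots> = growth (Suc t)"
      using step.hyps by (intro growth_Suc[symmetric]) simp
    finally show ?case .
  qed
qed

text \<open>With \<open>y\<close> the shifted time in the denominator of the rate,
  \<open>exp (1 / y) \<le> y / (y - 1)\<close> telescopes. \<open>2 - 2 * theta\<close> is the
  shifted time at \<open>t = 3\<close>.\<close>

lemma growth_le:
  assumes "t \<ge> 3"
  shows "growth t \<le> exp (theta / (2 - 2 * theta)) * ((t - 1 - 2 * theta) / (2 - 2 * theta)) powr theta"
  using assms
proof (induction t rule: dec_induct)
  case base
  have "growth 3 = exp (rate 3)"
    by (simp add: growth_def)
  then show ?case
    using theta_bounds by (simp add: rate_eq)
next
  case (step t)
  define y where "y = real (Suc t) - 1 - 2 * theta"
  have y: "y > 1" "y - 1 = real t - 1 - 2 * theta" "2 - 2 * theta > 0"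
    using step.hyps theta_bounds by (auto simp: y_def)
  have "1 - 1 / y \<le> exp (- (1 / y))"
    using exp_ge_add_one_self[of "- (1 / y)"] by simp
  then have "exp (1 / y) \<le> y / (y - 1)"
    using y(1) by (simp add: exp_minus field_simps)
  then have "exp (1 / y) powr theta \<le> (y / (y - 1)) powr theta"
    using theta_bounds by (intro powr_mono2) auto
  then have *: "exp (theta / y) \<le> (y / (y - 1)) powr theta"
    by (simp add: exp_powr_real)
  have "growth (Suc t) = growth t * exp (theta / y)"
    using step.hyps by (simp add: growth_Suc rate_eq y_def)
  also have "\<dots> \<le> exp (theta / (2 - 2 * theta)) * ((y - 1) / (2 - 2 * theta)) powr theta * (y / (y - 1)) powr theta"
    using step.IH * y(1,3) unfolding y(2)[symmetric] by (intro mult_mono) auto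
  also have "\<dots> = exp (theta / (2 - 2 * theta)) * (((y - 1) / (2 - 2 * theta)) * (y / (y - 1))) powr theta"
    using y by (subst powr_mult) auto
  also have "((y - 1) / (2 - 2 * theta)) * (y / (y - 1)) = y / (2 - 2 * theta)"
    using y(1) by simp
  finally show ?case
    by (simp add: y_def)
qed

definition edge_weight :: "nat \<times> nat \<Rightarrow> real" where
  "edge_weight e = real (fst e) powr (- chi) * real (snd e) powr (- theta)"

text \<open>\<open>rate s\<close> is of order \<open>1 / s\<close> and \<open>growth\<close> of
  order \<open>t powr theta\<close>; moreover \<open>theta - 1 = - chi\<close>.\<close>

lemma edge_factor_le:
  "\<exists>C\<ge>1. \<forall>s v. 1 \<le> v \<longrightarrow> v < s \<longrightarrow> rate s * (growth s / growth v) \<le> C * edge_weight (s, v)"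
proof -
  define D where "D = exp (theta / (2 - 2 * theta)) * (1 / (2 - 2 * theta)) powr theta"
  define c where "c = 3 * theta / (2 - 2 * theta)"
  \<comment> \<open>\<open>2 / (m + \<delta>)\<close> handles the edge \<open>(2, 1)\<close> and
    \<open>c * D * 3 powr theta\<close> the sources \<open>s \<ge> 3\<close>;
    \<open>C \<ge> 1\<close> makes its powers monotone in the exponent.\<close>
  define C where "C = max 1 (max (2 / (m + \<delta>)) (c * D * 3 powr theta))"
  have th: "2 - 2 * theta > 0" "theta > 0"
    using theta_bounds by auto
  show ?thesis
  proof (intro exI[of _ C] conjI allI impI)
    show "C \<ge> 1"
      by (simp add: C_def)
    fix s v :: nat assume v: "1 \<le> v" "v < s"
    have nonneg: "edge_weight (s, v) \<ge> 0"
      by (simp add: edge_weight_def)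
    show "rate s * (growth s / growth v) \<le> C * edge_weight (s, v)"
    proof (cases "s \<ge> 3")
      case False
      then have sv: "s = 2" "v = 1"
        using v by auto
      have "2 powr chi \<le> 2 powr (1 :: real)"
        using chi_bounds theta_bounds by (intro powr_mono) auto
      then have "1 \<le> 2 * 2 powr (- chi)"
        by (simp add: powr_minus field_simps)
      then have "1 / (m + \<delta>) \<le> 1 / (m + \<delta>) * (2 * 2 powr (- chi))"
        using \<delta> mult_left_mono[of 1 "2 * 2 powr (- chi)" "1 / (m + \<delta>)"] by simp
      also have "\<dots> = 2 / (m + \<delta>) * edge_weight (s, v)"
        by (simp add: edge_weight_def sv)
      also have "\<dots> \<le> C * edge_weight (s, v)"
        using nonneg by (intro mult_right_mono) (auto simp: C_def)
      finally show ?thesis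
        by (simp add: sv rate_def growth_le_2)
    next
      case True
      define y where "y = real s - 1 - 2 * theta"
      have y: "y > 0" "y \<le> real s" "y \<ge> real s * (2 - 2 * theta) / 3"
      proof -
        show "y > 0" "y \<le> real s"
          using True th theta_bounds by (auto simp: y_def)
        have "(1 + 2 * theta) * 3 \<le> (1 + 2 * theta) * real s"
          using True th by (intro mult_left_mono) auto
        then show "y \<ge> real s * (2 - 2 * theta) / 3"
          by (simp add: y_def field_simps)
      qed
      have "rate s = theta / y"
        using True by (simp add: rate_eq y_def)
      also have "\<dots> \<le> theta / (real s * (2 - 2 * theta) / 3)"
        using y th True by (intro divide_left_mono) auto
      finally have rate: "rate s \<le> c / real s"
        by (simp add: c_def mult_ac)
      have "growth s \<le> exp (theta / (2 - 2 * theta)) * (y / (2 - 2 * theta)) powr theta"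
        using growth_le[OF True] by (simp add: y_def)
      also have "\<dots> \<le> exp (theta / (2 - 2 * theta)) * (real s / (2 - 2 * theta)) powr theta"
        using y th by (intro mult_left_mono powr_mono2 divide_right_mono) auto
      also have "\<dots> = D * real s powr theta"
        using th by (simp add: D_def powr_divide)
      finally have g_s: "growth s \<le> D * real s powr theta" .
      have g_v: "growth v \<ge> real v powr theta / 3 powr theta"
        using growth_ge[OF v(1)] v by (simp add: powr_divide)
      have "growth s / growth v \<le> (D * real s powr theta) / (real v powr theta / 3 powr theta)"
        using g_s g_v v by (intro frac_le) (auto simp: D_def)
      then have "rate s * (growth s / growth v) \<le> c / real s * ((D * real s powr theta) / (real v powr theta / 3 powr theta))"
        using rate less_imp_le[OF rate_pos[of s]] th by (intro mult_mono) (auto simp: c_def)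
      also have "\<dots> = c * D * 3 powr theta * (real s powr theta / real s * real v powr (- theta))"
        using v by (simp add: powr_minus field_simps)
      also have "real s powr theta / real s = real s powr (- chi)"
        using True powr_diff[of "real s" theta 1] by (simp add: chi_eq)
      also have "c * D * 3 powr theta * (real s powr (- chi) * real v powr (- theta)) \<le> C * edge_weight (s, v)"
        unfolding edge_weight_def fst_conv snd_conv by (intro mult_right_mono) (auto simp: C_def)
      finally show ?thesis .
    qed
  qed
qed

lemma sum_in_count:
  assumes "F \<subseteq> forward_edges T"
  shows "(\<Sum>v\<in>{1..T}. in_count F v) = card F"
proof -
  have "finite F"
    using finite_subset[OF assms finite_forward_edges] .
  moreover have "snd ` F \<subseteq> {1..T}"
    using assms by (auto simp: forward_edges_def)
  ultimately show ?thesis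
    using sum.group[of F "{1..T}" snd "\<lambda>_. 1::nat"] by (simp add: in_count_def)
qed

lemma pochhammer_le_power:
  assumes "j \<le> n"
  shows "pochhammer (m + \<delta>) j \<le> real (m + n) ^ j"
proof -
  have "pochhammer (m + \<delta>) j = (\<Prod>i\<in>{0..<j}. m + \<delta> + real i)"
    by (simp add: pochhammer_prod)
  also have "\<dots> \<le> (\<Prod>i\<in>{0..<j}. real (m + n))"
    using assms \<delta> by (intro prod_mono) auto
  finally show ?thesis
    by simp
qed

text \<open>The case \<open>\<kappa> = 0\<close> of \<open>expectation_edges_le\<close>. The
  in-degrees of \<open>F\<close> sum to \<open>card F\<close>, so all Pochhammer factors together
  are at most \<open>(m + n) ^ n\<close>, uniformly in \<open>T\<close> and
  \<open>F\<close>.\<close>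

lemma prob_edges_le:
  obtains C where "C > 0" "\<And>T F. T \<ge> 2 \<Longrightarrow> F \<subseteq> forward_edges T \<Longrightarrow> card F \<le> n \<Longrightarrow>
    expect_graph T (\<lambda>G. of_bool (F \<subseteq> set_mset G)) \<le> C * (\<Prod>e\<in>F. edge_weight e)"
proof -
  obtain D where D: "D \<ge> 1" "\<And>s v. 1 \<le> v \<Longrightarrow> v < s \<Longrightarrow> rate s * (growth s / growth v) \<le> D * edge_weight (s, v)"
    using edge_factor_le by blast
  show ?thesis
  proof (rule that)
    show "real (m + n) ^ n * D ^ n > 0"
      using m_pos D(1) by simp
    fix T F assume T: "T \<ge> 2" and F: "F \<subseteq> forward_edges T" "card F \<le> n"
    have fin: "finite F"
      using finite_subset[OF F(1) finite_forward_edges] .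
    have "(\<Prod>v\<in>{1..T}. pochhammer (m + \<delta>) (in_count F v)) \<le> (\<Prod>v\<in>{1..T}. real (m + n) ^ in_count F v)"
    proof (intro prod_mono conjI pochhammer_le_power)
      fix v
      show "0 \<le> pochhammer (m + \<delta>) (in_count F v)"
        using \<delta> by (intro less_imp_le pochhammer_pos) simp
      have "in_count F v \<le> card F"
        unfolding in_count_def using fin by (intro card_mono) auto
      then show "in_count F v \<le> n"
        using F(2) by simp
    qed
    also have "\<dots> = real (m + n) ^ card F"
      unfolding power_sum[symmetric] sum_in_count[OF F(1)] ..
    also have "\<dots> \<le> real (m + n) ^ n"
      using m_pos F(2) by (intro power_increasing) auto
    finally have poch: "(\<Prod>v\<in>{1..T}. pochhammer (m + \<delta>) (in_count F v)) \<le> real (m + n) ^ n" .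
    have "(\<Prod>(s, v)\<in>F. rate s * (growth s / growth v)) \<le> (\<Prod>e\<in>F. D * edge_weight e)"
      using F(1) D(2) less_imp_le[OF rate_pos]
      by (intro prod_mono) (auto simp: forward_edges_def)
    also have "\<dots> = D ^ card F * (\<Prod>e\<in>F. edge_weight e)"
      by (simp add: prod.distrib)
    also have "\<dots> \<le> D ^ n * (\<Prod>e\<in>F. edge_weight e)"
      using D(1) F(2) by (intro mult_right_mono power_increasing prod_nonneg) (auto simp: edge_weight_def)
    finally have edges: "(\<Prod>(s, v)\<in>F. rate s * (growth s / growth v)) \<le> D ^ n * (\<Prod>e\<in>F. edge_weight e)" .
    have "expect_graph T (\<lambda>G. of_bool (F \<subseteq> set_mset G)) \<le>
        (\<Prod>v\<in>{1..T}. pochhammer (m + \<delta>) (in_count F v)) * (\<Prod>(s, v)\<in>F. rate s * (growth s / growth v))"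
      using expectation_edges_le[OF T F(1), of "\<lambda>_. 0"] by (simp add: weight_product_def)
    also have "\<dots> \<le> real (m + n) ^ n * (D ^ n * (\<Prod>e\<in>F. edge_weight e))"
      using poch edges less_imp_le[OF rate_pos]
      by (intro mult_mono prod_nonneg) (auto intro!: mult_nonneg_nonneg)
    finally show "expect_graph T (\<lambda>G. of_bool (F \<subseteq> set_mset G)) \<le>
        real (m + n) ^ n * D ^ n * (\<Prod>e\<in>F. edge_weight e)"
      by (simp add: mult.assoc)
  qed
qed

end

section \<open>Union bound over dense configurations\<close>

lemma card_targets_le:
  fixes G :: multigraph
  shows "card {v. (s, v) \<in># G} \<le> size {#e \<in># G. fst e = s#}"
proof -
  have "{v. (s, v) \<in># G} = snd ` set_mset {#e \<in># G. fst e = s#}"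
    by force
  then have "card {v. (s, v) \<in># G} \<le> card (set_mset {#e \<in># G. fst e = s#})"
    by (simp add: card_image_le)
  also have "\<dots> = size (mset_set (set_mset {#e \<in># G. fst e = s#}))"
    by simp
  also have "\<dots> \<le> size {#e \<in># G. fst e = s#}"
    by (intro size_mset_mono mset_set_set_mset_msubset)
  finally show ?thesis .
qed

lemma finite_targets: "finite {v. (s, v) \<in># (G :: multigraph)}"
  by (rule finite_subset[of _ "snd ` set_mset G"]) force+

text \<open>
  The combinatorial footprint of a nontrivial homology class in the link of the node \<open>t\<close>.
\<close>

definition dense_targets :: "nat \<Rightarrow> nat \<Rightarrow> multigraph \<Rightarrow> bool" where
  "dense_targets n t G \<longleftrightarrow> (\<exists>W. targets_hit t W G \<and> n \<le> card W \<and> (\<forall>w\<in>W. 2 \<le> card (link (adjacent G) w W)))"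

lemma expectation_of_bool_le_sum:
  assumes "finite (set_pmf p)" "\<And>x. x \<in> set_pmf p \<Longrightarrow> P x \<Longrightarrow> \<exists>i\<in>I. Q i x" "finite I"
  shows "measure_pmf.expectation p (\<lambda>x. of_bool (P x)) \<le> (\<Sum>i\<in>I. measure_pmf.expectation p (\<lambda>x. of_bool (Q i x)) :: real)"
proof -
  have "measure_pmf.expectation p (\<lambda>x. of_bool (P x)) \<le> (measure_pmf.expectation p (\<lambda>x. \<Sum>i\<in>I. of_bool (Q i x)) :: real)"
  proof (rule expectation_mono_finite[OF assms(1)])
    fix x assume x: "x \<in> set_pmf p"
    show "of_bool (P x) \<le> (\<Sum>i\<in>I. of_bool (Q i x) :: real)"
    proof (cases "P x")
      case True
      then obtain i where "i \<in> I" "Q i x"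
        using assms(2) x by blast
      then have "1 \<le> (\<Sum>i\<in>I. of_bool (Q i x) :: real)"
        using member_le_sum[of i I "\<lambda>i. of_bool (Q i x) :: real"] assms(3) by simp
      then show ?thesis
        using True by simp
    qed (simp add: sum_nonneg)
  qed
  also have "\<dots> = (\<Sum>i\<in>I. measure_pmf.expectation p (\<lambda>x. of_bool (Q i x)))"
    using assms(1) by (intro Bochner_Integration.integral_sum integrable_measure_pmf_finite)
  finally show ?thesis .
qed

text \<open>Over all subsets the products sum to the product of the \<open>f v + 1\<close>. This
  bounds the sum over configurations of every size at once.\<close>

lemma sum_prod_subsets_le:
  fixes f :: "'a \<Rightarrow> real"
  assumes "finite V" "\<W> \<subseteq> Pow V" "\<And>v. v \<in> V \<Longrightarrow> f v \<ge> 0"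
  shows "(\<Sum>W\<in>\<W>. \<Prod>w\<in>W. f w) \<le> exp (\<Sum>v\<in>V. f v)"
proof -
  have "(\<Sum>W\<in>\<W>. \<Prod>w\<in>W. f w) \<le> (\<Sum>W\<in>Pow V. \<Prod>w\<in>W. f w)"
    using assms by (intro sum_mono2) (auto intro!: prod_nonneg)
  also have "\<dots> = (\<Prod>v\<in>V. f v + 1)"
    using prod_add[OF assms(1), of f "\<lambda>_. 1"] by simp
  also have "\<dots> \<le> (\<Prod>v\<in>V. exp (f v))"
    using assms(3) by (intro prod_mono) (auto simp: add.commute)
  also have "\<dots> = exp (\<Sum>v\<in>V. f v)"
    using assms(1) by (rule exp_sum[symmetric])
  finally show ?thesis .
qed

context pref_attach
begin

lemma sum_powr_bounded: "\<exists>M>0. \<forall>T. (\<Sum>v\<in>{1..T}. real v powr (- 1 - chi)) \<le> M"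
proof -
  have s: "summable (\<lambda>v. real v powr (- 1 - chi))"
    using chi_bounds by (simp add: summable_real_powr_iff)
  have "(\<Sum>v\<in>{1..T}. real v powr (- 1 - chi)) \<le> suminf (\<lambda>v. real v powr (- 1 - chi))" for T
    by (rule sum_le_suminf[OF s]) auto
  then show ?thesis
    by (intro exI[of _ "max 1 (suminf (\<lambda>v. real v powr (- 1 - chi)))"]) (auto simp: le_max_iff_disj)
qed

text \<open>Since \<open>chi < theta\<close>, an edge contributes at most the power
  \<open>- chi\<close> at both ends, and every node of \<open>W\<close> is an end of at least two
  edges.\<close>

lemma prod_edge_weight_le:
  assumes "finite W" "0 \<notin> W" "F \<subseteq> W \<times> W"
    and deg: "\<And>w. w \<in> W \<Longrightarrow> 2 \<le> card {e \<in> F. fst e = w} + card {e \<in> F. snd e = w}"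
  shows "(\<Prod>e\<in>F. edge_weight e) \<le> (\<Prod>w\<in>W. real w powr (- 2 * chi))"
proof -
  let ?f = "\<lambda>w. real w powr (- chi)"
  have W: "real w \<ge> 1" if "w \<in> W" for w
    using assms(2) that by (cases w) auto
  have fin: "finite F"
    using finite_subset[OF assms(3)] assms(1) by simp
  have "(\<Prod>e\<in>F. edge_weight e) \<le> (\<Prod>e\<in>F. ?f (fst e) * ?f (snd e))"
  proof (intro prod_mono conjI)
    fix e assume "e \<in> F"
    then have "real (snd e) powr (- theta) \<le> ?f (snd e)"
      using W assms(3) chi_bounds by (intro powr_mono) auto
    then show "edge_weight e \<le> ?f (fst e) * ?f (snd e)"
      unfolding edge_weight_def by (intro mult_left_mono) auto
  qed (simp add: edge_weight_def)
  also have "\<dots> = (\<Prod>e\<in>F. ?f (fst e)) * (\<Prod>e\<in>F. ?f (snd e))"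
    by (rule prod.distrib)
  also have "(\<Prod>e\<in>F. ?f (fst e)) = (\<Prod>w\<in>W. (?f w) ^ card {e \<in> F. fst e = w})"
    using prod.group[OF fin assms(1), of fst "\<lambda>e. ?f (fst e)"] assms(3) by fastforce
  also have "(\<Prod>e\<in>F. ?f (snd e)) = (\<Prod>w\<in>W. (?f w) ^ card {e \<in> F. snd e = w})"
    using prod.group[OF fin assms(1), of snd "\<lambda>e. ?f (snd e)"] assms(3) by fastforce
  also have "(\<Prod>w\<in>W. (?f w) ^ card {e \<in> F. fst e = w}) * (\<Prod>w\<in>W. (?f w) ^ card {e \<in> F. snd e = w}) =
      (\<Prod>w\<in>W. (?f w) ^ (card {e \<in> F. fst e = w} + card {e \<in> F. snd e = w}))"
    by (simp add: power_add prod.distrib)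
  also have "\<dots> \<le> (\<Prod>w\<in>W. (?f w) ^ 2)"
  proof (intro prod_mono conjI power_decreasing deg)
    fix w assume "w \<in> W"
    then show "?f w \<le> 1"
      using W[of w] chi_bounds powr_mono[of "- chi" 0 "real w"] by simp
  qed auto
  also have "\<dots> = (\<Prod>w\<in>W. real w powr (- 2 * chi))"
    by (intro prod.cong refl) (simp add: power2_eq_square flip: powr_add)
  finally show ?thesis .
qed

text \<open>Union bound over the target set \<open>W\<close> and the set \<open>F\<close> of edges
  inside it. The \<open>card W \<ge> n\<close> edges of the last node supply the decay; summability
  over the old nodes keeps the number of choices of \<open>W\<close> harmless.\<close>

lemma prob_dense_targets_le:
  "\<exists>C>0. \<forall>T\<ge>2. expect_graph (Suc T) (\<lambda>G. of_bool (dense_targets n (Suc T) G)) \<le>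
    C * real (Suc T) powr (- real n * chi)"
proof -
  obtain C where C: "C > 0" "\<And>T F. T \<ge> 2 \<Longrightarrow> F \<subseteq> forward_edges T \<Longrightarrow> card F \<le> m + m * m \<Longrightarrow>
    expect_graph T (\<lambda>G. of_bool (F \<subseteq> set_mset G)) \<le> C * (\<Prod>e\<in>F. edge_weight e)"
    using prob_edges_le[of "m + m * m"] by blast
  obtain M where M: "M > 0" "\<And>T. (\<Sum>v\<in>{1..T}. real v powr (- 1 - chi)) \<le> M"
    using sum_powr_bounded by blast
  have "expect_graph (Suc T) (\<lambda>G. of_bool (dense_targets n (Suc T) G)) \<le>
    2 ^ (m * m) * C * exp M * real (Suc T) powr (- real n * chi)" if T: "T \<ge> 2" for T
  proof -
    define t where "t = Suc T"
    have t: "t \<ge> 2"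
      using T by (simp add: t_def)
    define \<W> where "\<W> = {W. W \<subseteq> {1..T} \<and> n \<le> card W \<and> card W \<le> m}"
    define \<F> where "\<F> W = {F. F \<subseteq> (W \<times> W) \<inter> forward_edges T \<and>
      (\<forall>w\<in>W. 2 \<le> card {e \<in> F. fst e = w} + card {e \<in> F. snd e = w})}" for W
    let ?E = "expect_graph t"
    have fin_W: "finite W" if "W \<in> \<W>" for W
      using that by (auto simp: \<W>_def intro: finite_subset)
    have fin_\<W>: "finite \<W>"
      by (rule finite_subset[of _ "Pow {1..T}"]) (auto simp: \<W>_def)
    have \<F>_sub: "\<F> W \<subseteq> Pow (W \<times> W)" for W
      by (auto simp: \<F>_def)
    have fin_\<F>: "finite (\<F> W)" if "W \<in> \<W>" for W
      using finite_subset[OF \<F>_sub] fin_W[OF that] by simp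
    have "?E (\<lambda>G. of_bool (dense_targets n t G) :: real) \<le>
        (\<Sum>(W, F)\<in>Sigma \<W> \<F>. ?E (\<lambda>G. of_bool (Pair t ` W \<union> F \<subseteq> set_mset G)))"
      unfolding split_def
    proof (rule expectation_of_bool_le_sum)
      show "finite (set_pmf (pa_graph t \<delta> m))"
        by (rule finite_set_pmf_graph[OF t])
      show "finite (Sigma \<W> \<F>)"
        using fin_\<W> fin_\<F> by (rule finite_SigmaI)
      fix G assume G: "G \<in> set_pmf (pa_graph t \<delta> m)" "dense_targets n t G"
      have st: "pa_stage m t 0 G"
        by (rule pa_stage_graph[OF t G(1)])
      obtain W where W: "targets_hit t W G" "n \<le> card W" "\<forall>w\<in>W. 2 \<le> card (link (adjacent G) w W)"
        using G(2) by (auto simp: dense_targets_def)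
      have WT: "W \<subseteq> {1..T}"
        using W(1) pa_stage_edge[OF st] by (force simp: targets_hit_def t_def)
      have "card W \<le> card {v. (t, v) \<in># G}"
        using W(1) by (intro card_mono finite_targets) (auto simp: targets_hit_def)
      also have "\<dots> \<le> m"
        using card_targets_le[of t G] st t by (simp add: pa_stage_def)
      finally have "W \<in> \<W>"
        using WT W(2) by (simp add: \<W>_def)
      define F where "F = {e \<in> W \<times> W. e \<in># G}"
      have fin: "finite F"
        using fin_W[OF \<open>W \<in> \<W>\<close>] by (simp add: F_def)
      have "F \<in> \<F> W"
        unfolding \<F>_def
      proof (intro CollectI conjI ballI)
        show "F \<subseteq> (W \<times> W) \<inter> forward_edges T"
          using WT pa_stage_edge[OF st] by (auto simp: F_def forward_edges_def)
        fix w assume "w \<in> W"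
        have "link (adjacent G) w W \<subseteq> snd ` {e \<in> F. fst e = w} \<union> fst ` {e \<in> F. snd e = w}"
          using \<open>w \<in> W\<close> by (force simp: link_def adjacent_def F_def)
        then have "card (link (adjacent G) w W) \<le> card (snd ` {e \<in> F. fst e = w} \<union> fst ` {e \<in> F. snd e = w})"
          using fin by (intro card_mono) auto
        also have "\<dots> \<le> card (snd ` {e \<in> F. fst e = w}) + card (fst ` {e \<in> F. snd e = w})"
          by (rule card_Un_le)
        also have "\<dots> \<le> card {e \<in> F. fst e = w} + card {e \<in> F. snd e = w}"
          using fin by (intro add_mono card_image_le) auto
        finally show "2 \<le> card {e \<in> F. fst e = w} + card {e \<in> F. snd e = w}"
          using W(3) \<open>w \<in> W\<close> by force
      qed
      moreover have "Pair t ` W \<union> F \<subseteq> set_mset G"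
        using W(1) by (auto simp: targets_hit_def F_def)
      ultimately show "\<exists>i\<in>Sigma \<W> \<F>. Pair t ` fst i \<union> snd i \<subseteq> set_mset G"
        using \<open>W \<in> \<W>\<close> by (intro bexI[of _ "(W, F)"]) auto
    qed
    also have "\<dots> = (\<Sum>W\<in>\<W>. \<Sum>F\<in>\<F> W. ?E (\<lambda>G. of_bool (Pair t ` W \<union> F \<subseteq> set_mset G)))"
      using fin_\<W> fin_\<F> by (intro sum.Sigma[symmetric]) auto
    also have "\<dots> \<le> (\<Sum>W\<in>\<W>. \<Sum>F\<in>\<F> W. C * (real t powr (- real n * chi) * (\<Prod>w\<in>W. real w powr (- 1 - chi))))"
    proof (intro sum_mono)
      fix W F assume W: "W \<in> \<W>" and F: "F \<in> \<F> W"
      have W1: "W \<subseteq> {1..T}" "n \<le> card W" "card W \<le> m"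
        using W by (auto simp: \<W>_def)
      have F1: "F \<subseteq> W \<times> W" "F \<subseteq> forward_edges T"
        using F by (auto simp: \<F>_def)
      have fin: "finite W" "finite F"
        using fin_W[OF W] finite_subset[OF F1(1)] by auto
      have sub: "Pair t ` W \<union> F \<subseteq> forward_edges t"
        using W1(1) F1(2) by (auto simp: forward_edges_def t_def)
      have "card F \<le> card W * card W"
        using card_mono[OF _ F1(1)] fin(1) by (simp add: card_cartesian_product)
      also have "\<dots> \<le> m * m"
        using W1(3) by (intro mult_mono) auto
      finally have "card (Pair t ` W \<union> F) \<le> m + m * m"
        using card_Un_le[of "Pair t ` W" F] card_image_le[OF fin(1), of "Pair t"] W1(3) by linarith
      then have "?E (\<lambda>G. of_bool (Pair t ` W \<union> F \<subseteq> set_mset G)) \<le> C * (\<Prod>e\<in>Pair t ` W \<union> F. edge_weight e)"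
        by (rule C(2)[OF t sub])
      also have "(\<Prod>e\<in>Pair t ` W \<union> F. edge_weight e) = (\<Prod>e\<in>Pair t ` W. edge_weight e) * (\<Prod>e\<in>F. edge_weight e)"
      proof (rule prod.union_disjoint)
        have "(t, w) \<notin> F" for w
          using F1(2) by (auto simp: forward_edges_def t_def)
        then show "Pair t ` W \<inter> F = {}"
          by blast
      qed (use fin in simp_all)
      also have "(\<Prod>e\<in>Pair t ` W. edge_weight e) = (\<Prod>w\<in>W. real t powr (- chi) * real w powr (- theta))"
        by (subst prod.reindex) (auto simp: inj_on_def edge_weight_def)
      also have "\<dots> = (real t powr (- chi)) ^ card W * (\<Prod>w\<in>W. real w powr (- theta))"
        by (simp add: prod.distrib)
      also have "(real t powr (- chi)) ^ card W * (\<Prod>w\<in>W. real w powr (- theta)) * (\<Prod>e\<in>F. edge_weight e) \<le>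
          real t powr (- real n * chi) * (\<Prod>w\<in>W. real w powr (- theta)) * (\<Prod>w\<in>W. real w powr (- 2 * chi))"
      proof (intro mult_mono)
        have "(real t powr (- chi)) ^ card W \<le> (real t powr (- chi)) ^ n"
          using t chi_bounds powr_mono[of "- chi" 0 "real t"] W1(2) by (intro power_decreasing) auto
        also have "\<dots> = real t powr (- real n * chi)"
          using t by (simp add: powr_power)
        finally show "(real t powr (- chi)) ^ card W \<le> real t powr (- real n * chi)" .
        show "(\<Prod>e\<in>F. edge_weight e) \<le> (\<Prod>w\<in>W. real w powr (- 2 * chi))"
          using F W1(1) by (intro prod_edge_weight_le fin F1) (auto simp: \<F>_def)
      qed (auto intro!: prod_nonneg mult_nonneg_nonneg simp: edge_weight_def)
      \<comment> \<open>\<open>- theta - 2 * chi = - 1 - chi\<close>, as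
        \<open>theta + chi = 1\<close>.\<close>
      also have "\<dots> = real t powr (- real n * chi) * (\<Prod>w\<in>W. real w powr (- 1 - chi))"
        by (simp add: chi_eq algebra_simps flip: prod.distrib powr_add)
      finally show "?E (\<lambda>G. of_bool (Pair t ` W \<union> F \<subseteq> set_mset G)) \<le>
          C * (real t powr (- real n * chi) * (\<Prod>w\<in>W. real w powr (- 1 - chi)))"
        using C(1) by simp
    qed
    also have "\<dots> = (\<Sum>W\<in>\<W>. card (\<F> W) * (C * (real t powr (- real n * chi) * (\<Prod>w\<in>W. real w powr (- 1 - chi)))))"
      by simp
    \<comment> \<open>\<open>F\<close> is a relation on at most \<open>m\<close> nodes, so the
      number of choices does not depend on \<open>T\<close>.\<close>
    also have "\<dots> \<le> (\<Sum>W\<in>\<W>. 2 ^ (m * m) * (C * (real t powr (- real n * chi) * (\<Prod>w\<in>W. real w powr (- 1 - chi)))))"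
    proof (intro sum_mono mult_right_mono)
      fix W assume W: "W \<in> \<W>"
      have "card (\<F> W) \<le> card (Pow (W \<times> W))"
        using fin_W[OF W] by (intro card_mono \<F>_sub) auto
      also have "\<dots> = 2 ^ (card W * card W)"
        using fin_W[OF W] by (simp add: card_Pow card_cartesian_product)
      also have "\<dots> \<le> 2 ^ (m * m)"
        using W by (intro power_increasing mult_mono) (auto simp: \<W>_def)
      finally show "real (card (\<F> W)) \<le> 2 ^ (m * m)"
        by (simp only: of_nat_le_iff[symmetric, where 'a = real] of_nat_power of_nat_numeral)
    qed (use C(1) in \<open>auto intro!: mult_nonneg_nonneg prod_nonneg\<close>)
    also have "\<dots> = 2 ^ (m * m) * C * real t powr (- real n * chi) * (\<Sum>W\<in>\<W>. \<Prod>w\<in>W. real w powr (- 1 - chi))"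
      by (simp add: sum_distrib_left mult_ac)
    also have "\<dots> \<le> 2 ^ (m * m) * C * real t powr (- real n * chi) * exp M"
    proof (intro mult_left_mono)
      have "(\<Sum>W\<in>\<W>. \<Prod>w\<in>W. real w powr (- 1 - chi)) \<le> exp (\<Sum>v\<in>{1..T}. real v powr (- 1 - chi))"
        by (rule sum_prod_subsets_le) (auto simp: \<W>_def)
      also have "\<dots> \<le> exp M"
        using M(2) by simp
      finally show "(\<Sum>W\<in>\<W>. \<Prod>w\<in>W. real w powr (- 1 - chi)) \<le> exp M" .
    qed (use C(1) in auto)
    finally show ?thesis
      by (simp add: t_def mult_ac)
  qed
  then show ?thesis
    using C(1) by (intro exI[of _ "2 ^ (m * m) * C * exp M"]) auto
qed

end

section \<open>Lower bounds: seeding and capping a cross-polytope\<close>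

lemma one_plus_ge_exp:
  fixes x :: real
  assumes "x \<ge> 0"
  shows "exp (x / (1 + x)) \<le> 1 + x"
proof -
  have "inverse (1 + x) = 1 - x / (1 + x)"
    using assms by (simp add: field_simps)
  also have "\<dots> \<le> exp (- (x / (1 + x)))"
    using exp_ge_add_one_self[of "- (x / (1 + x))"] by simp
  finally have "inverse (1 + x) \<le> inverse (exp (x / (1 + x)))"
    by (simp add: exp_minus)
  then show ?thesis
    using assms by (simp add: inverse_le_iff_le)
qed

text \<open>
  An initial graph in which the nodes \<open>2, \<dots>, 2 q + 1\<close> span a cross-polytope with antipodal pairs
  \<open>{2 i, 2 i + 1}\<close>, and the node \<open>2 q + 2\<close> is adjacent to all of them. The nodes \<open>2\<close> and \<open>3\<close>
  waste their edges on the node \<open>1\<close>.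
\<close>

definition seed_targets :: "nat \<Rightarrow> nat set" where
  "seed_targets s = (if s \<le> 3 then {1} else {2..2 * (s div 2) - 1})"

definition seeded :: "nat \<Rightarrow> multigraph \<Rightarrow> bool" where
  "seeded q G \<longleftrightarrow> (\<forall>s\<in>{2..2 * q + 2}. {v. (s, v) \<in># G} = seed_targets s)"

text \<open>The node \<open>t\<close> cones off the cross-polytope without filling it inside its own link.\<close>

definition caps_cross_polytope :: "nat \<Rightarrow> nat \<Rightarrow> multigraph \<Rightarrow> bool" where
  "caps_cross_polytope q t G \<longleftrightarrow> seeded q G \<and> targets_hit t {2..2 * q + 1} G \<and>
    (\<forall>w. (t, w) \<in># G \<longrightarrow> w \<notin> {2..2 * q + 1} \<longrightarrow> (\<exists>i<q. \<not> adjacent G w (2 * i + 2)))"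

lemma seeded_add_edges:
  assumes "G' \<in> set_pmf (pa_add_edges \<delta> (Suc T) k G)" "2 * q + 2 \<le> T"
  shows "seeded q G' \<longleftrightarrow> seeded q G"
proof -
  have "{v. (s, v) \<in># G'} = {v. (s, v) \<in># G}" if "s \<in> {2..2 * q + 2}" for s
    using add_edges_old_edges[OF assms(1), of s] assms(2) that by auto
  then show ?thesis
    by (simp add: seeded_def)
qed

context pref_attach
begin

text \<open>Every old node has positive probability at each draw, so any nonempty set of at most
  \<open>k\<close> old nodes can be the exact target set of \<open>k\<close> edges.\<close>

lemma exists_add_edges_with_targets:
  assumes T: "T \<ge> 2" "pa_stage m T 0 G"
    and "A \<subseteq> {1..T}" "card A \<le> k" "k > 0 \<Longrightarrow> A \<noteq> {}"
  shows "\<exists>G'\<in>set_pmf (pa_add_edges \<delta> (Suc T) k G). {v. (Suc T, v) \<in># G'} = A"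
  using assms(3-5)
proof (induction k arbitrary: A)
  case 0
  then have "A = {}"
    using finite_subset[OF 0(1)] by simp
  moreover have "{v. (Suc T, v) \<in># G} = {}"
    using pa_stage_0_edge[OF T(2), of "Suc T"] by auto
  ultimately show ?case
    by simp
next
  case (Suc k)
  have "finite A"
    using Suc.prems(1) by (rule finite_subset) simp
  obtain a where a: "a \<in> A"
    using Suc.prems(3) by auto
  \<comment> \<open>If the first \<open>k\<close> edges can already cover \<open>A\<close>, the last
    edge repeats a target; otherwise it supplies \<open>a\<close>.\<close>
  define B where "B = (if card A \<le> k then A else A - {a})"
  have "card (A - {a}) = card A - 1"
    using a \<open>finite A\<close> by simp
  have "B \<subseteq> {1..T}" "card B \<le> k" "insert a B = A"
    using Suc.prems a \<open>card (A - {a}) = card A - 1\<close> by (auto simp: B_def)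
  moreover have "B \<noteq> {}" if "k > 0"
  proof (cases "card A \<le> k")
    case False
    then have "card (A - {a}) > 0"
      using that \<open>card (A - {a}) = card A - 1\<close> by linarith
    then have "A - {a} \<noteq> {}"
      unfolding card_gt_0_iff by simp
    then show ?thesis
      using False by (simp only: B_def if_False not_False_eq_True)
  qed (use a in \<open>auto simp: B_def\<close>)
  ultimately obtain H where H: "H \<in> set_pmf (pa_add_edges \<delta> (Suc T) k G)" "{v. (Suc T, v) \<in># H} = B"
    using Suc.IH by blast
  have "a \<in> set_pmf (pa_target \<delta> (Suc T) H)"
    using a Suc.prems(1) set_pmf_target[OF T(1) pa_stage_add_edges[OF T H(1)]] by auto
  then have "add_mset (Suc T, a) H \<in> set_pmf (pa_add_edges \<delta> (Suc T) (Suc k) G)"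
    using H(1) by auto
  moreover have "{v. (Suc T, v) \<in># add_mset (Suc T, a) H} = A"
    using H(2) \<open>insert a B = A\<close> by auto
  ultimately show ?case
    by blast
qed

lemma exists_graph_with_targets:
  assumes "T \<ge> 2" "A 2 = {1}" "\<And>s. s \<in> {3..T} \<Longrightarrow> A s \<subseteq> {1..<s} \<and> A s \<noteq> {} \<and> card (A s) \<le> m"
  shows "\<exists>G\<in>set_pmf (pa_graph T \<delta> m). \<forall>s\<in>{2..T}. {v. (s, v) \<in># G} = A s"
  using assms
proof (induction T rule: dec_induct)
  case base
  have "replicate_mset m (2, 1) \<in> set_pmf (pa_graph 2 \<delta> m)"
    by (simp add: numeral_2_eq_2)
  moreover have "{v. (2, v) \<in># replicate_mset m (2 :: nat, 1 :: nat)} = {1}"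
    using m_pos by auto
  ultimately show ?case
    using base by (intro bexI[of _ "replicate_mset m (2, 1)"]) auto
next
  case (step T)
  then obtain G where G: "G \<in> set_pmf (pa_graph T \<delta> m)" "\<forall>s\<in>{2..T}. {v. (s, v) \<in># G} = A s"
    by auto
  have st: "pa_stage m T 0 G"
    by (rule pa_stage_graph[OF step.hyps(1) G(1)])
  have "A (Suc T) \<subseteq> {1..<Suc T} \<and> A (Suc T) \<noteq> {} \<and> card (A (Suc T)) \<le> m"
    using step by simp
  then obtain G' where G': "G' \<in> set_pmf (pa_add_edges \<delta> (Suc T) m G)" "{v. (Suc T, v) \<in># G'} = A (Suc T)"
    using exists_add_edges_with_targets[OF step.hyps(1) st, of "A (Suc T)" m]
    by (auto simp: atLeastLessThanSuc_atLeastAtMost)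
  have "G' \<in> set_pmf (pa_graph (Suc T) \<delta> m)"
    using step.hyps(1) G(1) G'(1) by auto
  moreover have "{v. (s, v) \<in># G'} = A s" if "s \<in> {2..Suc T}" for s
    using that G(2) G'(2) add_edges_old_edges[OF G'(1), of s] by (cases "s = Suc T") auto
  ultimately show ?case
    by blast
qed

text \<open>The largest prescribed target set, that of node \<open>2 * q + 2\<close>, has
  \<open>2 * q\<close> elements; \<open>2 * q \<le> m\<close> makes room for it.\<close>

lemma exists_seeded:
  assumes "q \<ge> 1" "2 * q \<le> m"
  shows "\<exists>G\<in>set_pmf (pa_graph (2 * q + 2) \<delta> m). seeded q G"
  unfolding seeded_def
proof (rule exists_graph_with_targets)
  fix s assume s: "s \<in> {3..2 * q + 2}"
  have "s div 2 \<le> q + 1" "2 * (s div 2) \<le> s" "s > 3 \<Longrightarrow> s div 2 \<ge> 2"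
    using s by auto
  then show "seed_targets s \<subseteq> {1..<s} \<and> seed_targets s \<noteq> {} \<and> card (seed_targets s) \<le> m"
    using s assms by (auto simp: seed_targets_def)
qed (use assms in \<open>auto simp: seed_targets_def\<close>)

text \<open>A lower bound in a form that telescopes over \<open>T\<close> without loss of a
  constant. The new node carries no demand, so it leaves the product unchanged.\<close>

lemma weight_product_growth:
  assumes T: "T \<ge> 2" "pa_stage m T 0 G" and P: "P \<subseteq> {1..T}" "card P \<le> m"
  defines "\<kappa> \<equiv> incr (\<lambda>_. 0) P"
  shows "(real (Suc T) / real T) powr (card P * theta) * weight_product T \<kappa> G \<le>
    expect_edges T m G (weight_product (Suc T) \<kappa>)"
proof -
  let ?S = "total_weight (Suc T)" and ?K = "card P"
  have S: "?S > 0"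
    by (rule total_weight_pos[OF T(1)])
  have K: "(\<Sum>v\<in>{1..T}. \<kappa> v) = ?K"
    unfolding \<kappa>_def using sum_incr[OF _ P(1), of "\<lambda>_. 0"] by simp
  define x where "x = ?K / (?S + m)"
  have x: "x \<ge> 0"
    using S by (simp add: x_def)
  \<comment> \<open>\<open>?S = (2 * m + \<delta>) * T - 2 * m\<close>, so
    \<open>card P \<le> m\<close> suffices. This turns \<open>m * (x / (1 + x))\<close> into at
    least \<open>card P * theta / T\<close>.\<close>
  have "?S + m + ?K \<le> (2 * m + \<delta>) * T"
    using P(2) by (simp add: total_weight_def algebra_simps)
  then have "m * ?K / ((2 * m + \<delta>) * T) \<le> m * ?K / (?S + m + ?K)"
    using S T(1) m_pos \<delta> by (intro divide_left_mono mult_pos_pos) auto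
  also have "\<dots> = m * (x / (1 + x))"
  proof -
    have frac: "?K / d / (1 + ?K / d) = ?K / (d + ?K)" if "d > 0" for d :: real
    proof -
      have "1 + ?K / d = (d + ?K) / d"
        using that by (simp add: add_divide_distrib)
      then show ?thesis
        using that by simp
    qed
    have "x / (1 + x) = ?K / (?S + m + ?K)"
      unfolding x_def using S by (intro frac) simp
    then show ?thesis
      by (simp only: times_divide_eq_right of_nat_mult)
  qed
  finally have rate: "?K * theta * (1 / T) \<le> m * (x / (1 + x))"
    by (simp add: theta_def mult_ac)
  have "(real (Suc T) / real T) powr (?K * theta) \<le> exp (1 / T) powr (?K * theta)"
  proof (rule powr_mono2)
    show "real (Suc T) / real T \<le> exp (1 / T)"
      using T(1) exp_ge_add_one_self[of "1 / real T"] by (simp add: field_simps)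
  qed (use theta_bounds in auto)
  also have "\<dots> = exp (?K * theta * (1 / T))"
    by (simp add: exp_powr_real)
  also have "\<dots> \<le> exp (m * (x / (1 + x)))"
    using rate by simp
  also have "\<dots> = exp (x / (1 + x)) ^ m"
    by (rule exp_of_nat_mult)
  also have "\<dots> \<le> (1 + x) ^ m"
    by (intro power_mono one_plus_ge_exp x) auto
  finally have "(real (Suc T) / real T) powr (?K * theta) * weight_product T \<kappa> G \<le> (1 + x) ^ m * weight_product T \<kappa> G"
    using less_imp_le[OF weight_product_pos[OF T]] by (rule mult_right_mono)
  also have "\<dots> \<le> expect_edges T m G (weight_product T \<kappa>)"
    using expectation_weight_product_ge[OF T order.refl, of \<kappa>] by (simp only: K x_def)
  also have "\<dots> = expect_edges T m G (weight_product (Suc T) \<kappa>)"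
  proof (rule expectation_cong)
    fix G' assume "G' \<in> set_pmf (pa_add_edges \<delta> (Suc T) m G)"
    moreover have "\<kappa> (Suc T) = 0"
      using P(1) by (auto simp: \<kappa>_def incr_def)
    ultimately show "weight_product T \<kappa> G' = weight_product (Suc T) \<kappa> G'"
      using weight_product_Suc[OF pa_stage_add_edges[OF T], of G' \<kappa>] by simp
  qed
  finally show ?thesis .
qed

text \<open>Being seeded is decided at time \<open>2 * q + 2\<close>, where it has positive
  probability; from then on the factors of \<open>weight_product_growth\<close> telescope.\<close>

lemma expectation_seeded_weight_ge:
  assumes q: "q \<ge> 1" "2 * q \<le> m"
  defines "\<kappa> \<equiv> incr (\<lambda>_. 0) {2..2 * q + 1}"
  shows "\<exists>c>0. \<forall>T\<ge>2 * q + 2. c * real T powr (2 * real q * theta) \<le>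
    expect_graph T (\<lambda>G. of_bool (seeded q G) * weight_product T \<kappa> G)"
proof -
  define n where "n = 2 * q + 2"
  have n: "n \<ge> 2"
    by (simp add: n_def)
  define L where "L T = expect_graph T (\<lambda>G. of_bool (seeded q G) * weight_product T \<kappa> G)" for T
  obtain H where H: "H \<in> set_pmf (pa_graph n \<delta> m)" "seeded q H"
    using exists_seeded[OF q] by (auto simp: n_def)
  have "0 < weight_product n \<kappa> H * pmf (pa_graph n \<delta> m) H"
    using H(1) weight_product_pos[OF n pa_stage_graph[OF n H(1)]] by (simp add: pmf_positive)
  also have "\<dots> \<le> (\<Sum>G\<in>set_pmf (pa_graph n \<delta> m). of_bool (seeded q G) * weight_product n \<kappa> G * pmf (pa_graph n \<delta> m) G)"
    using member_le_sum[OF H(1), of "\<lambda>G. of_bool (seeded q G) * weight_product n \<kappa> G * pmf (pa_graph n \<delta> m) G"]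
      less_imp_le[OF weight_product_pos[OF n pa_stage_graph[OF n]]] finite_set_pmf_graph[OF n] H(2)
    by simp
  also have "\<dots> = L n"
    unfolding L_def by (rule integral_measure_pmf_real[symmetric, OF finite_set_pmf_graph[OF n]])
  finally have L_pos: "L n > 0" .
  have card: "card {2..2 * q + 1} = 2 * q"
    by simp
  define c where "c = L n / real n powr (2 * real q * theta)"
  have main: "c * real T powr (2 * real q * theta) \<le> L T" if "T \<ge> n" for T
    using that
  proof (induction T rule: dec_induct)
    case base
    then show ?case
      using n by (simp add: c_def)
  next
    case (step T)
    have T: "T \<ge> 2"
      using step.hyps(1) n by simp
    let ?r = "(real (Suc T) / real T) powr (2 * real q * theta)"
    have "c * real (Suc T) powr (2 * real q * theta) = ?r * (c * real T powr (2 * real q * theta))"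
      using T by (simp add: powr_divide)
    also have "\<dots> \<le> ?r * L T"
      using step.IH by (rule mult_left_mono) simp
    also have "\<dots> = expect_graph T (\<lambda>G. ?r * (of_bool (seeded q G) * weight_product T \<kappa> G))"
      unfolding L_def by simp
    also have "\<dots> \<le> expect_graph T (\<lambda>G. expect_edges T m G
        (\<lambda>G'. of_bool (seeded q G') * weight_product (Suc T) \<kappa> G'))"
    proof (rule expectation_mono_finite[OF finite_set_pmf_graph[OF T]])
      fix G assume "G \<in> set_pmf (pa_graph T \<delta> m)"
      then have G: "pa_stage m T 0 G"
        by (rule pa_stage_graph[OF T])
      have sub: "{2..2 * q + 1} \<subseteq> {1..T}"
        using step.hyps(1) by (auto simp: n_def)
      have "?r * (of_bool (seeded q G) * weight_product T \<kappa> G) = of_bool (seeded q G) * (?r * weight_product T \<kappa> G)"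
        by simp
      also have "\<dots> \<le> of_bool (seeded q G) * expect_edges T m G (weight_product (Suc T) \<kappa>)"
        using weight_product_growth[OF T G sub] q(2) unfolding \<kappa>_def card by (intro mult_left_mono) auto
      also have "\<dots> = expect_edges T m G (\<lambda>G'. of_bool (seeded q G) * weight_product (Suc T) \<kappa> G')"
        by simp
      also have "\<dots> = expect_edges T m G (\<lambda>G'. of_bool (seeded q G') * weight_product (Suc T) \<kappa> G')"
        using step.hyps(1) by (intro expectation_cong) (simp add: seeded_add_edges n_def)
      finally show "?r * (of_bool (seeded q G) * weight_product T \<kappa> G) \<le>
          expect_edges T m G (\<lambda>G'. of_bool (seeded q G') * weight_product (Suc T) \<kappa> G')" .
    qed
    also have "\<dots> = L (Suc T)"
      unfolding L_def by (rule expectation_graph_Suc[OF T, symmetric])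
    finally show ?case .
  qed
  have "c > 0"
    using L_pos n by (simp add: c_def)
  then show ?thesis
    using main unfolding L_def n_def by (intro exI[of _ c] conjI allI impI)
qed

text \<open>The \<open>2 * q\<close> hits cost at most a factor \<open>2 * m * T\<close> each, while
  the weights involved have a joint expectation of order at least
  \<open>T powr (2 * q * theta)\<close>; the quotient has exponent
  \<open>- 2 * q * chi\<close>.\<close>

lemma prob_seeded_targets_hit_ge:
  assumes q: "q \<ge> 1" "2 * q \<le> m"
  shows "\<exists>c>0. \<forall>T\<ge>2 * q + 2. c * real (Suc T) powr (- 2 * real q * chi) \<le>
    expect_graph (Suc T)
      (\<lambda>G. of_bool (seeded q G \<and> targets_hit (Suc T) {2..2 * q + 1} G))"
proof -
  define P where "P = {2..2 * q + 1}"
  define \<kappa> where "\<kappa> = incr (\<lambda>_. 0) P"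
  have card: "card P = 2 * q"
    by (simp add: P_def)
  obtain c where "c > 0 \<and> (\<forall>T\<ge>2 * q + 2. c * real T powr (2 * real q * theta) \<le>
    expect_graph T (\<lambda>G. of_bool (seeded q G) * weight_product T \<kappa> G))"
    using expectation_seeded_weight_ge[OF q] unfolding \<kappa>_def P_def by (rule exE)
  note c = conjunct1[OF this] conjunct2[OF this, rule_format]
  define D where "D = (2 * real m) ^ (2 * q)"
  have D: "D > 0"
    using m_pos by (simp add: D_def)
  have "c / D * real (Suc T) powr (- 2 * real q * chi) \<le>
    expect_graph (Suc T)
      (\<lambda>G. of_bool (seeded q G \<and> targets_hit (Suc T) P G))" if Tq: "T \<ge> 2 * q + 2" for T
  proof -
    have T: "T \<ge> 2"
      using Tq by simp
    let ?S = "total_weight (Suc T)"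
    have S: "?S > 0"
      by (rule total_weight_pos[OF T])
    have sub: "P \<subseteq> {1..T}"
      using Tq by (auto simp: P_def)
    have "real (Suc T) powr (- 2 * real q * chi) \<le> real T powr (- 2 * real q * chi)"
      using T chi_bounds by (intro powr_mono2') auto
    then have "c / D * real (Suc T) powr (- 2 * real q * chi) \<le> c / D * real T powr (- 2 * real q * chi)"
      using c(1) D by (intro mult_left_mono) auto
    also have "\<dots> = (c * real T powr (2 * real q * theta)) / (D * real T ^ (2 * q))"
    proof -
      have "real T powr (- 2 * real q * chi) = real T powr (2 * real q * theta) / real T powr real (2 * q)"
        by (simp add: chi_eq algebra_simps flip: powr_diff)
      also have "real T powr real (2 * q) = real T ^ (2 * q)"
        using T by (intro powr_realpow) simp
      finally show ?thesis
        by simp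
    qed
    also have "D * real T ^ (2 * q) = (2 * real m * real T) ^ (2 * q)"
      by (simp add: D_def power_mult_distrib)
    also have "(c * real T powr (2 * real q * theta)) / (2 * real m * real T) ^ (2 * q) \<le>
        (c * real T powr (2 * real q * theta)) / (?S + m) ^ (2 * q)"
    proof (intro divide_left_mono power_mono mult_pos_pos zero_less_power)
      have "\<delta> * real T \<le> 0"
        using \<delta>(2) by (simp add: mult_nonpos_nonneg)
      then show "?S + m \<le> 2 * real m * real T"
        by (simp add: total_weight_def algebra_simps)
    qed (use S c(1) T m_pos in auto)
    also have "\<dots> \<le> expect_graph T (\<lambda>G. of_bool (seeded q G) * weight_product T \<kappa> G) / (?S + m) ^ (2 * q)"
      using c(2)[OF Tq] S by (intro divide_right_mono) auto
    also have "\<dots> = expect_graph T (\<lambda>G. of_bool (seeded q G) * weight_product T \<kappa> G / (?S + m) ^ (2 * q))"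
      by simp
    also have "\<dots> \<le> expect_graph T (\<lambda>G. expect_edges T m G
        (\<lambda>G'. of_bool (seeded q G' \<and> targets_hit (Suc T) P G')))"
    proof (rule expectation_mono_finite[OF finite_set_pmf_graph[OF T]])
      fix G assume "G \<in> set_pmf (pa_graph T \<delta> m)"
      then have G: "pa_stage m T 0 G"
        by (rule pa_stage_graph[OF T])
      have "of_bool (seeded q G) * weight_product T \<kappa> G / (?S + m) ^ (2 * q) =
          of_bool (seeded q G) * (weight_product T \<kappa> G / (?S + m) ^ card P)"
        by (simp add: card)
      also have "\<dots> \<le> of_bool (seeded q G) * expect_edges T m G
          (\<lambda>G'. of_bool (targets_hit (Suc T) P G') * weight_product T (\<lambda>_. 0) G')"
        unfolding \<kappa>_def using q(2) card
        by (intro mult_left_mono expectation_targets_hit_ge[OF T G sub]) auto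
      also have "\<dots> = expect_edges T m G
          (\<lambda>G'. of_bool (seeded q G) * of_bool (targets_hit (Suc T) P G'))"
        by (simp add: weight_product_def)
      also have "\<dots> = expect_edges T m G
          (\<lambda>G'. of_bool (seeded q G' \<and> targets_hit (Suc T) P G'))"
        using Tq by (intro expectation_cong) (simp add: seeded_add_edges of_bool_conj)
      finally show "of_bool (seeded q G) * weight_product T \<kappa> G / (?S + m) ^ (2 * q) \<le>
          expect_edges T m G
            (\<lambda>G'. of_bool (seeded q G' \<and> targets_hit (Suc T) P G'))" .
    qed
    also have "\<dots> = expect_graph (Suc T)
        (\<lambda>G. of_bool (seeded q G \<and> targets_hit (Suc T) P G))"
      by (rule expectation_graph_Suc[OF T, symmetric])
    finally show ?thesis .
  qed
  then show ?thesis
    using c(1) D unfolding P_def by (intro exI[of _ "c / D"]) auto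
qed

text \<open>
  If the link of \<open>t\<close> contains a further node that is adjacent to \<open>2\<close> and \<open>4\<close>, then \<open>t\<close> has
  \<open>2 q + 1\<close> prescribed neighbours, which is rarer by a factor \<open>t powr - chi\<close>.
\<close>

lemma prob_extra_coface_le:
  "\<exists>C>0. \<forall>T\<ge>2 * q + 2. (\<Sum>w\<in>{2 * q + 2..T}. expect_graph (Suc T)
      (\<lambda>G. of_bool (Pair (Suc T) ` insert w {2..2 * q + 1} \<union> {(w, 2), (w, 4)} \<subseteq> set_mset G))) \<le>
    C * real (Suc T) powr (- (2 * real q + 1) * chi)"
  if "q \<ge> 2"
proof -
  obtain C where C: "C > 0" "\<And>T F. T \<ge> 2 \<Longrightarrow> F \<subseteq> forward_edges T \<Longrightarrow> card F \<le> 2 * q + 3 \<Longrightarrow>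
    expect_graph T (\<lambda>G. of_bool (F \<subseteq> set_mset G)) \<le> C * (\<Prod>e\<in>F. edge_weight e)"
    using prob_edges_le[of "2 * q + 3"] by blast
  obtain M where M: "M > 0" "\<And>T. (\<Sum>v\<in>{1..T}. real v powr (- 1 - chi)) \<le> M"
    using sum_powr_bounded by blast
  have "(\<Sum>w\<in>{2 * q + 2..T}. expect_graph (Suc T)
      (\<lambda>G. of_bool (Pair (Suc T) ` insert w {2..2 * q + 1} \<union> {(w, 2), (w, 4)} \<subseteq> set_mset G))) \<le>
    C * M * real (Suc T) powr (- (2 * real q + 1) * chi)" if T: "T \<ge> 2 * q + 2" for T
  proof -
    define t where "t = Suc T"
    have "(\<Sum>w\<in>{2 * q + 2..T}. expect_graph t
        (\<lambda>G. of_bool (Pair t ` insert w {2..2 * q + 1} \<union> {(w, 2), (w, 4)} \<subseteq> set_mset G))) \<le>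
      (\<Sum>w\<in>{2 * q + 2..T}. C * (real t powr (- (2 * real q + 1) * chi) * real w powr (- 1 - chi)))"
    proof (rule sum_mono)
      fix w assume w: "w \<in> {2 * q + 2..T}"
      let ?P = "insert w {2..2 * q + 1}"
      have card: "card ?P = 2 * q + 1"
        using w by simp
      have "Pair t ` ?P \<union> {(w, 2), (w, 4)} \<subseteq> forward_edges t"
        using w T \<open>q \<ge> 2\<close> by (auto simp: forward_edges_def t_def)
      moreover have "card (Pair t ` ?P \<union> {(w, 2), (w, 4)}) \<le> 2 * q + 3"
        using card_Un_le[of "Pair t ` ?P" "{(w, 2), (w, 4)}"] card_image_le[of ?P "Pair t"] card by simp
      ultimately have "expect_graph t
          (\<lambda>G. of_bool (Pair t ` ?P \<union> {(w, 2), (w, 4)} \<subseteq> set_mset G)) \<le>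
          C * (\<Prod>e\<in>Pair t ` ?P \<union> {(w, 2), (w, 4)}. edge_weight e)"
        using T by (intro C(2)) (auto simp: t_def)
      also have "(\<Prod>e\<in>Pair t ` ?P \<union> {(w, 2), (w, 4)}. edge_weight e) =
          (\<Prod>e\<in>Pair t ` ?P. edge_weight e) * (\<Prod>e\<in>{(w, 2), (w, 4)}. edge_weight e)"
        using w by (intro prod.union_disjoint) (auto simp: t_def)
      also have "(\<Prod>e\<in>Pair t ` ?P. edge_weight e) = (\<Prod>p\<in>?P. real t powr (- chi) * real p powr (- theta))"
        by (subst prod.reindex) (auto simp: inj_on_def edge_weight_def)
      also have "\<dots> = (real t powr (- chi)) ^ (2 * q + 1) * (\<Prod>p\<in>?P. real p powr (- theta))"
        by (simp only: prod.distrib prod_constant card)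
      also have "(\<Prod>p\<in>?P. real p powr (- theta)) = real w powr (- theta) * (\<Prod>p\<in>{2..2 * q + 1}. real p powr (- theta))"
        using w by (intro prod.insert) auto
      \<comment> \<open>The factors at the fixed nodes are at most \<open>1\<close>. For
        \<open>w\<close>, the edge from \<open>t\<close> gives \<open>- theta\<close> and the edges
        to \<open>2\<close> and \<open>4\<close> give \<open>- chi\<close> each, so the sum over
        \<open>w\<close> is bounded.\<close>
      also have "(real t powr (- chi)) ^ (2 * q + 1) * (real w powr (- theta) * (\<Prod>p\<in>{2..2 * q + 1}. real p powr (- theta))) *
          (\<Prod>e\<in>{(w, 2), (w, 4)}. edge_weight e) \<le>
          (real t powr (- chi)) ^ (2 * q + 1) * (real w powr (- theta) * 1) * (real w powr (- chi) * real w powr (- chi))"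
      proof (intro mult_mono order.refl)
        have le_1: "real p powr (- theta) \<le> 1" if "p \<ge> 1" for p :: nat
          using that theta_bounds powr_mono[of "- theta" 0 "real p"] by simp
        then show "(\<Prod>p\<in>{2..2 * q + 1}. real p powr (- theta)) \<le> 1"
          by (intro prod_le_1) auto
        have "(\<Prod>e\<in>{(w, 2), (w, 4)}. edge_weight e) =
            (real w powr (- chi) * real 2 powr (- theta)) * (real w powr (- chi) * real 4 powr (- theta))"
          by (simp add: edge_weight_def)
        also have "\<dots> \<le> (real w powr (- chi) * 1) * (real w powr (- chi) * 1)"
          using le_1[of 2] le_1[of 4] by (intro mult_mono) auto
        finally show "(\<Prod>e\<in>{(w, 2), (w, 4)}. edge_weight e) \<le> real w powr (- chi) * real w powr (- chi)"
          by simp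
      qed (auto intro!: mult_nonneg_nonneg prod_nonneg simp: edge_weight_def)
      also have "(real t powr (- chi)) ^ (2 * q + 1) = real t powr (- (2 * real q + 1) * chi)"
        by (subst powr_realpow[symmetric]) (auto simp: t_def powr_powr algebra_simps)
      also have "real t powr (- (2 * real q + 1) * chi) * (real w powr (- theta) * 1) * (real w powr (- chi) * real w powr (- chi)) =
          real t powr (- (2 * real q + 1) * chi) * real w powr (- 1 - chi)"
        by (simp add: chi_eq mult.assoc algebra_simps flip: powr_add)
      finally show "expect_graph t
          (\<lambda>G. of_bool (Pair t ` ?P \<union> {(w, 2), (w, 4)} \<subseteq> set_mset G)) \<le>
          C * (real t powr (- (2 * real q + 1) * chi) * real w powr (- 1 - chi))"
        using C(1) by simp
    qed
    also have "\<dots> = C * real t powr (- (2 * real q + 1) * chi) * (\<Sum>w\<in>{2 * q + 2..T}. real w powr (- 1 - chi))"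
      by (simp add: sum_distrib_left mult_ac)
    also have "\<dots> \<le> C * real t powr (- (2 * real q + 1) * chi) * M"
    proof (rule mult_left_mono)
      have "(\<Sum>w\<in>{2 * q + 2..T}. real w powr (- 1 - chi)) \<le> (\<Sum>w\<in>{1..T}. real w powr (- 1 - chi))"
        by (intro sum_mono2) auto
      then show "(\<Sum>w\<in>{2 * q + 2..T}. real w powr (- 1 - chi)) \<le> M"
        using M(2)[of T] by linarith
    qed (use C(1) in simp)
    finally show ?thesis
      by (simp add: t_def mult_ac)
  qed
  then show ?thesis
    using C(1) M(1) by (intro exI[of _ "C * M"]) auto
qed

text \<open>If the seeded cross-polytope is hit but not capped, some other neighbour of the new node
  is adjacent to \<open>2\<close> and \<open>4\<close>. That event is rarer by a factor
  \<open>T powr (- chi)\<close> and eventually costs at most half of the main term.\<close>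

lemma prob_caps_cross_polytope_ge:
  assumes q: "q \<ge> 2" "2 * q \<le> m"
  shows "\<exists>c>0. \<forall>\<^sub>F T in sequentially. c * real (Suc T) powr (- 2 * real q * chi) \<le>
    expect_graph (Suc T) (\<lambda>G. of_bool (caps_cross_polytope q (Suc T) G))"
proof -
  let ?P = "{2..2 * q + 1}"
  have "q \<ge> 1"
    using q(1) by simp
  obtain c where "c > 0 \<and> (\<forall>T\<ge>2 * q + 2. c * real (Suc T) powr (- 2 * real q * chi) \<le>
    expect_graph (Suc T) (\<lambda>G. of_bool (seeded q G \<and> targets_hit (Suc T) ?P G)))"
    using prob_seeded_targets_hit_ge[OF \<open>q \<ge> 1\<close> q(2)] by (rule exE)
  note c = conjunct1[OF this] conjunct2[OF this, rule_format]
  define B where "B T = (\<Sum>w\<in>{2 * q + 2..T}. expect_graph (Suc T)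
      (\<lambda>G. of_bool (Pair (Suc T) ` insert w ?P \<union> {(w, 2), (w, 4)} \<subseteq> set_mset G)) :: real)" for T
  obtain C where "C > 0 \<and> (\<forall>T\<ge>2 * q + 2. B T \<le> C * real (Suc T) powr (- (2 * real q + 1) * chi))"
    using prob_extra_coface_le[OF q(1)] unfolding B_def[symmetric] by (rule exE)
  note C = conjunct1[OF this] conjunct2[OF this, rule_format]
  have split: "expect_graph (Suc T) (\<lambda>G. of_bool (seeded q G \<and> targets_hit (Suc T) ?P G)) \<le>
      expect_graph (Suc T) (\<lambda>G. of_bool (caps_cross_polytope q (Suc T) G)) + B T"
    if T: "T \<ge> 2 * q + 2" for T
  proof -
    define t where "t = Suc T"
    have t: "t \<ge> 2"
      using T by (simp add: t_def)
    let ?E = "expect_graph t"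
    \<comment> \<open>\<open>None\<close> stands for success, \<open>Some w\<close> for failure
      caused by \<open>w\<close>.\<close>
    define R where "R o' G \<longleftrightarrow> (case o' of None \<Rightarrow> caps_cross_polytope q t G
      | Some w \<Rightarrow> Pair t ` insert w ?P \<union> {(w, 2), (w, 4)} \<subseteq> set_mset G)" for o' G
    have "?E (\<lambda>G. of_bool (seeded q G \<and> targets_hit t ?P G)) \<le>
        (\<Sum>o'\<in>insert None (Some ` {2 * q + 2..T}). ?E (\<lambda>G. of_bool (R o' G)) :: real)"
    proof (rule expectation_of_bool_le_sum[OF finite_set_pmf_graph[OF t]])
      fix G assume G: "G \<in> set_pmf (pa_graph t \<delta> m)" "seeded q G \<and> targets_hit t ?P G"
      have st: "pa_stage m t 0 G"
        by (rule pa_stage_graph[OF t G(1)])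
      show "\<exists>o'\<in>insert None (Some ` {2 * q + 2..T}). R o' G"
      proof (cases "caps_cross_polytope q t G")
        case True
        then show ?thesis
          by (auto simp: R_def)
      next
        case False
        then obtain w where w: "(t, w) \<in># G" "w \<notin> ?P" "\<And>i. i < q \<Longrightarrow> adjacent G w (2 * i + 2)"
          using G(2) by (auto simp: caps_cross_polytope_def)
        \<comment> \<open>\<open>q \<ge> 2\<close> provides both nodes; two edges at
          \<open>w\<close> are what makes its exponent summable.\<close>
        have adj: "adjacent G w 2" "adjacent G w 4"
          using w(3)[of 0] w(3)[of 1] q(1) by (auto simp: eval_nat_numeral)
        have "1 \<le> w" "w < t"
          using pa_stage_edge[OF st w(1)] by auto
        \<comment> \<open>In a seeded graph node \<open>4\<close> sends its edges to
          \<open>2\<close> and \<open>3\<close> only, so it is not adjacent to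
          \<open>1\<close>.\<close>
        have "w \<noteq> 1"
        proof
          assume "w = 1"
          then have "(4, 1) \<in># G"
            using adj(2) pa_stage_edge[OF st, of 1 4] by (auto simp: adjacent_def)
          moreover have "{v. (4, v) \<in># G} = seed_targets 4"
            using G(2) q(1) by (simp add: seeded_def)
          ultimately have "1 \<in> seed_targets 4"
            by blast
          then show False
            by (simp add: seed_targets_def)
        qed
        then have w_ge: "w \<ge> 2 * q + 2"
          using w(2) \<open>1 \<le> w\<close> by auto
        have "(w, 2) \<in># G" "(w, 4) \<in># G"
          using adj pa_stage_edge[OF st, of 2 w] pa_stage_edge[OF st, of 4 w] w_ge q(1)
          by (auto simp: adjacent_def)
        then have "R (Some w) G"
          using G(2) w(1) by (auto simp: R_def targets_hit_def)
        then show ?thesis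
          using w_ge \<open>w < t\<close> by (intro bexI[of _ "Some w"]) (auto simp: t_def)
      qed
    qed simp
    also have "\<dots> = ?E (\<lambda>G. of_bool (R None G)) + (\<Sum>w\<in>{2 * q + 2..T}. ?E (\<lambda>G. of_bool (R (Some w) G)))"
      by (subst sum.insert) (auto simp: sum.reindex)
    finally show ?thesis
      by (simp add: R_def B_def t_def)
  qed
  have "eventually (\<lambda>T. C * real (Suc T) powr (- chi) \<le> c / 2) sequentially"
  proof -
    have "((\<lambda>T. C * real (Suc T) powr (- chi)) \<longlongrightarrow> C * 0) sequentially"
      using chi_bounds
      by (intro tendsto_intros tendsto_neg_powr filterlim_compose[OF filterlim_real_sequentially filterlim_Suc]) auto
    then have "eventually (\<lambda>T. C * real (Suc T) powr (- chi) < c / 2) sequentially"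
      using c(1) by (intro order_tendstoD(2)) auto
    then show ?thesis
      by (rule eventually_mono) simp
  qed
  then have "\<forall>\<^sub>F T in sequentially. c / 2 * real (Suc T) powr (- 2 * real q * chi) \<le>
    expect_graph (Suc T) (\<lambda>G. of_bool (caps_cross_polytope q (Suc T) G))"
    using eventually_ge_at_top[of "2 * q + 2"]
  proof eventually_elim
    case (elim T)
    let ?p = "real (Suc T) powr (- 2 * real q * chi)"
    have "B T \<le> C * real (Suc T) powr (- (2 * real q + 1) * chi)"
      by (rule C(2)[OF elim(2)])
    also have "\<dots> = C * real (Suc T) powr (- chi) * ?p"
      by (simp add: algebra_simps flip: powr_add)
    also have "\<dots> \<le> c / 2 * ?p"
      using elim(1) by (intro mult_right_mono) auto
    finally show ?case
      using c(2)[OF elim(2)] split[OF elim(2)] by simp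
  qed
  then show ?thesis
    using c(1) by (intro exI[of _ "c / 2"]) auto
qed

end


section \<open>Expected Betti numbers\<close>

lemma adjacent_sym: "adjacent G u v \<Longrightarrow> adjacent G v u"
  by (auto simp: adjacent_def)

lemma flag_adjacent: "finite U \<Longrightarrow> flag (adjacent G) U"
  by standard (auto intro: adjacent_sym)

text \<open>The ambient \<open>{1..N}\<close> may exceed the vertex set, so the complexes at times
  \<open>T\<close> and \<open>Suc T\<close> can be compared under one boundary operator.\<close>

lemma betti_pa_complex:
  assumes "T \<le> N" "q > 0"
  shows "betti q (pa_complex T G) = flag.betti_number (adjacent G) {1..N} {1..T} (Suc q)"
proof -
  interpret flag "adjacent G" "{1..N}"
    by (rule flag_adjacent) simp
  show ?thesis
    unfolding pa_complex_def using assms by (intro betti_clique_complex) auto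
qed

lemma link_last_node:
  assumes "pa_stage m (Suc T) 0 G"
  shows "link (adjacent G) (Suc T) {1..T} = {v. (Suc T, v) \<in># G}"
  using pa_stage_edge[OF assms] pa_stage_0_edge[OF assms] by (fastforce simp: link_def adjacent_def)

text \<open>\<open>n \<ge> 2\<close> ensures that the \<open>2 * (n - 1)\<close> neighbours inside
  \<open>W\<close> are at least the two demanded by \<open>dense_targets\<close>.\<close>

lemma not_acyclic_link_imp_dense_targets:
  assumes "pa_stage m (Suc T) 0 G" "n \<ge> 2"
    and "\<not> flag.acyclic_at (adjacent G) {1..Suc T} (link (adjacent G) (Suc T) {1..T}) n"
  shows "dense_targets (2 * n) (Suc T) G"
proof -
  interpret flag "adjacent G" "{1..Suc T}"
    by (rule flag_adjacent) simp
  have "link (adjacent G) (Suc T) {1..T} \<subseteq> {1..Suc T}"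
    by (auto simp: link_def)
  then obtain W where W: "W \<subseteq> link (adjacent G) (Suc T) {1..T}" "2 * n \<le> card W"
    "\<forall>w\<in>W. 2 * (n - 1) \<le> card (link (adjacent G) w W)"
    using not_acyclic_at_imp_dense_subset[OF _ assms(3)] by blast
  moreover have "2 \<le> 2 * (n - 1)"
    using assms(2) by simp
  ultimately show ?thesis
    unfolding dense_targets_def link_last_node[OF assms(1)] targets_hit_def
    by (intro exI[of _ W]) force
qed

lemma card_link_last_node:
  assumes "pa_stage m (Suc T) 0 G" "T \<ge> 1"
  shows "card (link (adjacent G) (Suc T) {1..T}) \<le> m"
  using card_targets_le[of "Suc T" G] assms unfolding link_last_node[OF assms(1)]
  by (simp add: pa_stage_def)

text \<open>Both complexes are read off the graph at time \<open>Suc T\<close>; the earlier one is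
  its restriction to \<open>{1..T}\<close>.\<close>

lemma betti_step_le:
  assumes st: "pa_stage m (Suc T) 0 G" and "T \<ge> 1" "q \<ge> 2"
  shows "betti q (pa_complex (Suc T) G) \<le>
    betti q (pa_complex T G) + 2 ^ m * of_bool (dense_targets (2 * q) (Suc T) G)"
proof -
  interpret flag "adjacent G" "{1..Suc T}"
    by (rule flag_adjacent) simp
  let ?L = "link (adjacent G) (Suc T) {1..T}"
  have "q > 0" and eq: "{1..Suc T} = insert (Suc T) {1..T}"
    using \<open>q \<ge> 2\<close> by auto
  have betti_eqs: "betti q (pa_complex T G) = betti_number {1..T} (Suc q)"
    "betti q (pa_complex (Suc T) G) = betti_number (insert (Suc T) {1..T}) (Suc q)"
    using betti_pa_complex[of T "Suc T", OF _ \<open>q > 0\<close>]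
    by (simp, subst eq[symmetric], intro betti_pa_complex \<open>q > 0\<close> order.refl)
  have "betti_number (insert (Suc T) {1..T}) (Suc q) \<le>
      betti_number {1..T} (Suc q) + (if acyclic_at ?L q then 0 else 2 ^ card ?L)"
    by (intro betti_number_insert_le) auto
  also have "(if acyclic_at ?L q then 0 else 2 ^ card ?L) \<le> (2 ^ m * of_bool (dense_targets (2 * q) (Suc T) G) :: nat)"
  proof (cases "acyclic_at ?L q")
    case False
    then have "dense_targets (2 * q) (Suc T) G"
      using not_acyclic_link_imp_dense_targets[OF st \<open>q \<ge> 2\<close>] by blast
    then show ?thesis
      using False card_link_last_node[OF st \<open>T \<ge> 1\<close>] by (simp add: power_increasing)
  qed simp
  finally show ?thesis
    unfolding betti_eqs by simp
qed

lemma cross_vertices_seed: "cross_vertices (\<lambda>i. 2 * i + 2) (\<lambda>i. 2 * i + 3) j = {2..2 * j + 1}"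
proof (induction j)
  case (Suc j)
  have "cross_vertices (\<lambda>i. 2 * i + 2) (\<lambda>i. 2 * i + 3) (Suc j) =
      {2 * j + 2, 2 * j + 3} \<union> cross_vertices (\<lambda>i. 2 * i + 2) (\<lambda>i. 2 * i + 3) j"
    by (auto simp: cross_vertices_def lessThan_Suc)
  then show ?case
    using Suc by auto
qed (simp add: cross_vertices_def)

lemma cross_polytope_seeded:
  assumes st: "pa_stage m (Suc T) 0 G" and "seeded q G" "2 * q + 2 \<le> T"
  shows "cross_polytope (adjacent G) {1..Suc T} (\<lambda>i. 2 * i + 2) (\<lambda>i. 2 * i + 3) q"
proof -
  have targets: "(s, v) \<in># G \<longleftrightarrow> v \<in> seed_targets s" if "s \<in> {2..2 * q + 2}" for s v
    using assms(2) that by (auto simp: seeded_def)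
  have seed: "seed_targets (2 * i + 2) = (if i = 0 then {1} else {2..2 * i + 1})"
    "seed_targets (2 * i + 3) = (if i = 0 then {1} else {2..2 * i + 1})" for i
  proof -
    have "(2 * i + 3) div 2 = i + 1"
      by simp
    then show "seed_targets (2 * i + 2) = (if i = 0 then {1} else {2..2 * i + 1})"
      "seed_targets (2 * i + 3) = (if i = 0 then {1} else {2..2 * i + 1})"
      by (auto simp: seed_targets_def)
  qed
  show ?thesis
  proof (intro cross_polytope.intro cross_polytope_axioms.intro flag_adjacent)
    fix i assume i: "i < q"
    show "adjacent G (2 * i + 2) v" if "v \<in> cross_vertices (\<lambda>i. 2 * i + 2) (\<lambda>i. 2 * i + 3) i" for v
    proof -
      have "(2 * i + 2, v) \<in># G" "v < 2 * i + 2"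
        using that i targets[of "2 * i + 2" v] unfolding cross_vertices_seed seed
        by (cases "i = 0"; simp)+
      then show ?thesis
        by (simp add: adjacent_def)
    qed
    show "adjacent G (2 * i + 3) v" if "v \<in> cross_vertices (\<lambda>i. 2 * i + 2) (\<lambda>i. 2 * i + 3) i" for v
    proof -
      have "(2 * i + 3, v) \<in># G" "v < 2 * i + 3"
        using that i targets[of "2 * i + 3" v] unfolding cross_vertices_seed seed
        by (cases "i = 0"; simp)+
      then show ?thesis
        by (simp add: adjacent_def)
    qed
    have "(2 * i + 3, 2 * i + 2) \<notin># G"
      using i targets[of "2 * i + 3" "2 * i + 2"] unfolding seed by (cases "i = 0") auto
    moreover have "(2 * i + 2, 2 * i + 3) \<notin># G"
      using pa_stage_edge[OF st, of "2 * i + 2" "2 * i + 3"] by auto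
    ultimately show "\<not> adjacent G (2 * i + 3) (2 * i + 2)"
      by (simp add: adjacent_def)
  qed (unfold cross_vertices_seed, use assms(3) in auto)
qed

text \<open>A capped cross-polytope is a cycle of the link that bounds in the old complex but not in
  the link, with node \<open>2 * q + 2\<close> as the old cone point. A loss needs homology of the
  link one degree higher, hence \<open>2 * q + 2\<close> dense targets.\<close>

lemma betti_step_ge:
  assumes st: "pa_stage m (Suc T) 0 G" and "T \<ge> 1" "q \<ge> 2"
  shows "betti q (pa_complex T G) + of_bool (2 * q + 2 \<le> T \<and> caps_cross_polytope q (Suc T) G) \<le>
    betti q (pa_complex (Suc T) G) + 2 ^ m * of_bool (dense_targets (2 * q + 2) (Suc T) G)"
proof -
  interpret flag "adjacent G" "{1..Suc T}"
    by (rule flag_adjacent) simp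
  let ?L = "link (adjacent G) (Suc T) {1..T}"
  let ?c = "2 * q + 2 \<le> T \<and> caps_cross_polytope q (Suc T) G"
  have "q > 0" and eq: "{1..Suc T} = insert (Suc T) {1..T}"
    using \<open>q \<ge> 2\<close> by auto
  have betti_eqs: "betti q (pa_complex T G) = betti_number {1..T} (Suc q)"
    "betti q (pa_complex (Suc T) G) = betti_number (insert (Suc T) {1..T}) (Suc q)"
    using betti_pa_complex[of T "Suc T", OF _ \<open>q > 0\<close>]
    by (simp, subst eq[symmetric], intro betti_pa_complex \<open>q > 0\<close> order.refl)
  have "cycles ?L q \<inter> boundaries {1..T} q \<noteq> boundaries ?L q" if ?c
  proof -
    have c: "seeded q G" "targets_hit (Suc T) {2..2 * q + 1} G"
      "\<And>w. (Suc T, w) \<in># G \<Longrightarrow> w \<notin> {2..2 * q + 1} \<Longrightarrow> \<exists>i<q. \<not> adjacent G w (2 * i + 2)"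
      using that by (auto simp: caps_cross_polytope_def)
    interpret X: cross_polytope "adjacent G" "{1..Suc T}" "\<lambda>i. 2 * i + 2" "\<lambda>i. 2 * i + 3" q
      using cross_polytope_seeded[OF st c(1)] that by blast
    show ?thesis
    proof (rule X.cycles_inter_boundaries_ne[of _ _ "2 * q + 2"])
      show "cross_vertices (\<lambda>i. 2 * i + 2) (\<lambda>i. 2 * i + 3) q \<subseteq> ?L"
        using c(2) unfolding cross_vertices_seed link_last_node[OF st] by (auto simp: targets_hit_def)
      show "?L \<subseteq> {1..T}"
        by (auto simp: link_def)
      show "{1..T} \<subseteq> {1..Suc T}" "2 * q + 2 \<in> {1..T}"
        using that by auto
      show "adjacent G (2 * q + 2) v" if "v \<in> cross_vertices (\<lambda>i. 2 * i + 2) (\<lambda>i. 2 * i + 3) q" for v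
      proof -
        have "{v. (2 * q + 2, v) \<in># G} = seed_targets (2 * q + 2)"
          using c(1) by (simp add: seeded_def)
        also have "\<dots> = {2..2 * q + 1}"
          using \<open>q \<ge> 2\<close> by (simp add: seed_targets_def)
        finally have "(2 * q + 2, v) \<in># G"
          using that unfolding cross_vertices_seed by blast
        then show ?thesis
          using that unfolding cross_vertices_seed by (auto simp: adjacent_def)
      qed
      show "\<exists>i<q. \<not> adjacent G w (2 * i + 2)"
        if "w \<in> ?L" "w \<notin> cross_vertices (\<lambda>i. 2 * i + 2) (\<lambda>i. 2 * i + 3) q" for w
        using that c(3)[of w] unfolding cross_vertices_seed link_last_node[OF st] by blast
    qed
  qed
  then have "betti_number {1..T} (Suc q) + of_bool ?c \<le> betti_number (insert (Suc T) {1..T}) (Suc q) +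
      (if acyclic_at ?L (Suc q) then 0 else 2 ^ card ?L)"
    using betti_number_insert_ge[of "Suc T" "{1..T}" q] by (cases ?c) auto
  also have "(if acyclic_at ?L (Suc q) then 0 else 2 ^ card ?L) \<le> (2 ^ m * of_bool (dense_targets (2 * q + 2) (Suc T) G) :: nat)"
  proof (cases "acyclic_at ?L (Suc q)")
    case False
    then have "dense_targets (2 * q + 2) (Suc T) G"
      using not_acyclic_link_imp_dense_targets[OF st, of "Suc q"] \<open>q \<ge> 2\<close> by simp
    then show ?thesis
      using False card_link_last_node[OF st \<open>T \<ge> 1\<close>] by (simp add: power_increasing)
  qed simp
  finally show ?thesis
    unfolding betti_eqs by simp
qed

section \<open>Passing to expectations\<close>

lemma pa_complex_add_edges:
  assumes "G' \<in> set_pmf (pa_add_edges \<delta> (Suc T) k G)"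
  shows "pa_complex T G' = pa_complex T G"
proof -
  have "adjacent G' u v \<longleftrightarrow> adjacent G u v" if "u \<in> {1..T}" "v \<in> {1..T}" for u v
    using add_edges_old_edges[OF assms] that by (auto simp: adjacent_def)
  then have "pairwise (adjacent G') \<sigma> \<longleftrightarrow> pairwise (adjacent G) \<sigma>" if "\<sigma> \<subseteq> {1..T}" for \<sigma>
    using that unfolding pairwise_def by (meson subsetD)
  then show ?thesis
    unfolding pa_complex_def clique_complex_def by (intro Collect_cong) (auto cong: conj_cong)
qed

context pref_attach
begin

text \<open>Edges of the new node do not touch the complex on \<open>{1..T}\<close>. This puts
  consecutive Betti numbers on one probability space, where the pathwise steps can be
  integrated.\<close>

lemma expected_betti_Suc_marginal:
  assumes "T \<ge> 2"
  shows "expect_graph (Suc T) (\<lambda>G. real (betti q (pa_complex T G))) =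
    expected_betti q T \<delta> m"
proof -
  have "expect_graph (Suc T) (\<lambda>G. real (betti q (pa_complex T G))) =
      expect_graph T (\<lambda>G. expect_edges T m G
        (\<lambda>G'. real (betti q (pa_complex T G'))))"
    by (rule expectation_graph_Suc[OF assms])
  also have "\<dots> = expect_graph T (\<lambda>G. expect_edges T m G
        (\<lambda>G'. real (betti q (pa_complex T G))))"
    by (intro expectation_cong) (simp add: pa_complex_add_edges)
  finally show ?thesis
    by (simp add: expected_betti_def)
qed

lemma expected_betti_Suc_le:
  assumes "T \<ge> 2" "q \<ge> 2"
  shows "expected_betti q (Suc T) \<delta> m \<le> expected_betti q T \<delta> m +
    2 ^ m * expect_graph (Suc T) (\<lambda>G. of_bool (dense_targets (2 * q) (Suc T) G))"
proof -
  have T: "Suc T \<ge> 2"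
    using assms(1) by simp
  have fin: "finite (set_pmf (pa_graph (Suc T) \<delta> m))"
    by (rule finite_set_pmf_graph[OF T])
  let ?E = "expect_graph (Suc T)"
  have "expected_betti q (Suc T) \<delta> m \<le>
      ?E (\<lambda>G. real (betti q (pa_complex T G)) + 2 ^ m * of_bool (dense_targets (2 * q) (Suc T) G))"
    unfolding expected_betti_def
  proof (rule expectation_mono_finite[OF fin])
    fix G assume "G \<in> set_pmf (pa_graph (Suc T) \<delta> m)"
    then have "betti q (pa_complex (Suc T) G) \<le>
        betti q (pa_complex T G) + 2 ^ m * of_bool (dense_targets (2 * q) (Suc T) G)"
      using assms by (intro betti_step_le pa_stage_graph[OF T]) auto
    then have "real (betti q (pa_complex (Suc T) G)) \<le>
        real (betti q (pa_complex T G) + 2 ^ m * of_bool (dense_targets (2 * q) (Suc T) G))"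
      by (rule of_nat_mono)
    then show "real (betti q (pa_complex (Suc T) G)) \<le>
        real (betti q (pa_complex T G)) + 2 ^ m * of_bool (dense_targets (2 * q) (Suc T) G)"
      by simp
  qed
  also have "\<dots> = ?E (\<lambda>G. real (betti q (pa_complex T G))) + ?E (\<lambda>G. 2 ^ m * of_bool (dense_targets (2 * q) (Suc T) G))"
    using fin by (intro Bochner_Integration.integral_add integrable_measure_pmf_finite)
  also have "?E (\<lambda>G. 2 ^ m * of_bool (dense_targets (2 * q) (Suc T) G)) =
      2 ^ m * (?E (\<lambda>G. of_bool (dense_targets (2 * q) (Suc T) G)) :: real)"
    by (rule integral_mult_right_zero)
  finally show ?thesis
    by (simp only: expected_betti_Suc_marginal[OF assms(1)])
qed

lemma expected_betti_Suc_ge: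
  assumes "T \<ge> 2 * q + 2" "q \<ge> 2"
  shows "expected_betti q T \<delta> m +
      expect_graph (Suc T) (\<lambda>G. of_bool (caps_cross_polytope q (Suc T) G)) \<le>
    expected_betti q (Suc T) \<delta> m +
    2 ^ m * expect_graph (Suc T) (\<lambda>G. of_bool (dense_targets (2 * q + 2) (Suc T) G))"
proof -
  have T: "T \<ge> 2" "Suc T \<ge> 2"
    using assms(1) by auto
  have fin: "finite (set_pmf (pa_graph (Suc T) \<delta> m))"
    by (rule finite_set_pmf_graph[OF T(2)])
  let ?E = "expect_graph (Suc T)"
  have "expected_betti q T \<delta> m + ?E (\<lambda>G. of_bool (caps_cross_polytope q (Suc T) G)) =
      ?E (\<lambda>G. real (betti q (pa_complex T G)) + of_bool (caps_cross_polytope q (Suc T) G))"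
    using fin unfolding expected_betti_Suc_marginal[OF T(1), symmetric]
    by (intro Bochner_Integration.integral_add[symmetric] integrable_measure_pmf_finite)
  also have "\<dots> \<le> ?E (\<lambda>G. real (betti q (pa_complex (Suc T) G)) + 2 ^ m * of_bool (dense_targets (2 * q + 2) (Suc T) G))"
  proof (rule expectation_mono_finite[OF fin])
    fix G assume "G \<in> set_pmf (pa_graph (Suc T) \<delta> m)"
    then have "betti q (pa_complex T G) + of_bool (2 * q + 2 \<le> T \<and> caps_cross_polytope q (Suc T) G) \<le>
        betti q (pa_complex (Suc T) G) + 2 ^ m * of_bool (dense_targets (2 * q + 2) (Suc T) G)"
      using assms T by (intro betti_step_ge pa_stage_graph[OF T(2)]) auto
    then have "real (betti q (pa_complex T G) + of_bool (2 * q + 2 \<le> T \<and> caps_cross_polytope q (Suc T) G)) \<le>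
        real (betti q (pa_complex (Suc T) G) + 2 ^ m * of_bool (dense_targets (2 * q + 2) (Suc T) G))"
      by (rule of_nat_mono)
    then show "real (betti q (pa_complex T G)) + of_bool (caps_cross_polytope q (Suc T) G) \<le>
        real (betti q (pa_complex (Suc T) G)) + 2 ^ m * of_bool (dense_targets (2 * q + 2) (Suc T) G)"
      using assms(1) by simp
  qed
  also have "\<dots> = ?E (\<lambda>G. real (betti q (pa_complex (Suc T) G))) + ?E (\<lambda>G. 2 ^ m * of_bool (dense_targets (2 * q + 2) (Suc T) G))"
    using fin by (intro Bochner_Integration.integral_add integrable_measure_pmf_finite)
  also have "?E (\<lambda>G. 2 ^ m * of_bool (dense_targets (2 * q + 2) (Suc T) G)) =
      2 ^ m * (?E (\<lambda>G. of_bool (dense_targets (2 * q + 2) (Suc T) G)) :: real)"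
    by (rule integral_mult_right_zero)
  finally show ?thesis
    by (simp only: expected_betti_def)
qed

lemma expected_betti_increment_le:
  assumes "q \<ge> 2"
  shows "\<exists>C>0. \<forall>T\<ge>2. expected_betti q (Suc T) \<delta> m - expected_betti q T \<delta> m \<le>
    C * real (Suc T) powr (- (2 * real q * chi))"
proof -
  obtain C where "C > 0 \<and> (\<forall>T\<ge>2. expect_graph (Suc T)
      (\<lambda>G. of_bool (dense_targets (2 * q) (Suc T) G)) \<le> C * real (Suc T) powr (- real (2 * q) * chi))"
    using prob_dense_targets_le[of "2 * q"] by (rule exE)
  note C = conjunct1[OF this] conjunct2[OF this, rule_format]
  show ?thesis
  proof (intro exI[of _ "2 ^ m * C"] conjI allI impI)
    show "2 ^ m * C > 0"
      using C(1) by simp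
    fix T :: nat assume T: "2 \<le> T"
    have "expected_betti q (Suc T) \<delta> m - expected_betti q T \<delta> m \<le> 2 ^ m *
        expect_graph (Suc T) (\<lambda>G. of_bool (dense_targets (2 * q) (Suc T) G))"
      using expected_betti_Suc_le[OF T assms] by linarith
    also have "\<dots> \<le> 2 ^ m * (C * real (Suc T) powr (- real (2 * q) * chi))"
      by (intro mult_left_mono C(2) T) simp
    finally show "expected_betti q (Suc T) \<delta> m - expected_betti q T \<delta> m \<le>
        2 ^ m * C * real (Suc T) powr (- (2 * real q * chi))"
      by (simp add: mult.assoc)
  qed
qed

lemma expected_betti_increment_ge:
  assumes "q \<ge> 2" "2 * q \<le> m"
  shows "\<exists>c>0. \<forall>\<^sub>F T in sequentially. c * real (Suc T) powr (- (2 * real q * chi)) \<le>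
    expected_betti q (Suc T) \<delta> m - expected_betti q T \<delta> m"
proof -
  obtain C where "C > 0 \<and> (\<forall>T\<ge>2. expect_graph (Suc T)
      (\<lambda>G. of_bool (dense_targets (2 * q + 2) (Suc T) G)) \<le> C * real (Suc T) powr (- real (2 * q + 2) * chi))"
    using prob_dense_targets_le[of "2 * q + 2"] by (rule exE)
  note C = conjunct1[OF this] conjunct2[OF this, rule_format]
  obtain c where "c > 0 \<and> (\<forall>\<^sub>F T in sequentially. c * real (Suc T) powr (- 2 * real q * chi) \<le>
    expect_graph (Suc T) (\<lambda>G. of_bool (caps_cross_polytope q (Suc T) G)))"
    using prob_caps_cross_polytope_ge[OF assms] by (rule exE)
  note c = conjunct1[OF this] conjunct2[OF this]
  \<comment> \<open>The loss has two more factors \<open>T powr (- chi)\<close> than the gain, so it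
    is eventually at most half of it.\<close>
  have "eventually (\<lambda>T. 2 ^ m * C * real (Suc T) powr (- 2 * chi) \<le> c / 2) sequentially"
  proof -
    have "((\<lambda>T. 2 ^ m * C * real (Suc T) powr (- 2 * chi)) \<longlongrightarrow> 2 ^ m * C * 0) sequentially"
      using chi_bounds
      by (intro tendsto_intros tendsto_neg_powr filterlim_compose[OF filterlim_real_sequentially filterlim_Suc]) auto
    then have "eventually (\<lambda>T. 2 ^ m * C * real (Suc T) powr (- 2 * chi) < c / 2) sequentially"
      using c(1) by (intro order_tendstoD(2)) auto
    then show ?thesis
      by (rule eventually_mono) simp
  qed
  then have "\<forall>\<^sub>F T in sequentially. c / 2 * real (Suc T) powr (- (2 * real q * chi)) \<le>
    expected_betti q (Suc T) \<delta> m - expected_betti q T \<delta> m"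
    using c(2) eventually_ge_at_top[of "2 * q + 2"]
  proof eventually_elim
    case (elim T)
    let ?p = "real (Suc T) powr (- (2 * real q * chi))"
    have "2 ^ m * (C * real (Suc T) powr (- real (2 * q + 2) * chi)) =
        2 ^ m * C * real (Suc T) powr (- 2 * chi) * ?p"
      by (simp add: algebra_simps flip: powr_add)
    also have "\<dots> \<le> c / 2 * ?p"
      using elim(1) by (intro mult_right_mono) auto
    finally have le: "2 ^ m * (C * real (Suc T) powr (- real (2 * q + 2) * chi)) \<le> c / 2 * ?p" .
    have "2 ^ m * expect_graph (Suc T)
        (\<lambda>G. of_bool (dense_targets (2 * q + 2) (Suc T) G)) \<le>
        2 ^ m * (C * real (Suc T) powr (- real (2 * q + 2) * chi))"
      using elim(3) by (intro mult_left_mono C(2)) auto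
    then have "2 ^ m * expect_graph (Suc T)
        (\<lambda>G. of_bool (dense_targets (2 * q + 2) (Suc T) G)) \<le> c / 2 * ?p"
      using le by (rule order.trans)
    moreover have "c * ?p \<le> expect_graph (Suc T) (\<lambda>G. of_bool (caps_cross_polytope q (Suc T) G))"
      using elim(2) by simp
    ultimately show ?case
      using expected_betti_Suc_ge[OF elim(3) assms(1)] by linarith
  qed
  then show ?thesis
    using c(1) by (intro exI[of _ "c / 2"]) auto
qed

end


section \<open>Sequences with power-law increments\<close>

text \<open>Mean value theorem. Keeping the antiderivative \<open>h\<close> abstract treats powers
  and the logarithm together.\<close>

lemma increment_bounds:
  fixes h :: "real \<Rightarrow> real" and a :: real
  assumes "a > 0" "\<And>x. x > 0 \<Longrightarrow> (h has_real_derivative x powr (- a)) (at x)" "T \<ge> 1"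
  shows "real (Suc T) powr (- a) \<le> h (real (Suc T)) - h (real T)"
    and "h (real (Suc T)) - h (real T) \<le> 2 powr a * real (Suc T) powr (- a)"
proof -
  obtain z where z: "real T < z" "z < real (Suc T)" "h (real (Suc T)) - h (real T) = z powr (- a)"
    using MVT2[of "real T" "real (Suc T)" h "\<lambda>x. x powr (- a)"] assms by auto
  show "real (Suc T) powr (- a) \<le> h (real (Suc T)) - h (real T)"
    unfolding z(3) using z assms by (intro powr_mono2') auto
  \<comment> \<open>\<open>z > T\<close>, and \<open>T \<ge> 1\<close> gives
    \<open>T \<ge> Suc T / 2\<close>.\<close>
  have "z powr (- a) \<le> (real (Suc T) / 2) powr (- a)"
    using z assms by (intro powr_mono2') auto
  also have "\<dots> = 2 powr a * real (Suc T) powr (- a)"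
    by (simp add: powr_divide powr_minus field_simps)
  finally show "h (real (Suc T)) - h (real T) \<le> 2 powr a * real (Suc T) powr (- a)"
    unfolding z(3) .
qed

lemma power_law_increments_le:
  fixes f :: "nat \<Rightarrow> real" and h :: "real \<Rightarrow> real"
  assumes "a > 0" "\<And>x. x > 0 \<Longrightarrow> (h has_real_derivative x powr (- a)) (at x)"
    and C: "C > 0" "\<And>T. T \<ge> 2 \<Longrightarrow> f (Suc T) - f T \<le> C * real (Suc T) powr (- a)"
    and "T \<ge> 2"
  shows "f T \<le> C * h (real T) + (f 2 - C * h 2)"
  using \<open>T \<ge> 2\<close>
proof (induction T rule: dec_induct)
  case (step T)
  have "f (Suc T) - f T \<le> C * (h (real (Suc T)) - h (real T))"
    using C(2)[of T] increment_bounds(1)[OF assms(1,2), of T] C(1) step.hyps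
    by (smt (verit, ccfv_SIG) mult_left_mono one_le_numeral order.trans)
  then show ?case
    using step.IH by (simp add: algebra_simps)
qed simp

lemma power_law_increments_ge:
  fixes f :: "nat \<Rightarrow> real" and h :: "real \<Rightarrow> real"
  assumes "a > 0" "\<And>x. x > 0 \<Longrightarrow> (h has_real_derivative x powr (- a)) (at x)"
    and c: "c > 0" "\<forall>\<^sub>F T in sequentially. c * real (Suc T) powr (- a) \<le> f (Suc T) - f T"
  shows "\<exists>c'>0. \<exists>d. \<forall>\<^sub>F T in sequentially. c' * h (real T) + d \<le> f T"
proof -
  obtain N where N: "\<And>T. T \<ge> N \<Longrightarrow> c * real (Suc T) powr (- a) \<le> f (Suc T) - f T"
    using c(2) by (auto simp: eventually_sequentially)
  define M where "M = max 1 N"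
  define c' where "c' = c / 2 powr a"
  have "c' * h (real T) + (f M - c' * h (real M)) \<le> f T" if "T \<ge> M" for T
    using that
  proof (induction T rule: dec_induct)
    case (step T)
    have "c' * (h (real (Suc T)) - h (real T)) \<le> c' * (2 powr a * real (Suc T) powr (- a))"
      using increment_bounds(2)[OF assms(1,2), of T] step.hyps c(1)
      by (intro mult_left_mono) (auto simp: M_def c'_def)
    also have "\<dots> = c * real (Suc T) powr (- a)"
      by (simp add: c'_def)
    also have "\<dots> \<le> f (Suc T) - f T"
      using N[of T] step.hyps by (simp add: M_def)
    finally show ?case
      using step.IH by (simp add: algebra_simps)
  qed simp
  then have "\<forall>\<^sub>F T in sequentially. c' * h (real T) + (f M - c' * h (real M)) \<le> f T"
    by (auto simp: eventually_sequentially)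
  moreover have "c' > 0"
    using c(1) by (simp add: c'_def)
  ultimately show ?thesis
    by blast
qed

text \<open>As \<open>H\<close> tends to infinity, additive constants of either sign are eventually
  absorbed: \<open>D\<close> by one more copy of \<open>H\<close>, and \<open>d\<close> by half of
  \<open>c * H\<close>.\<close>

lemma bigtheta_affine_bounds:
  fixes f H :: "nat \<Rightarrow> real"
  assumes H: "filterlim H at_top sequentially" and "C > 0" "c > 0"
    and upper: "\<forall>\<^sub>F T in sequentially. f T \<le> C * H T + D"
    and lower: "\<forall>\<^sub>F T in sequentially. c * H T + d \<le> f T"
    and nonneg: "\<And>T. f T \<ge> 0"
  shows "f \<in> \<Theta>(H)"
proof
  have ev: "\<forall>\<^sub>F T in sequentially. H T \<ge> B" for B
    using H by (simp add: filterlim_at_top)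
  show "f \<in> O(H)"
  proof (rule bigoI)
    show "\<forall>\<^sub>F T in sequentially. norm (f T) \<le> (C + 1) * norm (H T)"
      using upper ev[of "max 0 D"]
    proof eventually_elim
      case (elim T)
      then show ?case
        using nonneg[of T] by (simp add: algebra_simps)
    qed
  qed
  show "f \<in> \<Omega>(H)"
    unfolding bigomega_iff_bigo
  proof (rule bigoI)
    show "\<forall>\<^sub>F T in sequentially. norm (H T) \<le> 2 / c * norm (f T)"
      using lower ev[of "max 0 (- 2 * d / c)"]
    proof eventually_elim
      case (elim T)
      have "- 2 * d \<le> c * H T"
        using elim(2) \<open>c > 0\<close> by (simp add: field_simps)
      then have "c * H T \<le> 2 * f T"
        using elim(1) by linarith
      then show ?case
        using elim(2) nonneg[of T] \<open>c > 0\<close> by (simp add: field_simps)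
    qed
  qed
qed

theorem theorem3:
  fixes m q :: nat and \<delta> :: real
  assumes "m > 0" and "- real m < \<delta>" and "\<delta> < 0"
    and "q \<ge> 2" and "m \<ge> 2 * q"
  shows "(1 - 2 * real q * pa_chi \<delta> m > 0 \<longrightarrow>
            (\<lambda>T. expected_betti q T \<delta> m) \<in> \<Theta>(\<lambda>T. real T powr (1 - 2 * real q * pa_chi \<delta> m))) \<and>
         (1 - 2 * real q * pa_chi \<delta> m = 0 \<longrightarrow>
            (\<lambda>T. expected_betti q T \<delta> m) \<in> \<Theta>(\<lambda>T. ln (real T))) \<and>
         (1 - 2 * real q * pa_chi \<delta> m < 0 \<longrightarrow>
            (\<lambda>T. expected_betti q T \<delta> m) \<in> O(\<lambda>_. 1))"
proof -
  interpret pref_attach m \<delta>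
    using assms by unfold_locales
  define a where "a = 2 * real q * pa_chi \<delta> m"
  define f where "f = (\<lambda>T. expected_betti q T \<delta> m)"
  have a: "a > 0"
    using chi_bounds assms(4) by (simp add: a_def)
  have nonneg: "f T \<ge> 0" for T
    by (simp add: f_def expected_betti_def)
  obtain C where C: "C > 0" "\<And>T. T \<ge> 2 \<Longrightarrow> f (Suc T) - f T \<le> C * real (Suc T) powr (- a)"
    using expected_betti_increment_le[OF assms(4)] unfolding f_def a_def by auto
  obtain c where c: "c > 0" "\<forall>\<^sub>F T in sequentially. c * real (Suc T) powr (- a) \<le> f (Suc T) - f T"
    using expected_betti_increment_ge[OF assms(4,5)] unfolding f_def a_def by auto
  have powr_deriv: "((\<lambda>x. x powr (1 - a) / (1 - a)) has_real_derivative x powr (- a)) (at x)"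
    if "x > 0" "a \<noteq> 1" for x
    using that by (auto intro!: derivative_eq_intros)
  have "f \<in> \<Theta>(\<lambda>T. real T powr (1 - a))" if "1 - a > 0"
  proof -
    let ?h = "\<lambda>x. x powr (1 - a) / (1 - a)"
    have h: "x > 0 \<Longrightarrow> (?h has_real_derivative x powr (- a)) (at x)" for x
      using powr_deriv that by simp
    obtain c' d where c': "c' > 0" "\<forall>\<^sub>F T in sequentially. c' * ?h (real T) + d \<le> f T"
      using power_law_increments_ge[OF a h c] by blast
    show ?thesis
    proof (rule bigtheta_affine_bounds[of _ "C / (1 - a)" "c' / (1 - a)"])
      show "filterlim (\<lambda>T. real T powr (1 - a)) at_top sequentially"
        using that by real_asymp
      show "\<forall>\<^sub>F T in sequentially. f T \<le> C / (1 - a) * real T powr (1 - a) + (f 2 - C * ?h 2)"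
        using eventually_ge_at_top[of 2]
        by eventually_elim (use power_law_increments_le[OF a h C] in simp)
      show "\<forall>\<^sub>F T in sequentially. c' / (1 - a) * real T powr (1 - a) + d \<le> f T"
        using c'(2) by simp
    qed (use that C(1) c'(1) nonneg in auto)
  qed
  moreover have "f \<in> \<Theta>(\<lambda>T. ln (real T))" if "1 - a = 0"
  proof -
    have h: "x > 0 \<Longrightarrow> (ln has_real_derivative x powr (- a)) (at x)" for x :: real
      using that by (auto intro!: derivative_eq_intros simp: powr_minus field_simps)
    obtain c' d where c': "c' > 0" "\<forall>\<^sub>F T in sequentially. c' * ln (real T) + d \<le> f T"
      using power_law_increments_ge[OF a h c] by blast
    show ?thesis
    proof (rule bigtheta_affine_bounds[OF _ C(1) c'(1) _ c'(2)])
      show "filterlim (\<lambda>T. ln (real T)) at_top sequentially"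
        by real_asymp
      show "\<forall>\<^sub>F T in sequentially. f T \<le> C * ln (real T) + (f 2 - C * ln 2)"
        using eventually_ge_at_top[of 2]
        by eventually_elim (use power_law_increments_le[OF a h C] in simp)
    qed (rule nonneg)
  qed
  moreover have "f \<in> O(\<lambda>_. 1)" if "1 - a < 0"
  proof (rule bigoI)
    let ?h = "\<lambda>x. x powr (1 - a) / (1 - a)"
    have h: "x > 0 \<Longrightarrow> (?h has_real_derivative x powr (- a)) (at x)" for x
      using powr_deriv that by simp
    show "\<forall>\<^sub>F T in sequentially. norm (f T) \<le> (f 2 - C * ?h 2) * norm (1 :: real)"
      using eventually_ge_at_top[of 2]
    proof eventually_elim
      case (elim T)
      \<comment> \<open>For \<open>a > 1\<close> the antiderivative is negative, so the upper bound
        reduces to its constant term.\<close>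
      have "C * ?h (real T) \<le> 0"
        using that C(1) by (simp add: divide_nonneg_neg mult_nonneg_nonpos)
      then show ?case
        using power_law_increments_le[OF a h C elim] nonneg[of T] by simp
    qed
  qed
  ultimately show ?thesis
    unfolding f_def a_def by blast
qed

end
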